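(* Let $(E,\mathcal{L},\mathcal{B})$ be a weakly left-resolving labeled space and let $A\in\mathcal{B}$ be a minimal sinks set. Then $$I_A=\overline{\mathrm{span}}\{s_\alpha p_A s_\beta^*:\alpha,\beta\in\mathcal{L}^{\#}(E)\}$$ is a closed two-sided ideal of $C^*(E,\mathcal{L},\mathcal{B})$, which is isomorphic to $\mathcal{K}(\ell^2(\mathcal{L}^*(A)))$ (the compact operators on $\ell^2(\mathcal{L}^*(A))$), where $$\mathcal{L}^*(A):=\{\alpha:\ \alpha\in\mathcal{L}^*(E)\text{ and }r(\alpha)\supseteq A,\ \text{or }\alpha=\epsilon\}.$$
   Context: A directed graph $E=(E^0,E^1,s,r)$ consists of countable sets $E^0$ (vertices) and $E^1$ (edges) and maps $s,r:E^1\to E^0$ (source and range); a sink is a vertex that is not the source of any edge, and $E^0_{sink}$ is the set of sinks (which may be non-empty). $E^n$ is the set of paths $e_1\cdots e_n$ of length $n$ (so $r(e_i)=s(e_{i+1})$), with $s(e_1\cdots e_n)=s(e_1)$ and $r(e_1\cdots e_n)=r(e_n)$. A labeling is a function $\mathcal{L}:E^1\to\mathcal{A}$ into an alphabet $\mathcal{A}$, assumed onto; it extends to paths by $\mathcal{L}(e_1\cdots e_n)=\mathcal{L}(e_1)\cdots\mathcal{L}(e_n)$. Put $\mathcal{L}^*(E)=\bigcup_{n\ge1}\mathcal{L}(E^n)$ and $\mathcal{L}^{\#}(E)=\mathcal{L}^*(E)\cup\{\epsilon\}$, with $\epsilon$ the empty word. For $\alpha\in\mathcal{L}(E^n)$,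 $r(\alpha)=\{r(p):p\in E^n,\mathcal{L}(p)=\alpha\}\subseteq E^0$; for $A\subseteq E^0$, $r(A,\alpha)=\{r(p):\mathcal{L}(p)=\alpha,\ s(p)\in A\}$ and $\mathcal{L}(AE^1)=\{\mathcal{L}(e):e\in E^1,\ s(e)\in A\}$. A non-empty $\mathcal{B}\subseteq 2^{E^0}$ (assumed $\neq\{\emptyset\}$) is accommodating if $r(\alpha)\in\mathcal{B}$ for all $\alpha\in\mathcal{L}^*(E)$, $r(A,\alpha)\in\mathcal{B}$ for all $A\in\mathcal{B}$, $\alpha\in\mathcal{L}^*(E)$, and $\mathcal{B}$ is closed under finite intersections and unions. Then $(E,\mathcal{L},\mathcal{B})$ is called a labeled space. It is weakly left-resolving if $r(A\cap B,\alpha)=r(A,\alpha)\cap r(B,\alpha)$ for all $A,B\in\mathcal{B}$, $\alpha\in\mathcal{L}^*(E)$. A non-empty element $A$ of $\mathcal{B}$ is a minimal sinks set if $A\subseteq E^0_{sink}$ and for every $B\in\mathcal{B}$ either $A\subseteq B$ or $A\cap B=\emptyset$. A representation of a weakly left-resolving labeled space $(E,\mathcal{L},\mathcal{B})$ in a $C^*$-algebra consists of projections $\{p_A:A\in\mathcal{B}\}$ and partial isometries $\{s_a:a\in\mathcal{A}\}$ such that: (1) $p_Ap_B=p_{A\cap B}$ and $p_{A\cup B}=p_A+p_B-p_{A\cap B}$ for $A,B\in\mathcal{B}$; (2) $s_a^*s_b=\delta_{a,b}\,p_{r(a)}$ for $a,b\in\mathcal{A}$; (3) $s_a^*p_A=p_{r(A,a)}s_a^*$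 for $a\in\mathcal{A}$, $A\in\mathcal{B}$; (4) for $A\in\mathcal{B}$ with $\mathcal{L}(AE^1)$ finite and $A$ containing no sink, $p_A=\sum_{a\in\mathcal{L}(AE^1)}s_ap_{r(A,a)}s_a^*$. The labeled graph $C^*$-algebra $C^*(E,\mathcal{L},\mathcal{B})$ is the $C^*$-algebra generated by a universal representation, whose generators are denoted $p_A,s_a$. For a word $\mu=a_1\cdots a_n$, $s_\mu=s_{a_1}\cdots s_{a_n}$, and $s_\epsilon$ denotes the unit of the multiplier algebra of $C^*(E,\mathcal{L},\mathcal{B})$. *)

theory Defs
  imports
    "HOL-Analysis.Analysis"
    "HOL-Algebra.Module"
    "HOL-Algebra.Algebraic_Closure_Type"
    "Graph_Theory.Arc_Walk"
begin

section \<open>C*-algebras\<close>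

text \<open>
  C*-algebras are records with an explicit carrier, so that ideals are again structures of the
  same type and so that one can quantify over all C*-algebras whose elements have a given type.
  The field \<^term>\<open>one\<close> inherited from \<^theory>\<open>HOL-Algebra.Module\<close> carries no
  meaning: C*-algebras need not be unital.
\<close>

record 'c cstar = "(complex, 'c) module" +
  adj :: "'c \<Rightarrow> 'c"
  cnorm :: "'c \<Rightarrow> real"

text \<open>
  The metric is 0 off the carrier because \<^locale>\<open>Metric_space\<close> requires non-negativity and
  symmetry for all elements of the type.
\<close>

definition cdist :: "'c cstar \<Rightarrow> 'c \<Rightarrow> 'c \<Rightarrow> real" where
  "cdist C x y = (if x \<in> carrier C \<and> y \<in> carrier C then cnorm C (x \<ominus>\<^bsub>C\<^esub> y) else 0)"

abbreviation ctopology :: "'c cstar \<Rightarrow> 'c topology" where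
  "ctopology C \<equiv> Metric_space.mtopology (carrier C) (cdist C)"

locale cstar_algebra = module "ring_of_type_algebra :: complex ring" C for C :: "'c cstar" (structure) +
  assumes mult_closed: "\<lbrakk>x \<in> carrier C; y \<in> carrier C\<rbrakk> \<Longrightarrow> x \<otimes>\<^bsub>C\<^esub> y \<in> carrier C"
    and mult_assoc: "\<lbrakk>x \<in> carrier C; y \<in> carrier C; z \<in> carrier C\<rbrakk>
      \<Longrightarrow> (x \<otimes>\<^bsub>C\<^esub> y) \<otimes>\<^bsub>C\<^esub> z = x \<otimes>\<^bsub>C\<^esub> (y \<otimes>\<^bsub>C\<^esub> z)"
    and mult_add_left: "\<lbrakk>x \<in> carrier C; y \<in> carrier C; z \<in> carrier C\<rbrakk>
      \<Longrightarrow> (x \<oplus>\<^bsub>C\<^esub> y) \<otimes>\<^bsub>C\<^esub> z = x \<otimes>\<^bsub>C\<^esub> z \<oplus>\<^bsub>C\<^esub> y \<otimes>\<^bsub>C\<^esub> z"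
    and mult_add_right: "\<lbrakk>x \<in> carrier C; y \<in> carrier C; z \<in> carrier C\<rbrakk>
      \<Longrightarrow> z \<otimes>\<^bsub>C\<^esub> (x \<oplus>\<^bsub>C\<^esub> y) = z \<otimes>\<^bsub>C\<^esub> x \<oplus>\<^bsub>C\<^esub> z \<otimes>\<^bsub>C\<^esub> y"
    and mult_smult_left: "\<lbrakk>x \<in> carrier C; y \<in> carrier C\<rbrakk>
      \<Longrightarrow> (c \<odot>\<^bsub>C\<^esub> x) \<otimes>\<^bsub>C\<^esub> y = c \<odot>\<^bsub>C\<^esub> (x \<otimes>\<^bsub>C\<^esub> y)"
    and mult_smult_right: "\<lbrakk>x \<in> carrier C; y \<in> carrier C\<rbrakk>
      \<Longrightarrow> x \<otimes>\<^bsub>C\<^esub> (c \<odot>\<^bsub>C\<^esub> y) = c \<odot>\<^bsub>C\<^esub> (x \<otimes>\<^bsub>C\<^esub> y)"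
    and adj_closed: "x \<in> carrier C \<Longrightarrow> adj C x \<in> carrier C"
    and adj_adj: "x \<in> carrier C \<Longrightarrow> adj C (adj C x) = x"
    and adj_add: "\<lbrakk>x \<in> carrier C; y \<in> carrier C\<rbrakk>
      \<Longrightarrow> adj C (x \<oplus>\<^bsub>C\<^esub> y) = adj C x \<oplus>\<^bsub>C\<^esub> adj C y"
    and adj_smult: "x \<in> carrier C \<Longrightarrow> adj C (c \<odot>\<^bsub>C\<^esub> x) = cnj c \<odot>\<^bsub>C\<^esub> adj C x"
    and adj_mult: "\<lbrakk>x \<in> carrier C; y \<in> carrier C\<rbrakk>
      \<Longrightarrow> adj C (x \<otimes>\<^bsub>C\<^esub> y) = adj C y \<otimes>\<^bsub>C\<^esub> adj C x"
    and cnorm_eq_0_iff: "x \<in> carrier C \<Longrightarrow> cnorm C x = 0 \<longleftrightarrow> x = \<zero>\<^bsub>C\<^esub>"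
    and cnorm_smult: "x \<in> carrier C \<Longrightarrow> cnorm C (c \<odot>\<^bsub>C\<^esub> x) = cmod c * cnorm C x"
    and cnorm_triangle: "\<lbrakk>x \<in> carrier C; y \<in> carrier C\<rbrakk>
      \<Longrightarrow> cnorm C (x \<oplus>\<^bsub>C\<^esub> y) \<le> cnorm C x + cnorm C y"
    and cnorm_mult: "\<lbrakk>x \<in> carrier C; y \<in> carrier C\<rbrakk>
      \<Longrightarrow> cnorm C (x \<otimes>\<^bsub>C\<^esub> y) \<le> cnorm C x * cnorm C y"
    and cstar_identity: "x \<in> carrier C \<Longrightarrow> cnorm C (adj C x \<otimes>\<^bsub>C\<^esub> x) = (cnorm C x)\<^sup>2"
    and complete: "Metric_space.mcomplete (carrier C) (cdist C)"

lemma (in cstar_algebra) smult_in [simp]: "x \<in> carrier C \<Longrightarrow> c \<odot> x \<in> carrier C"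
  by (simp add: ring_of_type_algebra_def)

lemma (in cstar_algebra) smult_minus_one:
  assumes "x \<in> carrier C" shows "(-1) \<odot> x = \<ominus> x"
proof -
  have 1: "1 \<odot> x = x" using smult_one[OF assms] by (simp add: ring_of_type_algebra_def)
  have add: "(a + b) \<odot> x = a \<odot> x \<oplus> b \<odot> x" for a b
    using smult_l_distr[of a b x] assms by (simp add: ring_of_type_algebra_def)
  have "(0::complex) \<odot> x \<oplus> 0 \<odot> x = 0 \<odot> x" using add[of 0 0] by simp
  then have "(0::complex) \<odot> x = \<zero>" using assms by (metis M.add.l_cancel_one' smult_in)
  then have "(-1) \<odot> x \<oplus> x = \<zero>" using add[of "-1" 1] 1 by simp
  then show ?thesis using assms M.minus_equality[of "(-1) \<odot> x" x] by simp
qed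

lemma (in cstar_algebra) minus_eq_smult:
  "\<lbrakk>x \<in> carrier C; y \<in> carrier C\<rbrakk> \<Longrightarrow> x \<ominus> y = x \<oplus> (-1) \<odot> y"
  by (simp add: a_minus_def smult_minus_one)

lemma (in cstar_algebra) Metric_space_cdist: "Metric_space (carrier C) (cdist C)"
proof -
  have nonneg: "0 \<le> cnorm C x" if x: "x \<in> carrier C" for x
  proof -
    have "cnorm C (x \<oplus> (-1) \<odot> x) \<le> cnorm C x + cnorm C ((-1) \<odot> x)"
      using x by (intro cnorm_triangle) auto
    moreover have "x \<oplus> (-1) \<odot> x = \<zero>" using x by (simp add: smult_minus_one M.r_neg)
    moreover have "cnorm C \<zero> = 0" by (simp add: cnorm_eq_0_iff)
    ultimately show ?thesis using cnorm_smult[OF x, of "-1"] by simp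
  qed
  have cl: "x \<ominus> y \<in> carrier C" if "x \<in> carrier C" "y \<in> carrier C" for x y
    using that by simp
  have comm: "cnorm C (x \<ominus> y) = cnorm C (y \<ominus> x)" if xy: "x \<in> carrier C" "y \<in> carrier C" for x y
  proof -
    have "y \<ominus> x = \<ominus> (x \<ominus> y)"
      using xy by (simp add: a_minus_def M.minus_add M.a_comm)
    then have "y \<ominus> x = (-1) \<odot> (x \<ominus> y)" using cl[OF xy] smult_minus_one by simp
    then show ?thesis using cnorm_smult[OF cl[OF xy], of "-1"] by simp
  qed
  have zero: "cnorm C (x \<ominus> y) = 0 \<longleftrightarrow> x = y" if "x \<in> carrier C" "y \<in> carrier C" for x y
  proof -
    have "x \<ominus> y \<oplus> y = x" using that by (simp add: a_minus_def M.a_assoc M.l_neg)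
    then have "x \<ominus> y = \<zero> \<longleftrightarrow> x = y" using that by (auto simp: a_minus_def M.r_neg)
    then show ?thesis using cnorm_eq_0_iff[OF cl[OF that]] by simp
  qed
  have tri: "cnorm C (x \<ominus> z) \<le> cnorm C (x \<ominus> y) + cnorm C (y \<ominus> z)"
    if "x \<in> carrier C" "y \<in> carrier C" "z \<in> carrier C" for x y z
  proof -
    have "x \<ominus> z = (x \<ominus> y) \<oplus> (y \<ominus> z)"
      using that by (simp add: a_minus_def M.a_assoc M.r_neg1)
    then show ?thesis using cnorm_triangle cl that by simp
  qed
  show ?thesis
    by unfold_locales (use nonneg cl comm zero tri in \<open>auto simp: cdist_def\<close>)
qed

lemma cstar_algebra_pullback:
  fixes D :: "'d cstar" and E :: "'e cstar" and h :: "'e \<Rightarrow> 'd"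
  assumes D: "cstar_algebra D"
    and inj: "inj_on h (carrier E)"
    and clo: "closedin (ctopology D) (h ` carrier E)"
    and zero: "\<zero>\<^bsub>E\<^esub> \<in> carrier E" "h \<zero>\<^bsub>E\<^esub> = \<zero>\<^bsub>D\<^esub>"
    and add: "\<And>x y. \<lbrakk>x \<in> carrier E; y \<in> carrier E\<rbrakk> \<Longrightarrow> x \<oplus>\<^bsub>E\<^esub> y \<in> carrier E"
      "\<And>x y. \<lbrakk>x \<in> carrier E; y \<in> carrier E\<rbrakk> \<Longrightarrow> h (x \<oplus>\<^bsub>E\<^esub> y) = h x \<oplus>\<^bsub>D\<^esub> h y"
    and mult: "\<And>x y. \<lbrakk>x \<in> carrier E; y \<in> carrier E\<rbrakk> \<Longrightarrow> x \<otimes>\<^bsub>E\<^esub> y \<in> carrier E"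
      "\<And>x y. \<lbrakk>x \<in> carrier E; y \<in> carrier E\<rbrakk> \<Longrightarrow> h (x \<otimes>\<^bsub>E\<^esub> y) = h x \<otimes>\<^bsub>D\<^esub> h y"
    and smult: "\<And>c x. x \<in> carrier E \<Longrightarrow> c \<odot>\<^bsub>E\<^esub> x \<in> carrier E"
      "\<And>c x. x \<in> carrier E \<Longrightarrow> h (c \<odot>\<^bsub>E\<^esub> x) = c \<odot>\<^bsub>D\<^esub> h x"
    and adj: "\<And>x. x \<in> carrier E \<Longrightarrow> adj E x \<in> carrier E"
      "\<And>x. x \<in> carrier E \<Longrightarrow> h (adj E x) = adj D (h x)"
    and cnorm: "\<And>x. x \<in> carrier E \<Longrightarrow> cnorm E x = cnorm D (h x)"
  shows "cstar_algebra E"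
proof -
  interpret D: cstar_algebra D by (rule D)
  interpret MD: Metric_space "carrier D" "cdist D" by (rule D.Metric_space_cdist)
  have hD: "h x \<in> carrier D" if "x \<in> carrier E" for x
    using closedin_subset[OF clo] that by auto
  have eqI: "x = y" if "h x = h y" "x \<in> carrier E" "y \<in> carrier E" for x y
    using inj that by (auto dest: inj_onD)
  note h_simps = zero add mult smult adj hD
  have one: "1 \<odot>\<^bsub>D\<^esub> x = x" if "x \<in> carrier D" for x
    using D.smult_one[OF that] by (simp add: ring_of_type_algebra_def)
  have r: "(a * b) \<odot>\<^bsub>D\<^esub> x = a \<odot>\<^bsub>D\<^esub> (b \<odot>\<^bsub>D\<^esub> x)" "(a + b) \<odot>\<^bsub>D\<^esub> x = a \<odot>\<^bsub>D\<^esub> x \<oplus>\<^bsub>D\<^esub> b \<odot>\<^bsub>D\<^esub> x"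
    if "x \<in> carrier D" for a b x
    using D.smult_assoc1[of a b x] D.smult_l_distr[of a b x] that
    by (simp_all add: ring_of_type_algebra_def)
  have r': "a \<odot>\<^bsub>D\<^esub> (x \<oplus>\<^bsub>D\<^esub> y) = a \<odot>\<^bsub>D\<^esub> x \<oplus>\<^bsub>D\<^esub> a \<odot>\<^bsub>D\<^esub> y"
    if "x \<in> carrier D" "y \<in> carrier D" for a x y
    using D.smult_r_distr[of a x y] that by (simp add: ring_of_type_algebra_def)
  have grp: "abelian_group E"
  proof (rule abelian_groupI)
    fix x assume x: "x \<in> carrier E"
    have "(-1) \<odot>\<^bsub>E\<^esub> x \<oplus>\<^bsub>E\<^esub> x = \<zero>\<^bsub>E\<^esub>"
      by (rule eqI) (use x in \<open>simp_all add: h_simps D.smult_minus_one D.M.l_neg\<close>)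
    then show "\<exists>y\<in>carrier E. y \<oplus>\<^bsub>E\<^esub> x = \<zero>\<^bsub>E\<^esub>" using smult x by blast
  qed (auto intro!: eqI simp: h_simps D.M.a_ac)
  have module: "module (ring_of_type_algebra :: complex ring) E"
    by (rule moduleI[OF cring_from_type_algebra grp])
      (auto intro!: eqI simp: h_simps ring_of_type_algebra_def one r r')
  interpret E: module "ring_of_type_algebra :: complex ring" E by (rule module)
  have minus: "x \<ominus>\<^bsub>E\<^esub> y \<in> carrier E" "h (x \<ominus>\<^bsub>E\<^esub> y) = h x \<ominus>\<^bsub>D\<^esub> h y"
    if "x \<in> carrier E" "y \<in> carrier E" for x y
  proof -
    have "\<ominus>\<^bsub>E\<^esub> y = (-1) \<odot>\<^bsub>E\<^esub> y"
    proof (rule E.M.minus_equality)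
      show "(-1) \<odot>\<^bsub>E\<^esub> y \<oplus>\<^bsub>E\<^esub> y = \<zero>\<^bsub>E\<^esub>"
        by (rule eqI) (use that in \<open>simp_all add: h_simps D.smult_minus_one D.M.l_neg\<close>)
    qed (use that smult in auto)
    then show "x \<ominus>\<^bsub>E\<^esub> y \<in> carrier E" "h (x \<ominus>\<^bsub>E\<^esub> y) = h x \<ominus>\<^bsub>D\<^esub> h y"
      using that by (simp_all add: a_minus_def h_simps D.smult_minus_one)
  qed
  have dist: "cdist E x y = cdist D (h x) (h y)" if "x \<in> carrier E" "y \<in> carrier E" for x y
    using that by (simp add: cdist_def minus cnorm hD)
  have ME: "Metric_space (carrier E) (cdist E)"
  proof
    show "0 \<le> cdist E x y" for x y
      using dist[of x y] MD.nonneg by (cases "x \<in> carrier E \<and> y \<in> carrier E") (auto simp: cdist_def)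
    show "cdist E x y = cdist E y x" for x y
      using dist[of x y] dist[of y x] MD.commute
      by (cases "x \<in> carrier E \<and> y \<in> carrier E") (auto simp: cdist_def)
    show "cdist E x y = 0 \<longleftrightarrow> x = y" if "x \<in> carrier E" "y \<in> carrier E" for x y
      using that eqI hD by (auto simp: dist)
    show "cdist E x z \<le> cdist E x y + cdist E y z"
      if "x \<in> carrier E" "y \<in> carrier E" "z \<in> carrier E" for x y z
      using that hD MD.triangle by (simp add: dist)
  qed
  interpret ME: Metric_space "carrier E" "cdist E" by (rule ME)
  have compl: "ME.mcomplete"
    unfolding ME.mcomplete_def
  proof (intro allI impI)
    fix \<sigma> assume \<sigma>: "ME.MCauchy \<sigma>"
    then have \<sigma>E: "\<sigma> n \<in> carrier E" for n by (auto simp: ME.MCauchy_def)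
    have "MD.MCauchy (h \<circ> \<sigma>)"
      using \<sigma> \<sigma>E hD unfolding ME.MCauchy_def MD.MCauchy_def by (auto simp: dist)
    then obtain l where l: "limitin (ctopology D) (h \<circ> \<sigma>) l sequentially"
      using D.complete by (auto simp: MD.mcomplete_def)
    moreover have "range (h \<circ> \<sigma>) \<subseteq> h ` carrier E" using \<sigma>E by auto
    ultimately have "l \<in> h ` carrier E"
      using clo MD.metric_closedin_iff_sequentially_closed by blast
    then obtain x where x: "x \<in> carrier E" "l = h x" by auto
    then have "limitin ME.mtopology \<sigma> x sequentially"
      using l \<sigma>E by (simp add: MD.limit_metric_sequentially ME.limit_metric_sequentially dist hD)
    then show "\<exists>x. limitin ME.mtopology \<sigma> x sequentially" by blast
  qed
  show ?thesis
  proof (intro cstar_algebra.intro module cstar_algebra_axioms.intro)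
    show "cnorm E x = 0 \<longleftrightarrow> x = \<zero>\<^bsub>E\<^esub>" if "x \<in> carrier E" for x
      using that eqI[of x "\<zero>\<^bsub>E\<^esub>"] by (auto simp: h_simps cnorm D.cnorm_eq_0_iff)
  qed (use compl in \<open>auto intro!: eqI simp: h_simps cnorm D.mult_closed D.mult_assoc D.mult_add_left
        D.mult_add_right D.mult_smult_left D.mult_smult_right D.adj_closed D.adj_adj D.adj_add
        D.adj_smult D.adj_mult D.cnorm_smult D.cnorm_triangle D.cnorm_mult D.cstar_identity\<close>)
qed

definition is_projection :: "'c cstar \<Rightarrow> 'c \<Rightarrow> bool" where
  "is_projection C x \<longleftrightarrow> x \<in> carrier C \<and> adj C x = x \<and> x \<otimes>\<^bsub>C\<^esub> x = x"

definition is_partial_isometry :: "'c cstar \<Rightarrow> 'c \<Rightarrow> bool" where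
  "is_partial_isometry C x \<longleftrightarrow> x \<in> carrier C \<and> x \<otimes>\<^bsub>C\<^esub> adj C x \<otimes>\<^bsub>C\<^esub> x = x"

definition is_subspace :: "'c cstar \<Rightarrow> 'c set \<Rightarrow> bool" where
  "is_subspace C V \<longleftrightarrow> V \<subseteq> carrier C \<and> \<zero>\<^bsub>C\<^esub> \<in> V \<and> (\<forall>x\<in>V. \<forall>y\<in>V. x \<oplus>\<^bsub>C\<^esub> y \<in> V) \<and>
     (\<forall>c. \<forall>x\<in>V. c \<odot>\<^bsub>C\<^esub> x \<in> V)"

definition cstar_subalgebra :: "'c cstar \<Rightarrow> 'c set \<Rightarrow> bool" where
  "cstar_subalgebra C V \<longleftrightarrow> is_subspace C V \<and> (\<forall>x\<in>V. \<forall>y\<in>V. x \<otimes>\<^bsub>C\<^esub> y \<in> V) \<and>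
     (\<forall>x\<in>V. adj C x \<in> V) \<and> closedin (ctopology C) V"

definition generated_by :: "'c cstar \<Rightarrow> 'c set \<Rightarrow> bool" where
  "generated_by C S \<longleftrightarrow> S \<subseteq> carrier C \<and> (\<forall>V. cstar_subalgebra C V \<and> S \<subseteq> V \<longrightarrow> V = carrier C)"

definition closed_ideal :: "'c cstar \<Rightarrow> 'c set \<Rightarrow> bool" where
  "closed_ideal C V \<longleftrightarrow> is_subspace C V \<and>
     (\<forall>x\<in>carrier C. \<forall>y\<in>V. x \<otimes>\<^bsub>C\<^esub> y \<in> V \<and> y \<otimes>\<^bsub>C\<^esub> x \<in> V) \<and> closedin (ctopology C) V"

definition cspan :: "'c cstar \<Rightarrow> 'c set \<Rightarrow> 'c set" where
  "cspan C S = {\<Oplus>\<^bsub>C\<^esub>x\<in>F. c x \<odot>\<^bsub>C\<^esub> x | c F. finite F \<and> F \<subseteq> S}"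

definition closed_cspan :: "'c cstar \<Rightarrow> 'c set \<Rightarrow> 'c set" where
  "closed_cspan C S = ctopology C closure_of cspan C S"

definition star_hom :: "'c cstar \<Rightarrow> 'd cstar \<Rightarrow> ('c \<Rightarrow> 'd) set" where
  "star_hom C D = {\<phi>. \<phi> \<in> carrier C \<rightarrow> carrier D \<and>
     (\<forall>x\<in>carrier C. \<forall>y\<in>carrier C. \<phi> (x \<oplus>\<^bsub>C\<^esub> y) = \<phi> x \<oplus>\<^bsub>D\<^esub> \<phi> y) \<and>
     (\<forall>x\<in>carrier C. \<forall>y\<in>carrier C. \<phi> (x \<otimes>\<^bsub>C\<^esub> y) = \<phi> x \<otimes>\<^bsub>D\<^esub> \<phi> y) \<and>
     (\<forall>c. \<forall>x\<in>carrier C. \<phi> (c \<odot>\<^bsub>C\<^esub> x) = c \<odot>\<^bsub>D\<^esub> \<phi> x) \<and>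
     (\<forall>x\<in>carrier C. \<phi> (adj C x) = adj D (\<phi> x))}"

text \<open>An algebraic *-isomorphism of C*-algebras is automatically isometric.\<close>

definition star_isomorphic :: "'c cstar \<Rightarrow> 'd cstar \<Rightarrow> bool" where
  "star_isomorphic C D \<longleftrightarrow> (\<exists>\<phi>\<in>star_hom C D. bij_betw \<phi> (carrier C) (carrier D))"


section \<open>Compact operators on a sequence space\<close>

definition ell2 :: "'x set \<Rightarrow> ('x \<Rightarrow> complex) set" where
  "ell2 J = {f. (\<forall>x. x \<notin> J \<longrightarrow> f x = 0) \<and> (\<lambda>x. (cmod (f x))\<^sup>2) summable_on J}"

definition ell2_inner :: "('x \<Rightarrow> complex) \<Rightarrow> ('x \<Rightarrow> complex) \<Rightarrow> complex" where
  "ell2_inner f g = (\<Sum>\<^sub>\<infinity>x. f x * cnj (g x))"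

definition ell2_norm :: "('x \<Rightarrow> complex) \<Rightarrow> real" where
  "ell2_norm f = sqrt (\<Sum>\<^sub>\<infinity>x. (cmod (f x))\<^sup>2)"

abbreviation ell2_topology :: "'x set \<Rightarrow> ('x \<Rightarrow> complex) topology" where
  "ell2_topology J \<equiv> Metric_space.mtopology (ell2 J) (\<lambda>f g. ell2_norm (\<lambda>x. f x - g x))"

abbreviation ell2_ball :: "'x set \<Rightarrow> ('x \<Rightarrow> complex) set" where
  "ell2_ball J \<equiv> {f \<in> ell2 J. ell2_norm f \<le> 1}"

definition bounded_operators :: "'x set \<Rightarrow> (('x \<Rightarrow> complex) \<Rightarrow> ('x \<Rightarrow> complex)) set" where
  "bounded_operators J = {T \<in> ell2 J \<rightarrow>\<^sub>E ell2 J.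
     (\<forall>f\<in>ell2 J. \<forall>g\<in>ell2 J. T (\<lambda>x. f x + g x) = (\<lambda>x. T f x + T g x)) \<and>
     (\<forall>c. \<forall>f\<in>ell2 J. T (\<lambda>x. c * f x) = (\<lambda>x. c * T f x)) \<and>
     (\<exists>K. \<forall>f\<in>ell2 J. ell2_norm (T f) \<le> K * ell2_norm f)}"

definition bounded_operator_algebra :: "'x set \<Rightarrow> (('x \<Rightarrow> complex) \<Rightarrow> ('x \<Rightarrow> complex)) cstar" where
  "bounded_operator_algebra J =
    \<lparr> carrier = bounded_operators J,
      monoid.mult = (\<lambda>S T. compose (ell2 J) S T),
      one = (\<lambda>f\<in>ell2 J. f),
      ring.zero = (\<lambda>f\<in>ell2 J. (\<lambda>x. 0)),
      add = (\<lambda>S T. \<lambda>f\<in>ell2 J. (\<lambda>x. S f x + T f x)),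
      smult = (\<lambda>c T. \<lambda>f\<in>ell2 J. (\<lambda>x. c * T f x)),
      adj = (\<lambda>T. THE S. S \<in> bounded_operators J \<and>
        (\<forall>f\<in>ell2 J. \<forall>g\<in>ell2 J. ell2_inner (T f) g = ell2_inner f (S g))),
      cnorm = (\<lambda>T. SUP f\<in>ell2_ball J. ell2_norm (T f)) \<rparr>"

definition compact_operator_algebra :: "'x set \<Rightarrow> (('x \<Rightarrow> complex) \<Rightarrow> ('x \<Rightarrow> complex)) cstar" where
  "compact_operator_algebra J = (bounded_operator_algebra J)
     \<lparr>carrier := {T \<in> bounded_operators J.
       compactin (ell2_topology J) (ell2_topology J closure_of (T ` ell2_ball J))}\<rparr>"


section \<open>Labeled spaces\<close>

text \<open>
  The source and range maps are \<^const>\<open>tail\<close> and \<^const>\<open>head\<close>, and paths of positive length are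
  non-empty arc walks.  Since labelings are onto, the alphabet is the image of the set of edges.
  Words are lists of letters, with \<^term>\<open>[]\<close> as the empty word.
\<close>

definition sinks :: "('v, 'e) pre_digraph \<Rightarrow> 'v set" where
  "sinks G = {v \<in> verts G. \<forall>e\<in>arcs G. tail G e \<noteq> v}"

definition labels :: "('v, 'e) pre_digraph \<Rightarrow> ('e \<Rightarrow> 'a) \<Rightarrow> 'a set" where
  "labels G lab = lab ` arcs G"

definition labels_from :: "('v, 'e) pre_digraph \<Rightarrow> ('e \<Rightarrow> 'a) \<Rightarrow> 'v set \<Rightarrow> 'a set" where
  "labels_from G lab A = {lab e | e. e \<in> arcs G \<and> tail G e \<in> A}"

definition labeled_paths :: "('v, 'e) pre_digraph \<Rightarrow> ('e \<Rightarrow> 'a) \<Rightarrow> 'a list set" where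
  "labeled_paths G lab = {map lab q | u q v. pre_digraph.awalk G u q v \<and> q \<noteq> []}"

definition word_range :: "('v, 'e) pre_digraph \<Rightarrow> ('e \<Rightarrow> 'a) \<Rightarrow> 'a list \<Rightarrow> 'v set" where
  "word_range G lab \<alpha> = {v. \<exists>u q. pre_digraph.awalk G u q v \<and> q \<noteq> [] \<and> map lab q = \<alpha>}"

definition rel_range :: "('v, 'e) pre_digraph \<Rightarrow> ('e \<Rightarrow> 'a) \<Rightarrow> 'v set \<Rightarrow> 'a list \<Rightarrow> 'v set" where
  "rel_range G lab A \<alpha> =
     {v. \<exists>u q. pre_digraph.awalk G u q v \<and> q \<noteq> [] \<and> map lab q = \<alpha> \<and> u \<in> A}"

locale labeled_space = wf_digraph G
  for G :: "('v, 'e) pre_digraph" and lab :: "'e \<Rightarrow> 'a" and \<B> :: "'v set set" +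
  assumes countable_verts: "countable (verts G)"
    and countable_arcs: "countable (arcs G)"
    and sets_of_verts: "\<B> \<subseteq> Pow (verts G)"
    and nonempty: "\<B> \<noteq> {}"
    and nontrivial: "\<B> \<noteq> {{}}"
    and word_range_in: "\<alpha> \<in> labeled_paths G lab \<Longrightarrow> word_range G lab \<alpha> \<in> \<B>"
    and rel_range_in: "\<lbrakk>A \<in> \<B>; \<alpha> \<in> labeled_paths G lab\<rbrakk> \<Longrightarrow> rel_range G lab A \<alpha> \<in> \<B>"
    and Int_in: "\<lbrakk>A \<in> \<B>; B \<in> \<B>\<rbrakk> \<Longrightarrow> A \<inter> B \<in> \<B>"
    and Un_in: "\<lbrakk>A \<in> \<B>; B \<in> \<B>\<rbrakk> \<Longrightarrow> A \<union> B \<in> \<B>"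

locale weakly_left_resolving_labeled_space = labeled_space G lab \<B>
  for G :: "('v, 'e) pre_digraph" and lab :: "'e \<Rightarrow> 'a" and \<B> :: "'v set set" +
  assumes weakly_left_resolving: "\<lbrakk>A \<in> \<B>; B \<in> \<B>; \<alpha> \<in> labeled_paths G lab\<rbrakk>
      \<Longrightarrow> rel_range G lab (A \<inter> B) \<alpha> = rel_range G lab A \<alpha> \<inter> rel_range G lab B \<alpha>"

definition minimal_sinks_set :: "('v, 'e) pre_digraph \<Rightarrow> 'v set set \<Rightarrow> 'v set \<Rightarrow> bool" where
  "minimal_sinks_set G \<B> A \<longleftrightarrow>
     A \<in> \<B> \<and> A \<noteq> {} \<and> A \<subseteq> sinks G \<and> (\<forall>B\<in>\<B>. A \<subseteq> B \<or> A \<inter> B = {})"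


section \<open>The labeled graph C*-algebra\<close>

definition representation ::
    "('v, 'e) pre_digraph \<Rightarrow> ('e \<Rightarrow> 'a) \<Rightarrow> 'v set set \<Rightarrow>
     'c cstar \<Rightarrow> ('v set \<Rightarrow> 'c) \<Rightarrow> ('a \<Rightarrow> 'c) \<Rightarrow> bool" where
  "representation G lab \<B> C p s \<longleftrightarrow>
     cstar_algebra C \<and>
     (\<forall>A\<in>\<B>. is_projection C (p A)) \<and>
     (\<forall>a\<in>labels G lab. is_partial_isometry C (s a)) \<and>
     (\<forall>A\<in>\<B>. \<forall>B\<in>\<B>. p A \<otimes>\<^bsub>C\<^esub> p B = p (A \<inter> B)) \<and>
     (\<forall>A\<in>\<B>. \<forall>B\<in>\<B>. p (A \<union> B) = (p A \<oplus>\<^bsub>C\<^esub> p B) \<ominus>\<^bsub>C\<^esub> p (A \<inter> B)) \<and>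
     (\<forall>a\<in>labels G lab. \<forall>b\<in>labels G lab.
        adj C (s a) \<otimes>\<^bsub>C\<^esub> s b = (if a = b then p (word_range G lab [a]) else \<zero>\<^bsub>C\<^esub>)) \<and>
     (\<forall>a\<in>labels G lab. \<forall>A\<in>\<B>.
        adj C (s a) \<otimes>\<^bsub>C\<^esub> p A = p (rel_range G lab A [a]) \<otimes>\<^bsub>C\<^esub> adj C (s a)) \<and>
     (\<forall>A\<in>\<B>. finite (labels_from G lab A) \<and> A \<inter> sinks G = {} \<longrightarrow>
        p A = (\<Oplus>\<^bsub>C\<^esub>a\<in>labels_from G lab A.
                 s a \<otimes>\<^bsub>C\<^esub> p (rel_range G lab A [a]) \<otimes>\<^bsub>C\<^esub> adj C (s a)))"

text \<open>
  HOL cannot quantify over all C*-algebras of all types.  The universal property is therefore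
  stated for the C*-algebras whose elements are drawn from the following type of formal
  expressions in the generators.  Its constructors, including formal limits of sequences, match
  the operations under which a C*-subalgebra is closed, so every C*-algebra generated by a
  representation has an isomorphic copy there.  Lemma \<open>universal_property\<close> below shows that
  the universal property then holds for target C*-algebras over arbitrary types.
\<close>

datatype ('v, 'a) expr =
    Proj "'v set"
  | Iso 'a
  | Zero
  | Plus "('v, 'a) expr" "('v, 'a) expr"
  | Times "('v, 'a) expr" "('v, 'a) expr"
  | Scale complex "('v, 'a) expr"
  | Adj "('v, 'a) expr"
  | Lim "nat \<Rightarrow> ('v, 'a) expr"

definition labeled_graph_cstar_algebra ::
    "('v, 'e) pre_digraph \<Rightarrow> ('e \<Rightarrow> 'a) \<Rightarrow> 'v set set \<Rightarrow>
     'c cstar \<Rightarrow> ('v set \<Rightarrow> 'c) \<Rightarrow> ('a \<Rightarrow> 'c) \<Rightarrow> bool" where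
  "labeled_graph_cstar_algebra G lab \<B> C p s \<longleftrightarrow>
     representation G lab \<B> C p s \<and>
     generated_by C (p ` \<B> \<union> s ` labels G lab) \<and>
     (\<forall>(D :: ('v, 'a) expr cstar) P S. representation G lab \<B> D P S \<longrightarrow>
        (\<exists>\<phi>\<in>star_hom C D. (\<forall>A\<in>\<B>. \<phi> (p A) = P A) \<and> (\<forall>a\<in>labels G lab. \<phi> (s a) = S a)))"

lemma star_hom_zero:
  assumes "cstar_algebra C" "cstar_algebra D" "\<phi> \<in> star_hom C D"
  shows "\<phi> \<zero>\<^bsub>C\<^esub> = \<zero>\<^bsub>D\<^esub>"
proof -
  interpret C: cstar_algebra C by fact
  interpret D: cstar_algebra D by fact
  have "\<phi> (\<zero>\<^bsub>C\<^esub> \<oplus>\<^bsub>C\<^esub> \<zero>\<^bsub>C\<^esub>) = \<phi> \<zero>\<^bsub>C\<^esub> \<oplus>\<^bsub>D\<^esub> \<phi> \<zero>\<^bsub>C\<^esub>"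
    and "\<phi> \<zero>\<^bsub>C\<^esub> \<in> carrier D"
    using assms(3) C.M.zero_closed unfolding star_hom_def by blast+
  then show ?thesis using D.M.add.l_cancel_one' by simp
qed

lemma star_hom_minus:
  assumes "cstar_algebra C" "cstar_algebra D" "\<phi> \<in> star_hom C D"
    and "x \<in> carrier C" "y \<in> carrier C"
  shows "\<phi> (x \<ominus>\<^bsub>C\<^esub> y) = \<phi> x \<ominus>\<^bsub>D\<^esub> \<phi> y"
  using assms cstar_algebra.smult_in[OF assms(1)] cstar_algebra.minus_eq_smult[OF assms(1)]
    cstar_algebra.minus_eq_smult[OF assms(2)]
  unfolding star_hom_def by (simp add: Pi_iff)

lemma star_hom_finsum:
  assumes "cstar_algebra C" "cstar_algebra D" "\<phi> \<in> star_hom C D"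
    and "finite F" "f \<in> F \<rightarrow> carrier C"
  shows "\<phi> (finsum C f F) = (\<Oplus>\<^bsub>D\<^esub>i\<in>F. \<phi> (f i))"
  using assms(4,5)
proof (induction F rule: finite_induct)
  case empty
  interpret C: cstar_algebra C by fact
  interpret D: cstar_algebra D by fact
  show ?case using star_hom_zero[OF assms(1-3)] by simp
next
  case (insert i F)
  interpret C: cstar_algebra C by fact
  interpret D: cstar_algebra D by fact
  have \<phi>: "\<phi> x \<in> carrier D" if "x \<in> carrier C" for x
    using assms(3) that by (auto simp: star_hom_def)
  have f: "f \<in> F \<rightarrow> carrier C" "f i \<in> carrier C" using insert.prems by auto
  have "\<phi> (finsum C f (insert i F)) = \<phi> (f i \<oplus>\<^bsub>C\<^esub> finsum C f F)"
    using insert.hyps f by (simp add: C.M.finsum_insert)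
  also have "\<dots> = \<phi> (f i) \<oplus>\<^bsub>D\<^esub> \<phi> (finsum C f F)"
    using assms(3) f C.M.finsum_closed[OF f(1)] by (auto simp: star_hom_def)
  also have "\<dots> = (\<Oplus>\<^bsub>D\<^esub>i\<in>insert i F. \<phi> (f i))"
    using insert f \<phi> by (subst D.M.finsum_insert) auto
  finally show ?case .
qed

lemma (in labeled_space) representation_pullback:
  assumes rep: "representation G lab \<B> D (\<lambda>A. \<phi> (p A)) (\<lambda>a. \<phi> (s a))"
    and E: "cstar_algebra E" and \<phi>: "\<phi> \<in> star_hom E D" and inj: "inj_on \<phi> (carrier E)"
    and p: "\<And>A. A \<in> \<B> \<Longrightarrow> p A \<in> carrier E"
    and s: "\<And>a. a \<in> labels G lab \<Longrightarrow> s a \<in> carrier E"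
  shows "representation G lab \<B> E p s"
proof -
  have D: "cstar_algebra D" using rep by (simp add: representation_def)
  interpret E: cstar_algebra E by (rule E)
  interpret D: cstar_algebra D by (rule D)
  have eqI: "x = y" if "\<phi> x = \<phi> y" "x \<in> carrier E" "y \<in> carrier E" for x y
    using inj that by (auto dest: inj_onD)
  have \<phi>_binary: "\<phi> (x \<otimes>\<^bsub>E\<^esub> y) = \<phi> x \<otimes>\<^bsub>D\<^esub> \<phi> y" "\<phi> (x \<oplus>\<^bsub>E\<^esub> y) = \<phi> x \<oplus>\<^bsub>D\<^esub> \<phi> y"
    "\<phi> (x \<ominus>\<^bsub>E\<^esub> y) = \<phi> x \<ominus>\<^bsub>D\<^esub> \<phi> y"
    if "x \<in> carrier E" "y \<in> carrier E" for x y
    using that \<phi> star_hom_minus[OF E D \<phi>] by (auto simp: star_hom_def)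
  have \<phi>_unary: "\<phi> (adj E x) = adj D (\<phi> x)" "\<phi> x \<in> carrier D" if "x \<in> carrier E" for x
    using that \<phi> by (auto simp: star_hom_def)
  note \<phi>_simps = \<phi>_binary \<phi>_unary
  have label: "[a] \<in> labeled_paths G lab" if a: "a \<in> labels G lab" for a
  proof -
    obtain e where e: "e \<in> arcs G" "a = lab e" using a by (auto simp: labels_def)
    then have "awalk (tail G e) [e] (head G e)" by (simp add: awalk_def)
    then have "map lab [e] \<in> labeled_paths G lab" unfolding labeled_paths_def by blast
    then show ?thesis using e by simp
  qed
  have from_labels: "labels_from G lab A \<subseteq> labels G lab" for A
    by (auto simp: labels_from_def labels_def)
  note closed = p s E.mult_closed E.adj_closed label word_range_in rel_range_in Int_in Un_in
  show ?thesis
    unfolding representation_def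
  proof (intro conjI ballI impI E)
    fix A assume A: "A \<in> \<B>"
    have "is_projection D (\<phi> (p A))" using rep A by (simp add: representation_def)
    then show "is_projection E (p A)"
      using A by (auto intro!: eqI simp: is_projection_def \<phi>_simps closed)
  next
    fix a assume a: "a \<in> labels G lab"
    have "is_partial_isometry D (\<phi> (s a))" using rep a by (simp add: representation_def)
    then show "is_partial_isometry E (s a)"
      using a by (auto intro!: eqI simp: is_partial_isometry_def \<phi>_simps closed)
  next
    fix A B assume "A \<in> \<B>" "B \<in> \<B>"
    then show "p A \<otimes>\<^bsub>E\<^esub> p B = p (A \<inter> B)" "p (A \<union> B) = (p A \<oplus>\<^bsub>E\<^esub> p B) \<ominus>\<^bsub>E\<^esub> p (A \<inter> B)"
      using rep by (auto intro!: eqI simp: representation_def \<phi>_simps closed)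
  next
    fix a b assume ab: "a \<in> labels G lab" "b \<in> labels G lab"
    then have "adj D (\<phi> (s a)) \<otimes>\<^bsub>D\<^esub> \<phi> (s b) =
        (if a = b then \<phi> (p (word_range G lab [a])) else \<zero>\<^bsub>D\<^esub>)"
      using rep unfolding representation_def by blast
    then show "adj E (s a) \<otimes>\<^bsub>E\<^esub> s b = (if a = b then p (word_range G lab [a]) else \<zero>\<^bsub>E\<^esub>)"
      using ab by (auto intro!: eqI simp: \<phi>_simps closed star_hom_zero[OF E D \<phi>] split: if_splits)
  next
    fix a A assume aA: "a \<in> labels G lab" "A \<in> \<B>"
    then show "adj E (s a) \<otimes>\<^bsub>E\<^esub> p A = p (rel_range G lab A [a]) \<otimes>\<^bsub>E\<^esub> adj E (s a)"
      using rep by (intro eqI) (simp_all add: representation_def \<phi>_simps closed)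
  next
    fix A assume A: "A \<in> \<B>" and fin: "finite (labels_from G lab A) \<and> A \<inter> sinks G = {}"
    let ?f = "\<lambda>a. s a \<otimes>\<^bsub>E\<^esub> p (rel_range G lab A [a]) \<otimes>\<^bsub>E\<^esub> adj E (s a)"
    have f: "?f \<in> labels_from G lab A \<rightarrow> carrier E"
      using A from_labels by (auto simp: closed subset_iff)
    have "\<phi> (p A) = (\<Oplus>\<^bsub>D\<^esub>a\<in>labels_from G lab A.
        \<phi> (s a) \<otimes>\<^bsub>D\<^esub> \<phi> (p (rel_range G lab A [a])) \<otimes>\<^bsub>D\<^esub> adj D (\<phi> (s a)))"
      using rep A fin by (simp add: representation_def)
    also have "\<dots> = (\<Oplus>\<^bsub>D\<^esub>a\<in>labels_from G lab A. \<phi> (?f a))"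
      using A from_labels by (intro D.M.finsum_cong') (auto simp: \<phi>_simps closed subset_iff D.mult_closed D.adj_closed)
    also have "\<dots> = \<phi> (finsum E ?f (labels_from G lab A))"
      using star_hom_finsum[OF E D \<phi> _ f] fin by simp
    finally show "p A = finsum E ?f (labels_from G lab A)"
      using A E.M.finsum_closed[OF f] by (intro eqI) (simp_all add: closed)
  qed
qed

primrec eval_expr :: "'c cstar \<Rightarrow> ('v set \<Rightarrow> 'c) \<Rightarrow> ('a \<Rightarrow> 'c) \<Rightarrow> ('v, 'a) expr \<Rightarrow> 'c" where
  "eval_expr D P S (Proj A) = P A"
| "eval_expr D P S (Iso a) = S a"
| "eval_expr D P S Zero = \<zero>\<^bsub>D\<^esub>"
| "eval_expr D P S (Plus t u) = eval_expr D P S t \<oplus>\<^bsub>D\<^esub> eval_expr D P S u"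
| "eval_expr D P S (Times t u) = eval_expr D P S t \<otimes>\<^bsub>D\<^esub> eval_expr D P S u"
| "eval_expr D P S (Scale c t) = c \<odot>\<^bsub>D\<^esub> eval_expr D P S t"
| "eval_expr D P S (Adj t) = adj D (eval_expr D P S t)"
| "eval_expr D P S (Lim f) =
     (THE l. limitin (ctopology D) (\<lambda>n. eval_expr D P S (f n)) l sequentially)"

lemma universal_property:
  fixes G :: "('v, 'e) pre_digraph" and lab :: "'e \<Rightarrow> 'a" and D :: "'d cstar"
  assumes space: "labeled_space G lab \<B>"
    and univ: "labeled_graph_cstar_algebra G lab \<B> C p s"
    and rep: "representation G lab \<B> D P S"
  obtains \<phi> where "\<phi> \<in> star_hom C D"
    and "\<And>A. A \<in> \<B> \<Longrightarrow> \<phi> (p A) = P A" and "\<And>a. a \<in> labels G lab \<Longrightarrow> \<phi> (s a) = S a"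
proof -
  interpret labeled_space G lab \<B> by (rule space)
  have D: "cstar_algebra D" using rep by (simp add: representation_def)
  interpret D: cstar_algebra D by (rule D)
  interpret MD: Metric_space "carrier D" "cdist D" by (rule D.Metric_space_cdist)
  define ev where "ev = eval_expr D P S"
  define T where "T = carrier D \<inter> range ev"
  define name where "name = (\<lambda>x. SOME t. ev t = x)"
  have ev_name: "ev (name x) = x" if "x \<in> T" for x
    using that unfolding name_def T_def by (auto intro: someI)
  have T_I: "x \<in> T" if "x \<in> carrier D" "x = ev t" for x t
    using that by (auto simp: T_def)
  have T_D: "\<exists>t. x = ev t" "x \<in> carrier D" if "x \<in> T" for x
    using that by (auto simp: T_def)
  have zero: "\<zero>\<^bsub>D\<^esub> \<in> T" by (rule T_I[of _ Zero]) (auto simp: ev_def)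
  have add: "x \<oplus>\<^bsub>D\<^esub> y \<in> T" if xy: "x \<in> T" "y \<in> T" for x y
  proof -
    obtain t u where "x = ev t" "y = ev u" using T_D xy by meson
    then show ?thesis using T_D xy by (intro T_I[of _ "Plus t u"]) (auto simp: ev_def)
  qed
  have mult: "x \<otimes>\<^bsub>D\<^esub> y \<in> T" if xy: "x \<in> T" "y \<in> T" for x y
  proof -
    obtain t u where "x = ev t" "y = ev u" using T_D xy by meson
    then show ?thesis using T_D xy D.mult_closed by (intro T_I[of _ "Times t u"]) (auto simp: ev_def)
  qed
  have smult: "c \<odot>\<^bsub>D\<^esub> x \<in> T" if x: "x \<in> T" for c x
  proof -
    obtain t where "x = ev t" using T_D x by meson
    then show ?thesis using T_D x D.smult_in by (intro T_I[of _ "Scale c t"]) (auto simp: ev_def)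
  qed
  have adj: "adj D x \<in> T" if x: "x \<in> T" for x
  proof -
    obtain t where "x = ev t" using T_D x by meson
    then show ?thesis using T_D x D.adj_closed by (intro T_I[of _ "Adj t"]) (auto simp: ev_def)
  qed
  have closed: "closedin (ctopology D) T"
    unfolding MD.metric_closedin_iff_sequentially_closed
  proof (intro conjI allI impI)
    show "T \<subseteq> carrier D" by (auto simp: T_def)
    fix \<sigma> l assume l: "range \<sigma> \<subseteq> T \<and> limitin (ctopology D) \<sigma> l sequentially"
    then have "\<forall>n. \<exists>t. \<sigma> n = ev t" using T_D by blast
    then obtain f where f: "\<And>n. \<sigma> n = ev (f n)" by metis
    have "l = ev (Lim f)"
      unfolding ev_def eval_expr.simps
    proof (rule the_equality[symmetric])
      show "limitin (ctopology D) (\<lambda>n. eval_expr D P S (f n)) l sequentially"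
        using l f unfolding ev_def by (metis (no_types, lifting) ext)
      fix l' assume "limitin (ctopology D) (\<lambda>n. eval_expr D P S (f n)) l' sequentially"
      moreover have "(\<lambda>n. eval_expr D P S (f n)) = \<sigma>" using f by (auto simp: ev_def)
      ultimately show "l' = l"
        using l MD.limitin_metric_unique trivial_limit_sequentially by metis
    qed
    moreover have "l \<in> carrier D" using l by (auto simp: MD.limit_metric_sequentially)
    ultimately show "l \<in> T" by (rule T_I[rotated])
  qed
  define E :: "('v, 'a) expr cstar" where
    "E = \<lparr> carrier = name ` T, monoid.mult = (\<lambda>t u. name (ev t \<otimes>\<^bsub>D\<^esub> ev u)), one = Zero,
       ring.zero = name \<zero>\<^bsub>D\<^esub>, add = (\<lambda>t u. name (ev t \<oplus>\<^bsub>D\<^esub> ev u)),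
       smult = (\<lambda>c t. name (c \<odot>\<^bsub>D\<^esub> ev t)), adj = (\<lambda>t. name (adj D (ev t))),
       cnorm = (\<lambda>t. cnorm D (ev t)) \<rparr>"
  have carrier: "carrier E = name ` T" by (simp add: E_def)
  have image: "ev ` carrier E = T" by (auto simp: carrier ev_name image_iff)
  have inj: "inj_on ev (carrier E)" by (auto simp: carrier ev_name inj_on_def)
  have E: "cstar_algebra E"
  proof (rule cstar_algebra_pullback[OF D inj])
    show "closedin (ctopology D) (ev ` carrier E)" using closed by (simp add: image)
  qed (auto simp: E_def ev_name zero add mult smult adj)
  have ev_hom: "ev \<in> star_hom E D"
    using T_D(2) by (auto simp: star_hom_def E_def ev_name add mult smult adj)
  have P: "P A \<in> T" if "A \<in> \<B>" for A
    using rep that by (intro T_I[of _ "Proj A"]) (auto simp: representation_def is_projection_def ev_def)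
  have S: "S a \<in> T" if "a \<in> labels G lab" for a
    using rep that by (intro T_I[of _ "Iso a"]) (auto simp: representation_def is_partial_isometry_def ev_def)
  define P' where "P' = (\<lambda>A. if A \<in> \<B> then name (P A) else Proj A)"
  define S' where "S' = (\<lambda>a. if a \<in> labels G lab then name (S a) else Iso a)"
  have "(\<lambda>A. ev (P' A)) = P"
    using ev_name[OF P] by (intro ext) (simp add: P'_def, simp add: ev_def)
  moreover have "(\<lambda>a. ev (S' a)) = S"
    using ev_name[OF S] by (intro ext) (simp add: S'_def, simp add: ev_def)
  ultimately have "representation G lab \<B> E P' S'"
    using rep by (intro representation_pullback[OF _ E ev_hom inj]) (auto simp: P'_def S'_def carrier P S)
  then obtain \<psi> where \<psi>: "\<psi> \<in> star_hom C E" "\<And>A. A \<in> \<B> \<Longrightarrow> \<psi> (p A) = P' A"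
    "\<And>a. a \<in> labels G lab \<Longrightarrow> \<psi> (s a) = S' a"
    using univ unfolding labeled_graph_cstar_algebra_def by blast
  show thesis
  proof
    show "(\<lambda>x. ev (\<psi> x)) \<in> star_hom C D"
      using \<psi>(1) ev_hom by (auto simp: star_hom_def Pi_iff)
    show "ev (\<psi> (p A)) = P A" if "A \<in> \<B>" for A using that by (simp add: \<psi> P'_def ev_name P)
    show "ev (\<psi> (s a)) = S a" if "a \<in> labels G lab" for a using that by (simp add: \<psi> S'_def ev_name S)
  qed
qed

fun word_isometry :: "'c cstar \<Rightarrow> ('a \<Rightarrow> 'c) \<Rightarrow> 'a list \<Rightarrow> 'c" where
  "word_isometry C s [a] = s a"
| "word_isometry C s (a # b # \<alpha>) = s a \<otimes>\<^bsub>C\<^esub> word_isometry C s (b # \<alpha>)"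

text \<open>
  The element \<open>s\<^sub>\<alpha> x s\<^sub>\<beta>\<^sup>*\<close>.  For the empty word the isometry is the unit of the multiplier
  algebra, which need not lie in the C*-algebra but acts on it as the identity.
\<close>

definition word_sandwich :: "'c cstar \<Rightarrow> ('a \<Rightarrow> 'c) \<Rightarrow> 'a list \<Rightarrow> 'c \<Rightarrow> 'a list \<Rightarrow> 'c" where
  "word_sandwich C s \<alpha> x \<beta> =
     (let y = (if \<alpha> = [] then x else word_isometry C s \<alpha> \<otimes>\<^bsub>C\<^esub> x)
      in if \<beta> = [] then y else y \<otimes>\<^bsub>C\<^esub> adj C (word_isometry C s \<beta>))"

definition sinks_ideal ::
    "('v, 'e) pre_digraph \<Rightarrow> ('e \<Rightarrow> 'a) \<Rightarrow> 'c cstar \<Rightarrow> ('v set \<Rightarrow> 'c) \<Rightarrow> ('a \<Rightarrow> 'c) \<Rightarrow>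
     'v set \<Rightarrow> 'c set" where
  "sinks_ideal G lab C p s A = closed_cspan C
     {word_sandwich C s \<alpha> (p A) \<beta> | \<alpha> \<beta>.
        \<alpha> \<in> labeled_paths G lab \<union> {[]} \<and> \<beta> \<in> labeled_paths G lab \<union> {[]}}"

definition words_onto :: "('v, 'e) pre_digraph \<Rightarrow> ('e \<Rightarrow> 'a) \<Rightarrow> 'v set \<Rightarrow> 'a list set" where
  "words_onto G lab A = {\<alpha>. (\<alpha> \<in> labeled_paths G lab \<and> A \<subseteq> word_range G lab \<alpha>) \<or> \<alpha> = []}"

end

theory Submission
  imports Defs
begin

text \<open>
  The ideal is a copy of the compact operators because it is the closed span of a system of matrix
  units. Write \<open>J\<close> for \<^term>\<open>words_onto G lab A\<close> and \<open>w\<^sub>\<alpha> = s\<^sub>\<alpha> p\<^sub>A\<close>. Since \<open>A\<close> consists of sinks,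
  \<open>s\<^sub>a\<^sup>* p\<^sub>A = 0\<close> for every letter \<open>a\<close>. Since \<open>A\<close> is minimal, each \<open>p\<^sub>Y\<close> either fixes or kills
  \<open>w\<^sub>\<alpha>\<close>, according to whether \<open>r(Y, \<alpha>)\<close> contains \<open>A\<close> or misses it (\<open>p_mult_w\<close>). Therefore \<open>w\<^sub>\<alpha>\<^sup>*
  w\<^sub>\<beta>\<close> is \<open>p\<^sub>A\<close> if \<open>\<alpha> = \<beta> \<in> J\<close> and \<open>0\<close> otherwise (\<open>adj_w_mult_w\<close>). So the elements \<open>w\<^sub>\<alpha> w\<^sub>\<beta>\<^sup>*\<close>
  with \<open>\<alpha>, \<beta> \<in> J\<close> multiply like matrix units, and all other spanning elements of the ideal are
  zero. A generator or its adjoint sends each \<open>w\<^sub>\<alpha>\<close> to some \<open>w\<^sub>\<beta>\<close> or to zero, so the closed span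
  is an ideal (\<open>I_left_ideal\<close>).

  The same relations show how to represent the algebra on \<open>\<ell>\<^sup>2(J)\<close>: the letter \<open>a\<close> acts by
  prepending \<open>a\<close> to a word, and \<open>Y\<close> acts as the projection onto the words \<open>\<alpha>\<close> with \<open>A \<subseteq> r(Y, \<alpha>)\<close>
  (\<open>representation_words_onto\<close>). By universality there is a *-homomorphism \<open>\<pi>\<close> into the bounded
  operators on \<open>\<ell>\<^sup>2(J)\<close>, and it maps \<open>w\<^sub>\<alpha> w\<^sub>\<beta>\<^sup>*\<close> to the rank-one operator that sends the basis
  vector of \<open>\<beta>\<close> to that of \<open>\<alpha>\<close> (\<open>exists_representation\<close>). In particular \<open>p\<^sub>A \<noteq> 0\<close>.

  The isomorphism is the restriction of \<open>\<pi>\<close> to the ideal. On the span of finitely many matrix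
  units, the norm of the algebra and the operator norm of the image are equivalent, because in
  both C*-algebras the norm lies between the largest modulus of a matrix entry and the sum of all
  these moduli. The identity \<open>\<parallel>x\<parallel>\<^bsup>2n\<^esup> = \<parallel>(x\<^sup>* x)\<^sup>n\<parallel>\<close> for \<open>n\<close> a power of two makes the constants of
  this equivalence disappear in the limit, so \<open>\<pi>\<close> is isometric there
  (\<open>star_hom_isometric_on_matrix_units\<close>); this replaces the usual argument by spectral theory.
  Passing to the closure, \<open>\<pi>\<close> maps the ideal isometrically onto the norm closure of the finite
  matrices, and these are exactly the compact operators (\<open>limit_of_matrices_is_compact\<close>,
  \<open>compact_operator_approx\<close>).

  To apply universality, the bounded operators on \<open>\<ell>\<^sup>2(J)\<close> must be known to form a C*-algebra
  (\<open>cstar_algebra_bounded_operators\<close>), which needs completeness of \<open>\<ell>\<^sup>2(J)\<close> and existence of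
  adjoints.
\<close>

section \<open>Square-summable functions\<close>

lemma ell2_off: "f \<in> ell2 J \<Longrightarrow> x \<notin> J \<Longrightarrow> f x = 0"
  by (simp add: ell2_def)

lemma ell2_summable:
  assumes "f \<in> ell2 J"
  shows "(\<lambda>x. (cmod (f x))\<^sup>2) summable_on UNIV"
  using assms summable_on_cong_neutral[of UNIV J "\<lambda>x. (cmod (f x))\<^sup>2" "\<lambda>x. (cmod (f x))\<^sup>2"]
  by (auto simp: ell2_def)

lemma L2_set_le_ell2_norm:
  assumes "f \<in> ell2 J" "finite F"
  shows "L2_set (\<lambda>x. cmod (f x)) F \<le> ell2_norm f"
  unfolding L2_set_def ell2_norm_def
  by (intro real_sqrt_le_mono finite_sum_le_infsum ell2_summable[OF assms(1)] assms) auto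

text \<open>
  Bounds on finite partial sums give membership and the norm estimate at once. Together with
  \<open>L2_set_le_ell2_norm\<close> this reduces inequalities between norms in \<open>\<ell>\<^sup>2(J)\<close> to finite sums.
\<close>

lemma ell2_leI:
  assumes "\<And>x. x \<notin> J \<Longrightarrow> f x = 0"
    and "\<And>F. finite F \<Longrightarrow> F \<subseteq> J \<Longrightarrow> L2_set (\<lambda>x. cmod (f x)) F \<le> K"
  shows "f \<in> ell2 J" "ell2_norm f \<le> K"
proof -
  have K: "0 \<le> K" using assms(2)[of "{}"] by simp
  have fin: "(\<Sum>x\<in>F. (cmod (f x))\<^sup>2) \<le> K\<^sup>2" if "finite F" "F \<subseteq> J" for F
    using assms(2)[OF that] K unfolding L2_set_def by (simp add: real_sqrt_le_iff' sum_nonneg)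
  have sJ: "(\<lambda>x. (cmod (f x))\<^sup>2) summable_on J"
    by (rule nonneg_bdd_above_summable_on) (use fin in \<open>auto simp: bdd_above_def\<close>)
  then show "f \<in> ell2 J" using assms(1) by (auto simp: ell2_def)
  have "(\<Sum>\<^sub>\<infinity>x. (cmod (f x))\<^sup>2) = (\<Sum>\<^sub>\<infinity>x\<in>J. (cmod (f x))\<^sup>2)"
    by (rule infsum_cong_neutral) (use assms(1) in auto)
  also have "\<dots> \<le> K\<^sup>2" by (rule infsum_le_finite_sums[OF sJ fin])
  finally show "ell2_norm f \<le> K" unfolding ell2_norm_def using K by (simp add: real_le_lsqrt infsum_nonneg)
qed

lemma ell2_norm_ge0: "0 \<le> ell2_norm f"
  by (simp add: ell2_norm_def infsum_nonneg)

lemma cmod_le_ell2_norm: "f \<in> ell2 J \<Longrightarrow> cmod (f x) \<le> ell2_norm f"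
  using L2_set_le_ell2_norm[of f J "{x}"] by simp

lemma ell2_zero: "(\<lambda>x. 0) \<in> ell2 J" "ell2_norm (\<lambda>x::'x. 0) = 0"
  using ell2_leI(1)[of J "\<lambda>x. 0" 0] ell2_leI(2)[of "UNIV :: 'x set" "\<lambda>x. 0" 0]
    ell2_norm_ge0[of "\<lambda>x::'x. 0"]
  by (auto simp: L2_set_def)

lemma ell2_norm_eq_0: "f \<in> ell2 J \<Longrightarrow> ell2_norm f = 0 \<longleftrightarrow> f = (\<lambda>x. 0)"
  using cmod_le_ell2_norm[of f J] ell2_zero by fastforce

lemma ell2_add:
  assumes "f \<in> ell2 J" "g \<in> ell2 J"
  shows "(\<lambda>x. f x + g x) \<in> ell2 J" "ell2_norm (\<lambda>x. f x + g x) \<le> ell2_norm f + ell2_norm g"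
proof -
  have off: "f x + g x = 0" if "x \<notin> J" for x using assms that by (simp add: ell2_off)
  have *: "L2_set (\<lambda>x. cmod (f x + g x)) F \<le> ell2_norm f + ell2_norm g"
    if F: "finite F" "F \<subseteq> J" for F
  proof -
    have "L2_set (\<lambda>x. cmod (f x + g x)) F \<le> L2_set (\<lambda>x. cmod (f x) + cmod (g x)) F"
      by (rule L2_set_mono) (auto intro: norm_triangle_ineq)
    also have "\<dots> \<le> L2_set (\<lambda>x. cmod (f x)) F + L2_set (\<lambda>x. cmod (g x)) F"
      by (rule L2_set_triangle_ineq)
    also have "\<dots> \<le> ell2_norm f + ell2_norm g"
      using assms F by (intro add_mono L2_set_le_ell2_norm)
    finally show ?thesis .
  qed
  show "(\<lambda>x. f x + g x) \<in> ell2 J" "ell2_norm (\<lambda>x. f x + g x) \<le> ell2_norm f + ell2_norm g"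
    by (rule ell2_leI[OF off *]; assumption)+
qed

lemma ell2_smult_le:
  assumes "f \<in> ell2 J"
  shows "(\<lambda>x. c * f x) \<in> ell2 J" "ell2_norm (\<lambda>x. c * f x) \<le> cmod c * ell2_norm f"
proof -
  have off: "c * f x = 0" if "x \<notin> J" for x using assms that by (simp add: ell2_off)
  have *: "L2_set (\<lambda>x. cmod (c * f x)) F \<le> cmod c * ell2_norm f"
    if F: "finite F" "F \<subseteq> J" for F
    using L2_set_le_ell2_norm[OF assms F(1)]
    by (simp add: norm_mult L2_set_right_distrib[symmetric] mult_left_mono)
  show "(\<lambda>x. c * f x) \<in> ell2 J" "ell2_norm (\<lambda>x. c * f x) \<le> cmod c * ell2_norm f"
    by (rule ell2_leI[OF off *]; assumption)+
qed

lemmas ell2_smult = ell2_smult_le(1)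

lemma ell2_norm_smult:
  assumes "f \<in> ell2 J"
  shows "ell2_norm (\<lambda>x. c * f x) = cmod c * ell2_norm f"
proof (cases "c = 0")
  case False
  have "ell2_norm (\<lambda>x. inverse c * (c * f x)) \<le> cmod (inverse c) * ell2_norm (\<lambda>x. c * f x)"
    by (intro ell2_smult_le(2)[of _ J] ell2_smult assms)
  then have "cmod c * ell2_norm f \<le> ell2_norm (\<lambda>x. c * f x)"
    using False by (simp add: field_simps norm_inverse norm_divide)
  then show ?thesis using ell2_smult_le(2)[OF assms, of c] by simp
qed (simp add: ell2_zero)

lemma ell2_diff:
  assumes "f \<in> ell2 J" "g \<in> ell2 J"
  shows "(\<lambda>x. f x - g x) \<in> ell2 J"
  using ell2_add(1)[OF assms(1) ell2_smult[OF assms(2), of "-1"]] by simp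

lemma ell2_norm_minus_commute:
  assumes "f \<in> ell2 J" "g \<in> ell2 J"
  shows "ell2_norm (\<lambda>x. f x - g x) = ell2_norm (\<lambda>x. g x - f x)"
  using ell2_norm_smult[OF ell2_diff[OF assms(2,1)], of "-1"] by simp

text \<open>
  Fatou's lemma for the counting measure: a finite partial sum of the limit is a limit of finite
  partial sums.
\<close>

lemma ell2_pointwise_limit:
  assumes "\<And>n. g n \<in> ell2 J" "\<forall>\<^sub>F n in sequentially. ell2_norm (g n) \<le> K"
    and "\<And>x. (\<lambda>n. g n x) \<longlonglongrightarrow> h x"
  shows "h \<in> ell2 J" "ell2_norm h \<le> K"
proof -
  have off: "h x = 0" if "x \<notin> J" for x
    using assms(3)[of x] ell2_off[OF assms(1) that] by (simp add: LIMSEQ_const_iff)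
  have *: "L2_set (\<lambda>x. cmod (h x)) F \<le> K" if F: "finite F" "F \<subseteq> J" for F
  proof (rule tendsto_upperbound)
    show "(\<lambda>n. L2_set (\<lambda>x. cmod (g n x)) F) \<longlonglongrightarrow> L2_set (\<lambda>x. cmod (h x)) F"
      unfolding L2_set_def by (intro tendsto_intros assms(3))
    show "\<forall>\<^sub>F n in sequentially. L2_set (\<lambda>x. cmod (g n x)) F \<le> K"
      using assms(2) by eventually_elim (use L2_set_le_ell2_norm[OF assms(1) F(1)] in \<open>meson order_trans\<close>)
  qed simp
  show "h \<in> ell2 J" "ell2_norm h \<le> K" by (rule ell2_leI[OF off *]; assumption)+
qed

abbreviation ell2_dist :: "('x \<Rightarrow> complex) \<Rightarrow> ('x \<Rightarrow> complex) \<Rightarrow> real" where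
  "ell2_dist f g \<equiv> ell2_norm (\<lambda>x. f x - g x)"

lemma ell2_dist_triangle:
  assumes "f \<in> ell2 J" "g \<in> ell2 J" "h \<in> ell2 J"
  shows "ell2_dist f h \<le> ell2_dist f g + ell2_dist g h"
  using ell2_add(2)[OF ell2_diff[OF assms(1,2)] ell2_diff[OF assms(2,3)]] by simp

text \<open>
  The limit of a Cauchy sequence is formed pointwise. The last conclusion keeps the rate of
  convergence, because completeness of the algebra of operators needs a rate that is uniform on
  the unit ball.
\<close>

lemma ell2_Cauchy_limit:
  assumes g: "\<And>n. g n \<in> ell2 J"
    and Cauchy: "\<And>\<epsilon>. \<epsilon> > 0 \<Longrightarrow> \<exists>N. \<forall>m\<ge>N. \<forall>n\<ge>N. ell2_dist (g m) (g n) < \<epsilon>"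
  shows "(\<lambda>n. g n x) \<longlonglongrightarrow> lim (\<lambda>n. g n x)"
    and "(\<lambda>x. lim (\<lambda>n. g n x)) \<in> ell2 J"
    and "\<lbrakk>\<And>m. m \<ge> N \<Longrightarrow> ell2_dist (g n) (g m) \<le> \<epsilon>\<rbrakk> \<Longrightarrow> ell2_dist (g n) (\<lambda>x. lim (\<lambda>n. g n x)) \<le> \<epsilon>"
proof -
  have lim: "(\<lambda>n. g n x) \<longlonglongrightarrow> lim (\<lambda>n. g n x)" for x
  proof -
    have "Cauchy (\<lambda>n. g n x)"
      unfolding Cauchy_def dist_norm
      using Cauchy cmod_le_ell2_norm[OF ell2_diff[OF g g], where x = x] by (meson order_le_less_trans)
    then show ?thesis by (simp add: Cauchy_convergent_iff convergent_LIMSEQ_iff)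
  qed
  then show "(\<lambda>n. g n x) \<longlonglongrightarrow> lim (\<lambda>n. g n x)" .
  have close: "(\<lambda>x. g n x - lim (\<lambda>n. g n x)) \<in> ell2 J" "ell2_dist (g n) (\<lambda>x. lim (\<lambda>n. g n x)) \<le> \<epsilon>"
    if "\<And>m. m \<ge> N \<Longrightarrow> ell2_dist (g n) (g m) \<le> \<epsilon>" for n N \<epsilon>
    by (rule ell2_pointwise_limit[of "\<lambda>m x. g n x - g m x"];
        use that g in \<open>auto intro!: ell2_diff eventually_sequentiallyI[of N] tendsto_intros lim\<close>)+
  from close(2) show "ell2_dist (g n) (\<lambda>x. lim (\<lambda>n. g n x)) \<le> \<epsilon>"
    if "\<And>m. m \<ge> N \<Longrightarrow> ell2_dist (g n) (g m) \<le> \<epsilon>" using that .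
  obtain N where "\<forall>m\<ge>N. \<forall>n\<ge>N. ell2_dist (g m) (g n) < 1" using Cauchy[of 1] by auto
  then have "(\<lambda>x. g N x - lim (\<lambda>n. g n x)) \<in> ell2 J"
    by (intro close(1)[of N _ 1]) (auto simp: less_imp_le)
  from ell2_diff[OF g[of N] this] show "(\<lambda>x. lim (\<lambda>n. g n x)) \<in> ell2 J" by simp
qed

text \<open>
  Truncation to any set \<open>G\<close> that contains \<open>F\<close> is close to \<open>f\<close>. Monotonicity in \<open>G\<close> is what allows
  finitely many vectors to be truncated to one common set.
\<close>

lemma ell2_approx:
  assumes f: "f \<in> ell2 J" and \<epsilon>: "\<epsilon> > 0"
  obtains F where "finite F" "F \<subseteq> J"
    "\<And>G. F \<subseteq> G \<Longrightarrow> ell2_dist f (\<lambda>x. if x \<in> G then f x else 0) < \<epsilon>"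
proof -
  let ?q = "\<lambda>x. (cmod (f x))\<^sup>2"
  have sJ: "?q summable_on J" using f by (simp add: ell2_def)
  have "((\<lambda>F. sum ?q F) \<longlongrightarrow> infsum ?q J) (finite_subsets_at_top J)" by (rule infsum_tendsto[OF sJ])
  then have "\<forall>\<^sub>F F in finite_subsets_at_top J. dist (sum ?q F) (infsum ?q J) < (\<epsilon>/2)\<^sup>2"
    using \<epsilon> by (intro tendstoD) auto
  then obtain F where F: "finite F" "F \<subseteq> J" "dist (sum ?q F) (infsum ?q J) < (\<epsilon>/2)\<^sup>2"
    unfolding eventually_finite_subsets_at_top by blast
  show thesis
  proof
    fix G assume G: "F \<subseteq> G"
    have "ell2_dist f (\<lambda>x. if x \<in> G then f x else 0) \<le> \<epsilon>/2"
    proof (rule ell2_leI(2))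
      fix H assume H: "finite H" "H \<subseteq> J"
      have "(\<Sum>x\<in>H. (cmod (f x - (if x \<in> G then f x else 0)))\<^sup>2) = sum ?q (H - G)"
        using H by (intro sum.mono_neutral_cong_right) auto
      also have "\<dots> \<le> sum ?q (H - F)" using H G by (intro sum_mono2) auto
      also have "\<dots> = sum ?q (H \<union> F) - sum ?q F"
        using H F by (simp add: sum_diff[of "H \<union> F" F, symmetric] Un_Diff)
      also have "\<dots> \<le> infsum ?q J - sum ?q F"
        using H F sJ by (auto intro!: finite_sum_le_infsum)
      also have "\<dots> \<le> (\<epsilon>/2)\<^sup>2" using F(3) by (simp add: dist_real_def)
      finally show "L2_set (\<lambda>x. cmod (f x - (if x \<in> G then f x else 0))) H \<le> \<epsilon>/2"
        unfolding L2_set_def using \<epsilon> by (intro real_le_lsqrt) auto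
    qed (use f in \<open>auto simp: ell2_off\<close>)
    then show "ell2_dist f (\<lambda>x. if x \<in> G then f x else 0) < \<epsilon>" using \<epsilon> by simp
  qed (use F in auto)
qed

lemma ell2_finite_support:
  assumes "finite F" "F \<subseteq> J"
  shows "(\<lambda>x. if x \<in> F then c x else 0) \<in> ell2 J"
    "ell2_norm (\<lambda>x. if x \<in> F then c x else 0) = L2_set (\<lambda>x. cmod (c x)) F"
proof -
  let ?f = "\<lambda>x. if x \<in> F then c x else 0"
  have off: "?f x = 0" if "x \<notin> J" for x using assms that by auto
  have *: "L2_set (\<lambda>x. cmod (?f x)) G \<le> L2_set (\<lambda>x. cmod (c x)) F"
    if "finite G" "G \<subseteq> J" for G
  proof -
    have "(\<Sum>x\<in>G. (cmod (?f x))\<^sup>2) = (\<Sum>x\<in>G \<inter> F. (cmod (c x))\<^sup>2)"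
      using that by (intro sum.mono_neutral_cong_right) auto
    also have "\<dots> \<le> (\<Sum>x\<in>F. (cmod (c x))\<^sup>2)" using assms by (intro sum_mono2) auto
    finally show ?thesis unfolding L2_set_def by (rule real_sqrt_le_mono)
  qed
  show f: "?f \<in> ell2 J" by (rule ell2_leI[OF off *]; assumption)
  have "ell2_norm ?f \<le> L2_set (\<lambda>x. cmod (c x)) F" by (rule ell2_leI[OF off *]; assumption)
  moreover have "L2_set (\<lambda>x. cmod (c x)) F = L2_set (\<lambda>x. cmod (?f x)) F"
    by (rule L2_set_cong) auto
  ultimately show "ell2_norm ?f = L2_set (\<lambda>x. cmod (c x)) F"
    using L2_set_le_ell2_norm[OF f assms(1)] by simp
qed

definition basis_vec :: "'x \<Rightarrow> 'x \<Rightarrow> complex" where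
  "basis_vec x = (\<lambda>y. if y = x then 1 else 0)"

lemma basis_vec_ell2: "x \<in> J \<Longrightarrow> basis_vec x \<in> ell2 J"
  and basis_vec_norm: "ell2_norm (basis_vec x) = 1"
  using ell2_finite_support[of "{x}" J "\<lambda>_. 1"] ell2_finite_support(2)[of "{x}" UNIV "\<lambda>_. 1"]
  by (auto simp: basis_vec_def)

lemma ell2_inner_summable:
  assumes "f \<in> ell2 J" "g \<in> ell2 J"
  shows "(\<lambda>x. cmod (f x * cnj (g x))) summable_on UNIV"
    and "(\<Sum>\<^sub>\<infinity>x. cmod (f x * cnj (g x))) \<le> ell2_norm f * ell2_norm g"
proof -
  have fin: "(\<Sum>x\<in>F. cmod (f x * cnj (g x))) \<le> ell2_norm f * ell2_norm g" if F: "finite F" for F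
  proof -
    have "(\<Sum>x\<in>F. cmod (f x * cnj (g x))) \<le> L2_set (\<lambda>x. cmod (f x)) F * L2_set (\<lambda>x. cmod (g x)) F"
      using L2_set_mult_ineq[of "\<lambda>x. cmod (f x)" "\<lambda>x. cmod (g x)" F] by (simp add: norm_mult)
    also have "\<dots> \<le> ell2_norm f * ell2_norm g"
      using assms F by (intro mult_mono L2_set_le_ell2_norm) (auto simp: ell2_norm_ge0)
    finally show ?thesis .
  qed
  then show *: "(\<lambda>x. cmod (f x * cnj (g x))) summable_on UNIV"
    by (intro nonneg_bdd_above_summable_on) (auto simp: bdd_above_def)
  show "(\<Sum>\<^sub>\<infinity>x. cmod (f x * cnj (g x))) \<le> ell2_norm f * ell2_norm g"
    by (rule infsum_le_finite_sums[OF *]) (use fin in auto)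
qed

lemma cmod_ell2_inner_le:
  assumes "f \<in> ell2 J" "g \<in> ell2 J"
  shows "cmod (ell2_inner f g) \<le> ell2_norm f * ell2_norm g"
  unfolding ell2_inner_def
  using norm_infsum_bound[OF ell2_inner_summable(1)[OF assms]] ell2_inner_summable(2)[OF assms] by linarith

lemma ell2_inner_add_left:
  assumes "f \<in> ell2 J" "g \<in> ell2 J" "h \<in> ell2 J"
  shows "ell2_inner (\<lambda>x. f x + g x) h = ell2_inner f h + ell2_inner g h"
  using infsum_add[OF abs_summable_summable[OF ell2_inner_summable(1)[OF assms(1,3)]]
      abs_summable_summable[OF ell2_inner_summable(1)[OF assms(2,3)]]]
  by (simp add: ell2_inner_def distrib_right)

lemma ell2_inner_smult_left:
  "ell2_inner (\<lambda>x. c * f x) h = c * ell2_inner f h"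
  by (simp add: ell2_inner_def mult.assoc infsum_cmult_right')

lemma ell2_inner_commute: "ell2_inner g f = cnj (ell2_inner f g)"
  unfolding ell2_inner_def by (subst infsum_cnj[symmetric]) (simp add: mult.commute)

lemma ell2_inner_smult_right: "ell2_inner f (\<lambda>x. c * g x) = cnj c * ell2_inner f g"
  by (subst (1 2) ell2_inner_commute) (simp add: ell2_inner_smult_left)

lemma ell2_inner_add_right:
  assumes "f \<in> ell2 J" "g \<in> ell2 J" "h \<in> ell2 J"
  shows "ell2_inner f (\<lambda>x. g x + h x) = ell2_inner f g + ell2_inner f h"
  by (subst (1 2 3) ell2_inner_commute) (simp add: ell2_inner_add_left[OF assms(2,3,1)])

lemma ell2_inner_self:
  assumes "f \<in> ell2 J"
  shows "ell2_inner f f = complex_of_real ((ell2_norm f)\<^sup>2)"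
proof -
  have "ell2_inner f f = (\<Sum>\<^sub>\<infinity>x. complex_of_real ((cmod (f x))\<^sup>2))"
    unfolding ell2_inner_def by (simp add: complex_norm_square del: of_real_power)
  also have "\<dots> = complex_of_real (\<Sum>\<^sub>\<infinity>x. (cmod (f x))\<^sup>2)"
    by (rule infsum_bounded_linear_strong[OF _ bounded_linear_of_real])
      (use ell2_summable[OF assms] summable_on_of_real[OF ell2_summable[OF assms], where 'a = complex]
       in auto)
  finally show ?thesis by (simp add: ell2_norm_def infsum_nonneg)
qed

lemma ell2_inner_finite_left:
  assumes "finite F"
  shows "ell2_inner (\<lambda>x. if x \<in> F then c x else 0) g = (\<Sum>x\<in>F. c x * cnj (g x))"
proof -
  have "ell2_inner (\<lambda>x. if x \<in> F then c x else 0) g = (\<Sum>\<^sub>\<infinity>x\<in>F. c x * cnj (g x))"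
    unfolding ell2_inner_def by (rule infsum_cong_neutral) auto
  then show ?thesis using assms by simp
qed

lemma ell2_inner_basis_left: "ell2_inner (basis_vec x) g = cnj (g x)"
  using ell2_inner_finite_left[of "{x}" "\<lambda>_. 1" g] by (simp add: basis_vec_def)

lemma ell2_inner_basis_right: "ell2_inner f (basis_vec x) = f x"
  using ell2_inner_commute[of f "basis_vec x"] by (simp add: ell2_inner_basis_left)

lemma ell2_sum:
  assumes "finite F" "\<And>i. i \<in> F \<Longrightarrow> u i \<in> ell2 J"
  shows "(\<lambda>x. \<Sum>i\<in>F. c i * u i x) \<in> ell2 J"
  using assms by (induction F rule: finite_induct) (auto simp: ell2_zero ell2_add ell2_smult)

lemma ell2_inner_sum_left:
  assumes "finite F" "\<And>i. i \<in> F \<Longrightarrow> u i \<in> ell2 J" "g \<in> ell2 J"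
  shows "ell2_inner (\<lambda>x. \<Sum>i\<in>F. c i * u i x) g = (\<Sum>i\<in>F. c i * ell2_inner (u i) g)"
  using assms(1,2)
proof (induction F rule: finite_induct)
  case (insert i F)
  then show ?case
    using ell2_sum[of F u J c] ell2_smult[of "u i" J "c i"]
      ell2_inner_add_left[of "\<lambda>x. c i * u i x" J "\<lambda>x. \<Sum>i\<in>F. c i * u i x" g] assms(3)
    by (simp add: ell2_inner_smult_left)
qed (simp add: ell2_inner_def)

section \<open>The algebra of bounded operators\<close>

abbreviation op_norm :: "'x set \<Rightarrow> (('x \<Rightarrow> complex) \<Rightarrow> ('x \<Rightarrow> complex)) \<Rightarrow> real" where
  "op_norm J \<equiv> cnorm (bounded_operator_algebra J)"

abbreviation op_adj ::
    "'x set \<Rightarrow> (('x \<Rightarrow> complex) \<Rightarrow> ('x \<Rightarrow> complex)) \<Rightarrow> (('x \<Rightarrow> complex) \<Rightarrow> ('x \<Rightarrow> complex))" where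
  "op_adj J \<equiv> adj (bounded_operator_algebra J)"

lemma bounded_operatorsD:
  assumes "T \<in> bounded_operators J"
  shows "f \<in> ell2 J \<Longrightarrow> T f \<in> ell2 J"
    and "f \<in> ell2 J \<Longrightarrow> g \<in> ell2 J \<Longrightarrow> T (\<lambda>x. f x + g x) = (\<lambda>x. T f x + T g x)"
    and "f \<in> ell2 J \<Longrightarrow> T (\<lambda>x. c * f x) = (\<lambda>x. c * T f x)"
  using assms by (auto simp: bounded_operators_def)

lemma bounded_operators_restrict:
  assumes "\<And>f. f \<in> ell2 J \<Longrightarrow> T f \<in> ell2 J"
    and "\<And>f g. f \<in> ell2 J \<Longrightarrow> g \<in> ell2 J \<Longrightarrow> T (\<lambda>x. f x + g x) = (\<lambda>x. T f x + T g x)"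
    and "\<And>c f. f \<in> ell2 J \<Longrightarrow> T (\<lambda>x. c * f x) = (\<lambda>x. c * T f x)"
    and "\<And>f. f \<in> ell2 J \<Longrightarrow> ell2_norm (T f) \<le> K * ell2_norm f"
  shows "(\<lambda>f\<in>ell2 J. T f) \<in> bounded_operators J"
  using assms unfolding bounded_operators_def by (auto simp: ell2_add ell2_smult intro!: exI[of _ K])

lemma bounded_operators_eqI:
  assumes "S \<in> bounded_operators J" "T \<in> bounded_operators J"
    and "\<And>f. f \<in> ell2 J \<Longrightarrow> S f = T f"
  shows "S = T"
  by (rule PiE_ext[of S "ell2 J" "\<lambda>_. ell2 J"]) (use assms in \<open>auto simp: bounded_operators_def\<close>)

lemma bounded_operator_zero: "T \<in> bounded_operators J \<Longrightarrow> T (\<lambda>x. 0) = (\<lambda>x. 0)"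
  using bounded_operatorsD(3)[of T J "\<lambda>x. 0" 0] by (simp add: ell2_zero)

lemma bounded_operator_sum:
  assumes "T \<in> bounded_operators J" "finite F" "\<And>i. i \<in> F \<Longrightarrow> u i \<in> ell2 J"
  shows "T (\<lambda>x. \<Sum>i\<in>F. c i * u i x) = (\<lambda>x. \<Sum>i\<in>F. c i * T (u i) x)"
  using assms(2,3)
proof (induction F rule: finite_induct)
  case (insert i F)
  then show ?case
    using bounded_operatorsD(2)[OF assms(1) ell2_smult[of "u i" J "c i"] ell2_sum[of F u J c]]
    by (simp add: bounded_operatorsD(3)[OF assms(1)] ell2_zero)
qed (simp add: bounded_operator_zero[OF assms(1)])

lemma bounded_operator_finite_support:
  assumes "T \<in> bounded_operators J" "finite F" "F \<subseteq> J"
  shows "T (\<lambda>x. if x \<in> F then c x else 0) = (\<lambda>y. \<Sum>x\<in>F. c x * T (basis_vec x) y)"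
proof -
  have "(\<lambda>x. if x \<in> F then c x else 0) = (\<lambda>y. \<Sum>x\<in>F. c x * basis_vec x y)"
    using assms(2) by (auto simp: basis_vec_def if_distrib cong: if_cong)
  then show ?thesis
    using bounded_operator_sum[OF assms(1,2) basis_vec_ell2[OF subsetD[OF assms(3)]], where c = c]
    by simp
qed

lemma op_norm_eq_SUP: "op_norm J T = (SUP f\<in>ell2_ball J. ell2_norm (T f))"
  by (simp add: bounded_operator_algebra_def)

lemma ell2_norm_op_le:
  assumes T: "T \<in> bounded_operators J" and f: "f \<in> ell2 J"
  shows "ell2_norm (T f) \<le> op_norm J T * ell2_norm f"
proof (cases "ell2_norm f = 0")
  case True
  then have "f = (\<lambda>x. 0)" using ell2_norm_eq_0[OF f] by simp
  then show ?thesis using bounded_operator_zero[OF T] by (simp add: ell2_zero)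
next
  case False
  then have pos: "ell2_norm f > 0" using ell2_norm_ge0[of f] by simp
  obtain K where K: "\<And>f. f \<in> ell2 J \<Longrightarrow> ell2_norm (T f) \<le> K * ell2_norm f"
    using T unfolding bounded_operators_def by blast
  have bdd: "bdd_above ((\<lambda>f. ell2_norm (T f)) ` ell2_ball J)"
  proof (rule bdd_aboveI2)
    fix g assume g: "g \<in> ell2_ball J"
    then have "ell2_norm (T g) \<le> K * ell2_norm g" using K by simp
    also have "\<dots> \<le> \<bar>K\<bar> * 1" using g ell2_norm_ge0[of g] by (intro mult_mono) auto
    finally show "ell2_norm (T g) \<le> \<bar>K\<bar>" by simp
  qed
  let ?c = "complex_of_real (inverse (ell2_norm f))"
  let ?g = "\<lambda>x. ?c * f x"
  have c: "cmod ?c = inverse (ell2_norm f)" using pos by (simp add: norm_inverse)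
  have "ell2_norm (T ?g) \<le> op_norm J T"
    unfolding op_norm_eq_SUP
    by (rule cSUP_upper[OF _ bdd]) (use pos c f in \<open>simp add: ell2_smult ell2_norm_smult\<close>)
  then have "inverse (ell2_norm f) * ell2_norm (T f) \<le> op_norm J T"
    using c ell2_norm_smult[OF bounded_operatorsD(1)[OF T f], of ?c]
      bounded_operatorsD(3)[OF T f, of ?c] by simp
  then show ?thesis using pos by (simp add: field_simps)
qed

lemma op_norm_leI:
  assumes "0 \<le> K" "\<And>f. f \<in> ell2 J \<Longrightarrow> ell2_norm (T f) \<le> K * ell2_norm f"
  shows "op_norm J T \<le> K"
  unfolding op_norm_eq_SUP
proof (rule cSUP_least)
  have "(\<lambda>x. 0) \<in> ell2_ball J" by (simp add: ell2_zero)
  then show "ell2_ball J \<noteq> {}" by blast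
  fix f assume f: "f \<in> ell2_ball J"
  then have "ell2_norm (T f) \<le> K * ell2_norm f" using assms by simp
  also have "\<dots> \<le> K * 1" using f assms(1) by (intro mult_left_mono) auto
  finally show "ell2_norm (T f) \<le> K" by simp
qed

lemma op_norm_ge0:
  assumes "T \<in> bounded_operators J"
  shows "0 \<le> op_norm J T"
proof (cases "\<exists>f\<in>ell2 J. ell2_norm f \<noteq> 0")
  case True
  then obtain f where f: "f \<in> ell2 J" "ell2_norm f \<noteq> 0" by blast
  then have "0 \<le> op_norm J T * ell2_norm f"
    using ell2_norm_op_le[OF assms f(1)] ell2_norm_ge0[of "T f"] by linarith
  then show ?thesis using f(2) ell2_norm_ge0[of f] by (simp add: zero_le_mult_iff)
next
  case False
  then have "(\<lambda>f. ell2_norm (T f)) ` ell2_ball J = {0}"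
    using bounded_operatorsD(1)[OF assms] ell2_zero by (force simp: image_iff)
  then show ?thesis unfolding op_norm_eq_SUP by simp
qed

text \<open>
  The adjoint \<open>S\<close> is written down by its matrix. To see that \<open>S g\<close> is square summable, test the
  bound for \<open>T\<close> on the vector \<open>h\<close> that agrees with \<open>S g\<close> on a finite set \<open>F\<close> and vanishes
  elsewhere: if \<open>L\<close> is the norm of \<open>h\<close>, then \<open>L\<^sup>2 = \<langle>T h, g\<rangle> \<le> \<parallel>T\<parallel> L \<parallel>g\<parallel>\<close>. The adjoint identity
  holds for finitely supported \<open>f\<close> by linearity and for all \<open>f\<close> by truncation.
\<close>

lemma bounded_operator_adjoint_exists:
  assumes T: "T \<in> bounded_operators J"
  obtains S where "S \<in> bounded_operators J"
    and "\<And>f g. \<lbrakk>f \<in> ell2 J; g \<in> ell2 J\<rbrakk> \<Longrightarrow> ell2_inner (T f) g = ell2_inner f (S g)"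
proof -
  define K where "K = op_norm J T"
  have K0: "0 \<le> K" unfolding K_def by (rule op_norm_ge0[OF T])
  define S where "S = (\<lambda>g x. if x \<in> J then ell2_inner g (T (basis_vec x)) else 0)"
  note Tb = bounded_operatorsD(1)[OF T basis_vec_ell2]
  have S_fin: "ell2_inner (T (\<lambda>x. if x \<in> F then c x else 0)) g = (\<Sum>x\<in>F. c x * cnj (S g x))"
    if F: "finite F" "F \<subseteq> J" and g: "g \<in> ell2 J" for F c g
    unfolding bounded_operator_finite_support[OF T F]
    using F g Tb by (subst ell2_inner_sum_left[of _ _ J])
      (auto simp: S_def subset_iff ell2_inner_commute[of g] intro!: sum.cong)
  have L2: "L2_set (\<lambda>x. cmod (S g x)) F \<le> K * ell2_norm g"
    if g: "g \<in> ell2 J" and F: "finite F" "F \<subseteq> J" for F g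
  proof -
    let ?L = "L2_set (\<lambda>x. cmod (S g x)) F"
    let ?h = "\<lambda>x. if x \<in> F then S g x else 0"
    have "complex_of_real (?L\<^sup>2) = (\<Sum>x\<in>F. S g x * cnj (S g x))"
      by (simp add: L2_set_def sum_nonneg complex_norm_square del: of_real_power)
    also have "\<dots> = ell2_inner (T ?h) g" by (rule S_fin[OF F g, symmetric])
    finally have "?L\<^sup>2 = cmod (ell2_inner (T ?h) g)"
      by (metis abs_of_nonneg norm_of_real zero_le_power2)
    also have "\<dots> \<le> ell2_norm (T ?h) * ell2_norm g"
      using F g by (intro cmod_ell2_inner_le[of _ J] bounded_operatorsD(1)[OF T] ell2_finite_support)
    also have "\<dots> \<le> (K * ?L) * ell2_norm g"
      using ell2_norm_op_le[OF T ell2_finite_support(1)[OF F, of "S g"]] ell2_finite_support(2)[OF F, of "S g"]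
      by (intro mult_right_mono) (auto simp: K_def ell2_norm_ge0)
    finally have "?L * ?L \<le> ?L * (K * ell2_norm g)" by (simp add: power2_eq_square algebra_simps)
    then show ?thesis
      using K0 ell2_norm_ge0[of g] by (cases "?L = 0") (auto simp: less_le)
  qed
  have S_off: "S g x = 0" if "x \<notin> J" for g x using that by (simp add: S_def)
  have S_ell2: "S g \<in> ell2 J" "ell2_norm (S g) \<le> K * ell2_norm g" if "g \<in> ell2 J" for g
    by (rule ell2_leI[OF S_off L2[OF that]]; assumption)+
  have adj: "ell2_inner (T f) g = ell2_inner f (S g)" if f: "f \<in> ell2 J" and g: "g \<in> ell2 J" for f g
  proof (rule ccontr)
    assume ne: "ell2_inner (T f) g \<noteq> ell2_inner f (S g)"
    define \<delta> where "\<delta> = cmod (ell2_inner (T f) g - ell2_inner f (S g))"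
    \<comment> \<open>\<open>M * \<parallel>d\<parallel>\<close> bounds the change of both sides of the identity when \<open>f\<close> changes by \<open>d\<close>.\<close>
    define M where "M = K * ell2_norm g + ell2_norm (S g) + 1"
    have M: "M > 0" using mult_nonneg_nonneg[OF K0 ell2_norm_ge0[of g]] ell2_norm_ge0[of "S g"]
      by (simp add: M_def)
    have \<delta>: "\<delta> > 0" using ne by (simp add: \<delta>_def)
    obtain F where F: "finite F" "F \<subseteq> J"
      "ell2_dist f (\<lambda>x. if x \<in> F then f x else 0) < \<delta> / M"
      using ell2_approx[OF f, of "\<delta> / M"] M \<delta> by (metis order_refl divide_pos_pos)
    let ?f = "\<lambda>x. if x \<in> F then f x else 0"
    let ?d = "\<lambda>x. f x - ?f x"
    have fF: "?f \<in> ell2 J" by (rule ell2_finite_support[OF F(1,2)])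
    have d: "?d \<in> ell2 J" by (rule ell2_diff[OF f fF])
    have f_eq: "f = (\<lambda>x. ?f x + ?d x)" by simp
    have "ell2_inner (T f) g = ell2_inner (T ?f) g + ell2_inner (T ?d) g"
      by (subst f_eq, subst bounded_operatorsD(2)[OF T fF d],
          rule ell2_inner_add_left[OF bounded_operatorsD(1)[OF T fF] bounded_operatorsD(1)[OF T d] g])
    moreover have "ell2_inner f (S g) = ell2_inner ?f (S g) + ell2_inner ?d (S g)"
      by (subst f_eq, rule ell2_inner_add_left[OF fF d S_ell2(1)[OF g]])
    moreover have "ell2_inner (T ?f) g = ell2_inner ?f (S g)"
      using S_fin[OF F(1,2) g] ell2_inner_finite_left[OF F(1)] by simp
    ultimately have "\<delta> = cmod (ell2_inner (T ?d) g - ell2_inner ?d (S g))" by (simp add: \<delta>_def)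
    also have "\<dots> \<le> cmod (ell2_inner (T ?d) g) + cmod (ell2_inner ?d (S g))" by (rule norm_triangle_ineq4)
    also have "\<dots> \<le> ell2_norm (T ?d) * ell2_norm g + ell2_norm ?d * ell2_norm (S g)"
      by (intro add_mono cmod_ell2_inner_le[of _ J] bounded_operatorsD(1)[OF T] d g S_ell2)
    also have "\<dots> \<le> (K * ell2_norm ?d) * ell2_norm g + ell2_norm ?d * ell2_norm (S g)"
      using ell2_norm_op_le[OF T d] by (intro add_right_mono mult_right_mono) (auto simp: K_def ell2_norm_ge0)
    also have "\<dots> \<le> M * ell2_norm ?d"
      using ell2_norm_ge0[of ?d] by (simp add: M_def algebra_simps)
    also have "\<dots> < \<delta>" using F(3) M by (simp add: field_simps)
    finally show False by simp
  qed
  let ?S = "\<lambda>g\<in>ell2 J. S g"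
  have "?S \<in> bounded_operators J"
  proof (rule bounded_operators_restrict)
    show "S (\<lambda>x. f x + g x) = (\<lambda>x. S f x + S g x)" if "f \<in> ell2 J" "g \<in> ell2 J" for f g
      using that Tb by (auto simp: S_def ell2_inner_add_left)
    show "S (\<lambda>x. c * f x) = (\<lambda>x. c * S f x)" for c f
      by (auto simp: S_def ell2_inner_smult_left)
  qed (use S_ell2 in auto)
  moreover have "ell2_inner (T f) g = ell2_inner f (?S g)" if "f \<in> ell2 J" "g \<in> ell2 J" for f g
    using adj that by simp
  ultimately show thesis using that by blast
qed

text \<open>
  Adjoints are unique since pairing with the basis vectors determines a vector. This makes the
  definite description in the definition of the algebra computable.
\<close>

lemma op_adjI:
  assumes "S \<in> bounded_operators J"
    and "\<And>f g. \<lbrakk>f \<in> ell2 J; g \<in> ell2 J\<rbrakk> \<Longrightarrow> ell2_inner (T f) g = ell2_inner f (S g)"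
  shows "op_adj J T = S"
proof -
  have "(THE S. S \<in> bounded_operators J \<and>
      (\<forall>f\<in>ell2 J. \<forall>g\<in>ell2 J. ell2_inner (T f) g = ell2_inner f (S g))) = S"
  proof (rule the_equality)
    fix S' assume S': "S' \<in> bounded_operators J \<and>
      (\<forall>f\<in>ell2 J. \<forall>g\<in>ell2 J. ell2_inner (T f) g = ell2_inner f (S' g))"
    show "S' = S"
    proof (rule bounded_operators_eqI)
      fix g assume g: "g \<in> ell2 J"
      show "S' g = S g"
      proof
        fix x
        show "S' g x = S g x"
        proof (cases "x \<in> J")
          case True
          then have "cnj (S' g x) = cnj (S g x)"
            using S' assms(2) g basis_vec_ell2[OF True] by (metis ell2_inner_basis_left)
          then show ?thesis by simp
        next
          case False
          then show ?thesis
            using S' assms(1) g by (metis bounded_operatorsD(1) ell2_off)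
        qed
      qed
    qed (use S' assms in auto)
  qed (use assms in auto)
  then show ?thesis by (simp add: bounded_operator_algebra_def)
qed

lemma op_adj:
  assumes T: "T \<in> bounded_operators J"
  shows "op_adj J T \<in> bounded_operators J"
    and "\<lbrakk>f \<in> ell2 J; g \<in> ell2 J\<rbrakk> \<Longrightarrow> ell2_inner (T f) g = ell2_inner f (op_adj J T g)"
proof -
  obtain S where S: "S \<in> bounded_operators J"
    "\<And>f g. \<lbrakk>f \<in> ell2 J; g \<in> ell2 J\<rbrakk> \<Longrightarrow> ell2_inner (T f) g = ell2_inner f (S g)"
    using bounded_operator_adjoint_exists[OF T] by blast
  then have "op_adj J T = S" by (rule op_adjI)
  with S show "op_adj J T \<in> bounded_operators J"
    and "\<lbrakk>f \<in> ell2 J; g \<in> ell2 J\<rbrakk> \<Longrightarrow> ell2_inner (T f) g = ell2_inner f (op_adj J T g)" by auto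
qed

lemma op_norm_adj_le:
  assumes T: "T \<in> bounded_operators J"
  shows "op_norm J (op_adj J T) \<le> op_norm J T"
proof (rule op_norm_leI[OF op_norm_ge0[OF T]])
  fix g assume g: "g \<in> ell2 J"
  let ?h = "op_adj J T g"
  have h: "?h \<in> ell2 J" by (rule bounded_operatorsD(1)[OF op_adj(1)[OF T] g])
  have "(ell2_norm ?h)\<^sup>2 = cmod (ell2_inner (T ?h) g)"
    using op_adj(2)[OF T h g] ell2_inner_self[OF h] by (simp add: norm_power ell2_norm_ge0)
  also have "\<dots> \<le> ell2_norm (T ?h) * ell2_norm g"
    by (rule cmod_ell2_inner_le[OF bounded_operatorsD(1)[OF T h] g])
  also have "\<dots> \<le> (op_norm J T * ell2_norm ?h) * ell2_norm g"
    by (rule mult_right_mono[OF ell2_norm_op_le[OF T h] ell2_norm_ge0])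
  finally have "ell2_norm ?h * ell2_norm ?h \<le> ell2_norm ?h * (op_norm J T * ell2_norm g)"
    by (simp add: power2_eq_square algebra_simps)
  then show "ell2_norm ?h \<le> op_norm J T * ell2_norm g"
    using op_norm_ge0[OF T] ell2_norm_ge0[of g] ell2_norm_ge0[of ?h]
    by (cases "ell2_norm ?h = 0") (auto simp: less_le)
qed

lemma bounded_operator_algebra_simps:
  "carrier (bounded_operator_algebra J) = bounded_operators J"
  "f \<in> ell2 J \<Longrightarrow> (S \<otimes>\<^bsub>bounded_operator_algebra J\<^esub> T) f = S (T f)"
  "f \<in> ell2 J \<Longrightarrow> (S \<oplus>\<^bsub>bounded_operator_algebra J\<^esub> T) f = (\<lambda>x. S f x + T f x)"
  "f \<in> ell2 J \<Longrightarrow> (c \<odot>\<^bsub>bounded_operator_algebra J\<^esub> T) f = (\<lambda>x. c * T f x)"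
  "f \<in> ell2 J \<Longrightarrow> \<zero>\<^bsub>bounded_operator_algebra J\<^esub> f = (\<lambda>x. 0)"
  by (simp_all add: bounded_operator_algebra_def compose_def)

lemma bounded_operators_zero_closed: "\<zero>\<^bsub>bounded_operator_algebra J\<^esub> \<in> bounded_operators J"
  by (auto simp: bounded_operator_algebra_def ell2_zero intro!: bounded_operators_restrict[where K = 0])

lemma bounded_operators_smult_closed:
  assumes T: "T \<in> bounded_operators J"
  shows "c \<odot>\<^bsub>bounded_operator_algebra J\<^esub> T \<in> bounded_operators J"
proof -
  note D = bounded_operatorsD[OF T]
  have smult: "ell2_norm (\<lambda>x. c * T f x) \<le> (cmod c * op_norm J T) * ell2_norm f" if "f \<in> ell2 J" for f
    using that D ell2_norm_op_le[OF T that] by (simp add: ell2_norm_smult[of _ J] mult.assoc mult_left_mono)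
  have "c \<odot>\<^bsub>bounded_operator_algebra J\<^esub> T = (\<lambda>f\<in>ell2 J. \<lambda>x. c * T f x)"
    by (simp add: bounded_operator_algebra_def)
  also have "\<dots> \<in> bounded_operators J"
    by (rule bounded_operators_restrict[OF _ _ _ smult]) (auto simp: D ell2_smult algebra_simps)
  finally show ?thesis .
qed

lemma bounded_operators_closed:
  assumes S: "S \<in> bounded_operators J" and T: "T \<in> bounded_operators J"
  shows "S \<otimes>\<^bsub>bounded_operator_algebra J\<^esub> T \<in> bounded_operators J"
    and "S \<oplus>\<^bsub>bounded_operator_algebra J\<^esub> T \<in> bounded_operators J"
    and "op_norm J (S \<otimes>\<^bsub>bounded_operator_algebra J\<^esub> T) \<le> op_norm J S * op_norm J T"
    and "op_norm J (S \<oplus>\<^bsub>bounded_operator_algebra J\<^esub> T) \<le> op_norm J S + op_norm J T"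
proof -
  note D = bounded_operatorsD[OF S] bounded_operatorsD[OF T]
  have mult: "ell2_norm (S (T f)) \<le> op_norm J S * op_norm J T * ell2_norm f" if "f \<in> ell2 J" for f
  proof -
    have "ell2_norm (S (T f)) \<le> op_norm J S * ell2_norm (T f)" using that D by (intro ell2_norm_op_le S)
    also have "\<dots> \<le> op_norm J S * (op_norm J T * ell2_norm f)"
      using that by (intro mult_left_mono ell2_norm_op_le T op_norm_ge0 S)
    finally show ?thesis by simp
  qed
  have add: "ell2_norm (\<lambda>x. S f x + T f x) \<le> (op_norm J S + op_norm J T) * ell2_norm f"
    if "f \<in> ell2 J" for f
    using ell2_add(2)[OF D(1,4)[OF that]] ell2_norm_op_le[OF S that] ell2_norm_op_le[OF T that]
    by (simp add: distrib_right)
  let ?B = "bounded_operator_algebra J"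
  have "S \<otimes>\<^bsub>?B\<^esub> T = (\<lambda>f\<in>ell2 J. S (T f))"
    by (simp add: bounded_operator_algebra_def compose_def)
  also have "\<dots> \<in> bounded_operators J" by (rule bounded_operators_restrict[OF _ _ _ mult]) (auto simp: D)
  finally show "S \<otimes>\<^bsub>?B\<^esub> T \<in> bounded_operators J" .
  have "S \<oplus>\<^bsub>?B\<^esub> T = (\<lambda>f\<in>ell2 J. \<lambda>x. S f x + T f x)"
    by (simp add: bounded_operator_algebra_def)
  also have "\<dots> \<in> bounded_operators J"
    by (rule bounded_operators_restrict[OF _ _ _ add]) (auto simp: D ell2_add algebra_simps)
  finally show "S \<oplus>\<^bsub>?B\<^esub> T \<in> bounded_operators J" .
  show "op_norm J (S \<otimes>\<^bsub>bounded_operator_algebra J\<^esub> T) \<le> op_norm J S * op_norm J T"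
    using mult by (intro op_norm_leI) (auto simp: op_norm_ge0 S T bounded_operator_algebra_simps)
  show "op_norm J (S \<oplus>\<^bsub>bounded_operator_algebra J\<^esub> T) \<le> op_norm J S + op_norm J T"
    using add by (intro op_norm_leI) (auto simp: op_norm_ge0 S T bounded_operator_algebra_simps)
qed

lemma module_bounded_operators: "module (ring_of_type_algebra :: complex ring) (bounded_operator_algebra J)"
proof -
  note cl = bounded_operators_closed bounded_operators_smult_closed
      bounded_operators_zero_closed
  note simps = bounded_operator_algebra_simps bounded_operatorsD
  have "abelian_group (bounded_operator_algebra J)"
  proof (rule abelian_groupI)
    fix T assume T: "T \<in> carrier (bounded_operator_algebra J)"
    have "(-1) \<odot>\<^bsub>bounded_operator_algebra J\<^esub> T \<oplus>\<^bsub>bounded_operator_algebra J\<^esub> T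
        = \<zero>\<^bsub>bounded_operator_algebra J\<^esub>"
      using T by (intro bounded_operators_eqI[where J = J]) (auto simp: simps cl)
    then show "\<exists>y\<in>carrier (bounded_operator_algebra J).
        y \<oplus>\<^bsub>bounded_operator_algebra J\<^esub> T = \<zero>\<^bsub>bounded_operator_algebra J\<^esub>"
      using T cl(5)[OF T[unfolded simps], of "-1"] by (auto simp: simps)
  qed (auto simp: simps cl algebra_simps intro!: bounded_operators_eqI[where J = J])
  then show ?thesis
    by (intro moduleI cring_from_type_algebra)
      (auto simp: simps cl ring_of_type_algebra_def algebra_simps intro!: bounded_operators_eqI[where J = J])
qed

lemma bounded_operators_minus_apply:
  assumes "S \<in> bounded_operators J" "T \<in> bounded_operators J" "f \<in> ell2 J"
  shows "(S \<ominus>\<^bsub>bounded_operator_algebra J\<^esub> T) f = (\<lambda>x. S f x - T f x)"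
proof -
  interpret module "ring_of_type_algebra :: complex ring" "bounded_operator_algebra J"
    by (rule module_bounded_operators)
  have "\<ominus>\<^bsub>bounded_operator_algebra J\<^esub> T = (-1) \<odot>\<^bsub>bounded_operator_algebra J\<^esub> T"
    using assms by (intro M.minus_equality bounded_operators_eqI[where J = J])
      (auto simp: bounded_operators_closed bounded_operators_smult_closed
      bounded_operators_zero_closed bounded_operator_algebra_simps)
  then show ?thesis using assms by (simp add: a_minus_def bounded_operator_algebra_simps)
qed

lemma op_norm_eq_0_iff:
  assumes T: "T \<in> bounded_operators J"
  shows "op_norm J T = 0 \<longleftrightarrow> T = \<zero>\<^bsub>bounded_operator_algebra J\<^esub>"
proof
  assume "op_norm J T = 0"
  then have "T f = (\<lambda>x. 0)" if "f \<in> ell2 J" for f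
    using ell2_norm_op_le[OF T that] ell2_norm_ge0[of "T f"]
      ell2_norm_eq_0[OF bounded_operatorsD(1)[OF T that]] by simp
  then show "T = \<zero>\<^bsub>bounded_operator_algebra J\<^esub>"
    using T by (intro bounded_operators_eqI[where J = J])
      (auto simp: bounded_operators_zero_closed bounded_operator_algebra_simps)
next
  assume T0: "T = \<zero>\<^bsub>bounded_operator_algebra J\<^esub>"
  have "op_norm J T \<le> 0" by (rule op_norm_leI) (auto simp: T0 bounded_operator_algebra_simps ell2_zero)
  then show "op_norm J T = 0" using op_norm_ge0[OF T] by simp
qed

lemma op_norm_smult:
  assumes T: "T \<in> bounded_operators J"
  shows "op_norm J (c \<odot>\<^bsub>bounded_operator_algebra J\<^esub> T) = cmod c * op_norm J T"
proof -
  let ?B = "bounded_operator_algebra J"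
  have le: "op_norm J (c \<odot>\<^bsub>?B\<^esub> T) \<le> cmod c * op_norm J T" if T: "T \<in> bounded_operators J" for c T
    using ell2_norm_op_le[OF T] bounded_operatorsD(1)[OF T] op_norm_ge0[OF T]
    by (intro op_norm_leI)
      (auto simp: bounded_operator_algebra_simps ell2_norm_smult[of _ J] mult.assoc mult_left_mono)
  show ?thesis
  proof (cases "c = 0")
    case True
    then show ?thesis using le[OF T, of c] op_norm_ge0[OF bounded_operators_smult_closed[OF T, of c]] by simp
  next
    case False
    have "T = inverse c \<odot>\<^bsub>?B\<^esub> (c \<odot>\<^bsub>?B\<^esub> T)"
      using T False by (intro bounded_operators_eqI[where J = J])
        (auto simp: bounded_operators_closed bounded_operators_smult_closed
      bounded_operators_zero_closed bounded_operator_algebra_simps)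
    then have "op_norm J T \<le> cmod (inverse c) * op_norm J (c \<odot>\<^bsub>?B\<^esub> T)"
      using le[OF bounded_operators_smult_closed[OF T, of c], of "inverse c"] by simp
    then have "cmod c * op_norm J T \<le> op_norm J (c \<odot>\<^bsub>?B\<^esub> T)"
      using False by (simp add: norm_inverse norm_divide field_simps)
    then show ?thesis using le[OF T, of c] by simp
  qed
qed

text \<open>
  The nontrivial inequality comes from \<open>\<parallel>T f\<parallel>\<^sup>2 = \<langle>f, T\<^sup>* T f\<rangle> \<le> \<parallel>T\<^sup>* T\<parallel> \<parallel>f\<parallel>\<^sup>2\<close>.
\<close>

lemma op_norm_cstar_identity:
  assumes T: "T \<in> bounded_operators J"
  shows "op_norm J (op_adj J T \<otimes>\<^bsub>bounded_operator_algebra J\<^esub> T) = (op_norm J T)\<^sup>2"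
proof (rule antisym)
  let ?S = "op_adj J T \<otimes>\<^bsub>bounded_operator_algebra J\<^esub> T"
  note A = op_adj(1)[OF T]
  have S: "?S \<in> bounded_operators J" by (rule bounded_operators_closed[OF A T])
  have "op_norm J ?S \<le> op_norm J (op_adj J T) * op_norm J T" by (rule bounded_operators_closed[OF A T])
  also have "\<dots> \<le> op_norm J T * op_norm J T" by (intro mult_right_mono op_norm_adj_le op_norm_ge0 T)
  finally show "op_norm J ?S \<le> (op_norm J T)\<^sup>2" by (simp add: power2_eq_square)
  have "op_norm J T \<le> sqrt (op_norm J ?S)"
  proof (rule op_norm_leI)
    fix f assume f: "f \<in> ell2 J"
    note Tf = bounded_operatorsD(1)[OF T f]
    have Sf: "?S f \<in> ell2 J" by (rule bounded_operatorsD(1)[OF S f])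
    have "(ell2_norm (T f))\<^sup>2 = cmod (ell2_inner (T f) (T f))"
      using ell2_inner_self[OF Tf] by (simp add: norm_power ell2_norm_ge0)
    also have "\<dots> = cmod (ell2_inner f (?S f))"
      using op_adj(2)[OF T f Tf] f by (simp add: bounded_operator_algebra_simps)
    also have "\<dots> \<le> ell2_norm f * (op_norm J ?S * ell2_norm f)"
      using cmod_ell2_inner_le[OF f Sf] mult_left_mono[OF ell2_norm_op_le[OF S f] ell2_norm_ge0[of f]]
      by linarith
    also have "\<dots> = (sqrt (op_norm J ?S) * ell2_norm f)\<^sup>2"
      using op_norm_ge0[OF S] by (simp add: power_mult_distrib power2_eq_square algebra_simps)
    finally show "ell2_norm (T f) \<le> sqrt (op_norm J ?S) * ell2_norm f"
      using op_norm_ge0[OF S] by (simp add: power2_le_iff_abs_le ell2_norm_ge0)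
  qed (use op_norm_ge0[OF S] in simp)
  then show "(op_norm J T)\<^sup>2 \<le> op_norm J ?S"
    using op_norm_ge0[OF T] op_norm_ge0[OF S] real_le_rsqrt sqrt_le_D
    by (metis power_mono real_sqrt_pow2)
qed

lemma cdist_bounded_operators:
  assumes "S \<in> bounded_operators J" "T \<in> bounded_operators J"
  shows "cdist (bounded_operator_algebra J) S T = op_norm J (S \<ominus>\<^bsub>bounded_operator_algebra J\<^esub> T)"
  using assms by (simp add: cdist_def bounded_operator_algebra_simps)

lemma bounded_operators_minus_closed:
  assumes "S \<in> bounded_operators J" "T \<in> bounded_operators J"
  shows "S \<ominus>\<^bsub>bounded_operator_algebra J\<^esub> T \<in> bounded_operators J"
proof -
  interpret module "ring_of_type_algebra :: complex ring" "bounded_operator_algebra J"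
    by (rule module_bounded_operators)
  show ?thesis using assms M.minus_closed[of S T] by (simp add: bounded_operator_algebra_simps)
qed

lemma op_norm_minus_leI:
  assumes "S \<in> bounded_operators J" "T \<in> bounded_operators J" "0 \<le> K"
    and "\<And>f. f \<in> ell2 J \<Longrightarrow> ell2_dist (S f) (T f) \<le> K * ell2_norm f"
  shows "op_norm J (S \<ominus>\<^bsub>bounded_operator_algebra J\<^esub> T) \<le> K"
  using assms by (intro op_norm_leI) (auto simp: bounded_operators_minus_apply)

lemma ell2_dist_op_le:
  assumes "S \<in> bounded_operators J" "T \<in> bounded_operators J" "f \<in> ell2 J"
  shows "ell2_dist (S f) (T f) \<le> op_norm J (S \<ominus>\<^bsub>bounded_operator_algebra J\<^esub> T) * ell2_norm f"
  using ell2_norm_op_le[OF bounded_operators_minus_closed[OF assms(1,2)] assms(3)]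
  by (simp add: bounded_operators_minus_apply assms)

lemma op_norm_minus_commute:
  assumes "S \<in> bounded_operators J" "T \<in> bounded_operators J"
  shows "op_norm J (S \<ominus>\<^bsub>bounded_operator_algebra J\<^esub> T) = op_norm J (T \<ominus>\<^bsub>bounded_operator_algebra J\<^esub> S)"
proof -
  have "op_norm J (S \<ominus>\<^bsub>bounded_operator_algebra J\<^esub> T) \<le> op_norm J (T \<ominus>\<^bsub>bounded_operator_algebra J\<^esub> S)"
    if "S \<in> bounded_operators J" "T \<in> bounded_operators J" for S T
    using ell2_dist_op_le[OF that(2,1)] bounded_operatorsD(1)[OF that(1)] bounded_operatorsD(1)[OF that(2)]
    by (intro op_norm_minus_leI that op_norm_ge0 bounded_operators_minus_closed)
      (auto simp: ell2_norm_minus_commute[of "S _" J])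
  then show ?thesis using assms by (metis antisym)
qed

text \<open>
  This repeats \<open>cstar_algebra.Metric_space_cdist\<close> for the bounded operators, which are not yet
  known to be a C*-algebra: completeness, the one axiom still missing, presupposes the metric
  space.
\<close>

lemma Metric_space_bounded_operators:
  "Metric_space (bounded_operators J) (cdist (bounded_operator_algebra J))"
proof
  let ?B = "bounded_operator_algebra J"
  note minus = bounded_operators_minus_closed and dist = cdist_bounded_operators
  show "0 \<le> cdist ?B S T" for S T
    using op_norm_ge0[OF minus, of S J T] by (auto simp: cdist_def bounded_operator_algebra_simps)
  show "cdist ?B S T = cdist ?B T S" for S T
    using op_norm_minus_commute[of S J T] by (auto simp: cdist_def bounded_operator_algebra_simps)
  show "cdist ?B S T = 0 \<longleftrightarrow> S = T" if ST: "S \<in> bounded_operators J" "T \<in> bounded_operators J" for S T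
  proof
    assume "cdist ?B S T = 0"
    then have "S f = T f" if "f \<in> ell2 J" for f
    proof -
      have "ell2_dist (S f) (T f) = 0"
        using ell2_dist_op_le[OF ST that] ell2_norm_ge0[of "\<lambda>x. S f x - T f x"] \<open>cdist ?B S T = 0\<close>
        by (simp add: dist ST)
      then have "(\<lambda>x. S f x - T f x) = (\<lambda>x. 0)"
        using ell2_norm_eq_0[OF ell2_diff[OF bounded_operatorsD(1)[OF ST(1) that] bounded_operatorsD(1)[OF ST(2) that]]]
        by simp
      then show ?thesis by (metis eq_iff_diff_eq_0 ext)
    qed
    then show "S = T" using ST by (intro bounded_operators_eqI)
  next
    assume "S = T"
    have "op_norm J (T \<ominus>\<^bsub>?B\<^esub> T) \<le> 0"
      by (rule op_norm_minus_leI[OF ST(2,2)]) (auto simp: ell2_zero)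
    then show "cdist ?B S T = 0" using op_norm_ge0[OF minus[OF ST(2,2)]] by (simp add: dist ST \<open>S = T\<close>)
  qed
  show "cdist ?B R T \<le> cdist ?B R S + cdist ?B S T"
    if RST: "R \<in> bounded_operators J" "S \<in> bounded_operators J" "T \<in> bounded_operators J" for R S T
  proof -
    have "ell2_dist (R f) (T f) \<le> (op_norm J (R \<ominus>\<^bsub>?B\<^esub> S) + op_norm J (S \<ominus>\<^bsub>?B\<^esub> T)) * ell2_norm f"
      if f: "f \<in> ell2 J" for f
      using ell2_dist_triangle[OF RST[THEN bounded_operatorsD(1), OF f]]
        ell2_dist_op_le[OF RST(1,2) f] ell2_dist_op_le[OF RST(2,3) f]
      by (simp add: distrib_right)
    then show ?thesis
      using RST by (simp add: dist) (intro op_norm_minus_leI add_nonneg_nonneg op_norm_ge0 minus)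
  qed
qed

text \<open>
  For each vector \<open>f\<close> the images of \<open>f\<close> converge, and the distance to the limit is at most \<open>\<epsilon>\<close>
  times the norm of \<open>f\<close> with \<open>\<epsilon>\<close> independent of \<open>f\<close>. So the pointwise limit is bounded, and it is
  the limit in norm.
\<close>

lemma bounded_operators_mcomplete:
  "Metric_space.mcomplete (bounded_operators J) (cdist (bounded_operator_algebra J))"
proof -
  let ?B = "bounded_operator_algebra J"
  interpret Metric_space "bounded_operators J" "cdist ?B" by (rule Metric_space_bounded_operators)
  show ?thesis
    unfolding mcomplete_def
  proof (intro allI impI)
    fix \<sigma> assume \<sigma>: "MCauchy \<sigma>"
    then have B: "\<sigma> n \<in> bounded_operators J" for n by (auto simp: MCauchy_def)
    have Cauchy: "\<exists>N. \<forall>m\<ge>N. \<forall>n\<ge>N. op_norm J (\<sigma> m \<ominus>\<^bsub>?B\<^esub> \<sigma> n) < \<epsilon>" if "\<epsilon> > 0" for \<epsilon>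
      using \<sigma> that unfolding MCauchy_def by (simp add: cdist_bounded_operators B)
    define T where "T = (\<lambda>f\<in>ell2 J. \<lambda>x. lim (\<lambda>n. \<sigma> n f x))"
    note mem = bounded_operatorsD(1)[OF B]
    have dist_le: "ell2_dist (\<sigma> m f) (\<sigma> n f) \<le> \<epsilon> * ell2_norm f"
      if "op_norm J (\<sigma> m \<ominus>\<^bsub>?B\<^esub> \<sigma> n) < \<epsilon>" "f \<in> ell2 J" for m n f \<epsilon>
      using ell2_dist_op_le[OF B B that(2), of m n] that(1) ell2_norm_ge0[of f]
      by (meson less_imp_le mult_right_mono order_trans)
    have Cauchy_f: "\<exists>N. \<forall>m\<ge>N. \<forall>n\<ge>N. ell2_dist (\<sigma> m f) (\<sigma> n f) < \<epsilon>" if "\<epsilon> > 0" "f \<in> ell2 J" for f \<epsilon>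
    proof -
      define \<delta> where "\<delta> = \<epsilon> / (ell2_norm f + 1)"
      have pos: "ell2_norm f + 1 > 0" using ell2_norm_ge0[of f] by simp
      then have "\<delta> > 0" using that by (simp add: \<delta>_def)
      moreover have "\<delta> * ell2_norm f < \<epsilon>"
        using pos that by (simp add: \<delta>_def field_simps)
      ultimately show ?thesis using Cauchy dist_le[OF _ that(2), of _ _ \<delta>] by (meson order_le_less_trans)
    qed
    note lim = ell2_Cauchy_limit[OF mem Cauchy_f]
    have T_in: "T f \<in> ell2 J" if "f \<in> ell2 J" for f using lim(2) that by (simp add: T_def)
    have close: "ell2_dist (\<sigma> n f) (T f) \<le> \<epsilon> * ell2_norm f"
      if "\<forall>m\<ge>N. op_norm J (\<sigma> n \<ominus>\<^bsub>?B\<^esub> \<sigma> m) < \<epsilon>" "f \<in> ell2 J" for n N f \<epsilon>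
    proof -
      have "ell2_dist (\<sigma> n f) (\<lambda>x. lim (\<lambda>n. \<sigma> n f x)) \<le> \<epsilon> * ell2_norm f"
        by (rule ell2_Cauchy_limit(3)[where N = N and g = "\<lambda>n. \<sigma> n f", OF mem Cauchy_f])
          (use that dist_le in auto)
      then show ?thesis using that by (simp add: T_def)
    qed
    have "T = restrict T (ell2 J)" by (simp add: T_def)
    moreover have "restrict T (ell2 J) \<in> bounded_operators J"
    proof -
      obtain N where N: "\<forall>m\<ge>N. op_norm J (\<sigma> N \<ominus>\<^bsub>?B\<^esub> \<sigma> m) < 1" using Cauchy[of 1] by auto
      show ?thesis
      proof (rule bounded_operators_restrict)
        fix f assume f: "f \<in> ell2 J"
        have "ell2_norm (T f) = ell2_dist (T f) (\<lambda>x. 0)" by simp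
        also have "\<dots> \<le> ell2_dist (T f) (\<sigma> N f) + ell2_dist (\<sigma> N f) (\<lambda>x. 0)"
          by (rule ell2_dist_triangle[OF T_in[OF f] mem[OF f] ell2_zero(1)])
        also have "\<dots> \<le> 1 * ell2_norm f + op_norm J (\<sigma> N) * ell2_norm f"
          using close[OF N f] ell2_norm_op_le[OF B f, of N] ell2_norm_minus_commute[OF T_in[OF f] mem[OF f, of N]]
          by simp
        finally show "ell2_norm (T f) \<le> (1 + op_norm J (\<sigma> N)) * ell2_norm f" by (simp add: distrib_right)
      next
        fix f g assume fg: "f \<in> ell2 J" "g \<in> ell2 J"
        show "T (\<lambda>x. f x + g x) = (\<lambda>x. T f x + T g x)"
        proof
          fix x
          have "(\<lambda>n. \<sigma> n (\<lambda>x. f x + g x) x) \<longlonglongrightarrow> T f x + T g x"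
            using tendsto_add[OF lim(1)[OF fg(1), of x] lim(1)[OF fg(2), of x]] fg
            by (simp add: bounded_operatorsD(2)[OF B] T_def)
          then show "T (\<lambda>x. f x + g x) x = T f x + T g x"
            using fg by (simp add: T_def ell2_add limI)
        qed
      next
        fix c f assume f: "f \<in> ell2 J"
        show "T (\<lambda>x. c * f x) = (\<lambda>x. c * T f x)"
        proof
          fix x
          have "(\<lambda>n. \<sigma> n (\<lambda>x. c * f x) x) \<longlonglongrightarrow> c * T f x"
            using tendsto_mult_left[OF lim(1)[OF f, of x], of c] f
            by (simp add: bounded_operatorsD(3)[OF B] T_def)
          then show "T (\<lambda>x. c * f x) x = c * T f x"
            using f by (simp add: T_def ell2_smult limI)
        qed
      qed (rule T_in)
    qed
    ultimately have T: "T \<in> bounded_operators J" by simp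
    have "limitin mtopology \<sigma> T sequentially"
      unfolding limit_metric_sequentially
    proof (intro conjI T allI impI)
      fix \<epsilon> :: real assume "\<epsilon> > 0"
      then obtain N where N: "\<forall>m\<ge>N. \<forall>n\<ge>N. op_norm J (\<sigma> m \<ominus>\<^bsub>?B\<^esub> \<sigma> n) < \<epsilon> / 2"
        using Cauchy[of "\<epsilon> / 2"] by auto
      have "\<sigma> n \<in> bounded_operators J \<and> cdist ?B (\<sigma> n) T < \<epsilon>" if "n \<ge> N" for n
      proof -
        have "op_norm J (\<sigma> n \<ominus>\<^bsub>?B\<^esub> T) \<le> \<epsilon> / 2"
          using N that \<open>\<epsilon> > 0\<close> by (intro op_norm_minus_leI B T close[of N]) auto
        then show ?thesis using \<open>\<epsilon> > 0\<close> B by (simp add: cdist_bounded_operators B T)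
      qed
      then show "\<exists>N. \<forall>n\<ge>N. \<sigma> n \<in> bounded_operators J \<and> cdist ?B (\<sigma> n) T < \<epsilon>" by blast
    qed
    then show "\<exists>T. limitin mtopology \<sigma> T sequentially" by blast
  qed
qed

theorem cstar_algebra_bounded_operators: "cstar_algebra (bounded_operator_algebra J)"
proof (intro cstar_algebra.intro module_bounded_operators cstar_algebra_axioms.intro)
  let ?B = "bounded_operator_algebra J"
  note simps = bounded_operator_algebra_simps
  note cl = bounded_operators_closed bounded_operators_smult_closed op_adj(1)
  note D = bounded_operatorsD
  fix S assume S: "S \<in> carrier ?B"
  then have S: "S \<in> bounded_operators J" by (simp add: simps)
  have inner_adj: "ell2_inner f (S g) = ell2_inner (op_adj J S f) g"
    if "S \<in> bounded_operators J" "f \<in> ell2 J" "g \<in> ell2 J" for S f g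
    using op_adj(2)[OF that(1,3,2)] ell2_inner_commute[of f "S g"] ell2_inner_commute[of "op_adj J S f" g]
    by simp
  show "op_adj J S \<in> carrier ?B" by (simp add: simps cl S)
  show "op_adj J (op_adj J S) = S"
    by (rule op_adjI[OF S]) (simp add: inner_adj S)
  show "op_adj J (c \<odot>\<^bsub>?B\<^esub> S) = cnj c \<odot>\<^bsub>?B\<^esub> op_adj J S" for c
  proof (rule op_adjI)
    fix f g assume fg: "f \<in> ell2 J" "g \<in> ell2 J"
    then show "ell2_inner ((c \<odot>\<^bsub>?B\<^esub> S) f) g = ell2_inner f ((cnj c \<odot>\<^bsub>?B\<^esub> op_adj J S) g)"
      using fg op_adj(2)[OF S fg] by (simp add: simps ell2_inner_smult_left ell2_inner_smult_right)
  qed (intro cl S)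
  show "cnorm ?B S = 0 \<longleftrightarrow> S = \<zero>\<^bsub>?B\<^esub>" by (rule op_norm_eq_0_iff[OF S])
  show "cnorm ?B (c \<odot>\<^bsub>?B\<^esub> S) = cmod c * cnorm ?B S" for c by (rule op_norm_smult[OF S])
  show "cnorm ?B (op_adj J S \<otimes>\<^bsub>?B\<^esub> S) = (cnorm ?B S)\<^sup>2" by (rule op_norm_cstar_identity[OF S])
  fix T assume T: "T \<in> carrier ?B"
  then have T: "T \<in> bounded_operators J" by (simp add: simps)
  show "S \<otimes>\<^bsub>?B\<^esub> T \<in> carrier ?B" by (simp add: simps cl S T)
  show "c \<odot>\<^bsub>?B\<^esub> S \<otimes>\<^bsub>?B\<^esub> T = c \<odot>\<^bsub>?B\<^esub> (S \<otimes>\<^bsub>?B\<^esub> T)" for c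
    by (rule bounded_operators_eqI[where J = J]) (use S T in \<open>auto simp: simps cl D\<close>)
  show "S \<otimes>\<^bsub>?B\<^esub> (c \<odot>\<^bsub>?B\<^esub> T) = c \<odot>\<^bsub>?B\<^esub> (S \<otimes>\<^bsub>?B\<^esub> T)" for c
    by (rule bounded_operators_eqI[where J = J]) (use S T in \<open>auto simp: simps cl D\<close>)
  show "cnorm ?B (S \<oplus>\<^bsub>?B\<^esub> T) \<le> cnorm ?B S + cnorm ?B T"
    and "cnorm ?B (S \<otimes>\<^bsub>?B\<^esub> T) \<le> cnorm ?B S * cnorm ?B T"
    using cl(3,4)[OF S T] by auto
  show "op_adj J (S \<otimes>\<^bsub>?B\<^esub> T) = op_adj J T \<otimes>\<^bsub>?B\<^esub> op_adj J S"
  proof (rule op_adjI)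
    fix f g assume fg: "f \<in> ell2 J" "g \<in> ell2 J"
    then show "ell2_inner ((S \<otimes>\<^bsub>?B\<^esub> T) f) g = ell2_inner f ((op_adj J T \<otimes>\<^bsub>?B\<^esub> op_adj J S) g)"
      using op_adj(2)[OF S D(1)[OF T fg(1)] fg(2)] op_adj(2)[OF T fg(1) D(1)[OF op_adj(1)[OF S] fg(2)]]
      by (simp add: simps)
  qed (intro cl S T)
  show "op_adj J (S \<oplus>\<^bsub>?B\<^esub> T) = op_adj J S \<oplus>\<^bsub>?B\<^esub> op_adj J T"
  proof (rule op_adjI)
    fix f g assume fg: "f \<in> ell2 J" "g \<in> ell2 J"
    let ?s = "op_adj J S g" and ?t = "op_adj J T g"
    have st: "?s \<in> ell2 J" "?t \<in> ell2 J"
      by (rule D(1)[OF op_adj(1)[OF S] fg(2)], rule D(1)[OF op_adj(1)[OF T] fg(2)])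
    show "ell2_inner ((S \<oplus>\<^bsub>?B\<^esub> T) f) g = ell2_inner f ((op_adj J S \<oplus>\<^bsub>?B\<^esub> op_adj J T) g)"
      using fg op_adj(2)[OF S fg] op_adj(2)[OF T fg]
      by (simp add: simps ell2_inner_add_left[OF D(1)[OF S fg(1)] D(1)[OF T fg(1)] fg(2)]
          ell2_inner_add_right[OF fg(1) st])
  qed (intro cl S T)
  fix R assume R: "R \<in> carrier ?B"
  then have R: "R \<in> bounded_operators J" by (simp add: simps)
  show "S \<otimes>\<^bsub>?B\<^esub> T \<otimes>\<^bsub>?B\<^esub> R = S \<otimes>\<^bsub>?B\<^esub> (T \<otimes>\<^bsub>?B\<^esub> R)"
    and "(S \<oplus>\<^bsub>?B\<^esub> T) \<otimes>\<^bsub>?B\<^esub> R = S \<otimes>\<^bsub>?B\<^esub> R \<oplus>\<^bsub>?B\<^esub> T \<otimes>\<^bsub>?B\<^esub> R"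
    and "R \<otimes>\<^bsub>?B\<^esub> (S \<oplus>\<^bsub>?B\<^esub> T) = R \<otimes>\<^bsub>?B\<^esub> S \<oplus>\<^bsub>?B\<^esub> R \<otimes>\<^bsub>?B\<^esub> T"
    by (rule bounded_operators_eqI[where J = J]; use R S T in \<open>auto simp: simps cl D\<close>)+
qed (use bounded_operators_mcomplete in \<open>simp add: bounded_operator_algebra_simps\<close>)

section \<open>Partial permutation operators\<close>

definition partial_bij :: "'x set \<Rightarrow> ('x \<Rightarrow> 'x option) \<Rightarrow> bool" where
  "partial_bij J \<tau> \<longleftrightarrow> dom \<tau> \<subseteq> J \<and> ran \<tau> \<subseteq> J \<and> inj_on \<tau> (dom \<tau>)"

lemma partial_bijI:
  assumes "\<And>y x. \<sigma> y = Some x \<Longrightarrow> y \<in> J \<and> x \<in> J"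
    and "\<And>y y' x. \<lbrakk>\<sigma> y = Some x; \<sigma> y' = Some x\<rbrakk> \<Longrightarrow> y = y'"
  shows "partial_bij J \<sigma>"
  unfolding partial_bij_def
proof (intro conjI inj_onI subsetI)
  show "y \<in> J" if "y \<in> dom \<sigma>" for y using domD[OF that] assms(1) by blast
  show "x \<in> J" if "x \<in> ran \<sigma>" for x using that assms(1) by (auto simp: ran_def)
  show "y = z" if "y \<in> dom \<sigma>" "z \<in> dom \<sigma>" "\<sigma> y = \<sigma> z" for y z
    using domD[OF that(1)] assms(2) that(3) by metis
qed

text \<open>
  Partial bijections \<open>\<tau>\<close> of \<open>J\<close>, written as partial functions, act on \<open>\<ell>\<^sup>2(J)\<close> by reindexing.
  Products of such operators are compositions in the option monad and adjoints are inverses, so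
  that identities between these operators reduce to identities between partial functions.
\<close>

definition pull_op :: "'x set \<Rightarrow> ('x \<Rightarrow> 'x option) \<Rightarrow> (('x \<Rightarrow> complex) \<Rightarrow> ('x \<Rightarrow> complex))" where
  "pull_op J \<tau> = (\<lambda>f\<in>ell2 J. \<lambda>y. case \<tau> y of None \<Rightarrow> 0 | Some x \<Rightarrow> f x)"

lemma pull_op_apply: "f \<in> ell2 J \<Longrightarrow> pull_op J \<tau> f y = (case \<tau> y of None \<Rightarrow> 0 | Some x \<Rightarrow> f x)"
  by (simp add: pull_op_def)

lemma pull_op_bounded:
  assumes \<tau>: "partial_bij J \<tau>"
  shows "pull_op J \<tau> \<in> bounded_operators J"
proof -
  have off: "(case \<tau> y of None \<Rightarrow> 0 | Some x \<Rightarrow> f x) = (0 :: complex)" if "y \<notin> J" for f y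
    using \<tau> that by (auto simp: partial_bij_def dom_def split: option.splits)
  have L2: "L2_set (\<lambda>y. cmod (case \<tau> y of None \<Rightarrow> 0 | Some x \<Rightarrow> f x)) F \<le> 1 * ell2_norm f"
    if f: "f \<in> ell2 J" and F: "finite F" "F \<subseteq> J" for f F
  proof -
    let ?D = "F \<inter> dom \<tau>"
    have inj: "inj_on (\<lambda>y. the (\<tau> y)) ?D"
    proof (rule inj_onI)
      fix y z assume yz: "y \<in> ?D" "z \<in> ?D" "the (\<tau> y) = the (\<tau> z)"
      then have "\<tau> y = \<tau> z" by auto
      then show "y = z" using \<tau> yz by (auto simp: partial_bij_def dest: inj_onD)
    qed
    have "L2_set (\<lambda>y. cmod (case \<tau> y of None \<Rightarrow> 0 | Some x \<Rightarrow> f x)) F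
        = L2_set (\<lambda>x. cmod (f x)) ((\<lambda>y. the (\<tau> y)) ` ?D)"
      unfolding L2_set_def sum.reindex[OF inj] using F
      by (intro arg_cong[where f = sqrt] sum.mono_neutral_cong_right) (auto split: option.splits)
    also have "\<dots> \<le> ell2_norm f" using F by (intro L2_set_le_ell2_norm[OF f]) auto
    finally show ?thesis by simp
  qed
  show ?thesis
    unfolding pull_op_def
  proof (rule bounded_operators_restrict)
    fix f assume f: "f \<in> ell2 J"
    show "(\<lambda>y. case \<tau> y of None \<Rightarrow> 0 | Some x \<Rightarrow> f x) \<in> ell2 J"
      "ell2_norm (\<lambda>y. case \<tau> y of None \<Rightarrow> 0 | Some x \<Rightarrow> f x) \<le> 1 * ell2_norm f"
      by (rule ell2_leI[OF off L2[OF f]]; assumption)+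
  qed (auto split: option.splits)
qed

lemma op_adj_pull_op:
  assumes \<sigma>: "partial_bij J \<sigma>" and \<tau>: "partial_bij J \<tau>"
    and inv: "\<And>x y. \<sigma> y = Some x \<longleftrightarrow> \<tau> x = Some y"
  shows "op_adj J (pull_op J \<sigma>) = pull_op J \<tau>"
proof (rule op_adjI[OF pull_op_bounded[OF \<tau>]])
  fix f g assume f: "f \<in> ell2 J" and g: "g \<in> ell2 J"
  have bij: "bij_betw (\<lambda>y. the (\<sigma> y)) (dom \<sigma>) (dom \<tau>)"
  proof (rule bij_betwI[where g = "\<lambda>x. the (\<tau> x)"])
    show "(\<lambda>y. the (\<sigma> y)) \<in> dom \<sigma> \<rightarrow> dom \<tau>" using inv by fastforce
    show "(\<lambda>x. the (\<tau> x)) \<in> dom \<tau> \<rightarrow> dom \<sigma>" using inv by fastforce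
    show "the (\<tau> (the (\<sigma> y))) = y" if y: "y \<in> dom \<sigma>" for y
    proof -
      obtain x where "\<sigma> y = Some x" using y by blast
      moreover from this have "\<tau> x = Some y" by (simp add: inv)
      ultimately show ?thesis by simp
    qed
    show "the (\<sigma> (the (\<tau> x))) = x" if x: "x \<in> dom \<tau>" for x
    proof -
      obtain y where "\<tau> x = Some y" using x by blast
      moreover from this have "\<sigma> y = Some x" by (simp add: inv)
      ultimately show ?thesis by simp
    qed
  qed
  have "ell2_inner (pull_op J \<sigma> f) g = (\<Sum>\<^sub>\<infinity>y\<in>dom \<sigma>. f (the (\<sigma> y)) * cnj (g y))"
    unfolding ell2_inner_def by (rule infsum_cong_neutral) (auto simp: pull_op_apply f)
  also have "\<dots> = (\<Sum>\<^sub>\<infinity>y\<in>dom \<sigma>. f (the (\<sigma> y)) * cnj (g (the (\<tau> (the (\<sigma> y))))))"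
    using inv by (intro infsum_cong) (metis domD option.sel)
  also have "\<dots> = (\<Sum>\<^sub>\<infinity>x\<in>dom \<tau>. f x * cnj (g (the (\<tau> x))))"
    by (rule infsum_reindex_bij_betw[OF bij])
  also have "\<dots> = ell2_inner f (pull_op J \<tau> g)"
    unfolding ell2_inner_def by (rule infsum_cong_neutral) (auto simp: pull_op_apply g)
  finally show "ell2_inner (pull_op J \<sigma> f) g = ell2_inner f (pull_op J \<tau> g)" .
qed

lemma pull_op_mult:
  assumes "partial_bij J \<sigma>" "partial_bij J \<tau>"
  shows "pull_op J \<sigma> \<otimes>\<^bsub>bounded_operator_algebra J\<^esub> pull_op J \<tau> = pull_op J (\<lambda>y. Option.bind (\<sigma> y) \<tau>)"
proof -
  have "pull_op J \<sigma> (pull_op J \<tau> f) = pull_op J (\<lambda>y. Option.bind (\<sigma> y) \<tau>) f" if f: "f \<in> ell2 J" for f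
    using f bounded_operatorsD(1)[OF pull_op_bounded[OF assms(2)] f]
    by (intro ext) (auto simp: pull_op_apply split: option.splits)
  then have "(\<lambda>f\<in>ell2 J. pull_op J \<sigma> (pull_op J \<tau> f)) = restrict (pull_op J (\<lambda>y. Option.bind (\<sigma> y) \<tau>)) (ell2 J)"
    by (rule restrict_ext)
  also have "\<dots> = pull_op J (\<lambda>y. Option.bind (\<sigma> y) \<tau>)" by (simp add: pull_op_def)
  finally show ?thesis by (simp add: bounded_operator_algebra_def compose_def)
qed

lemma pull_op_empty: "pull_op J (\<lambda>_. None) = \<zero>\<^bsub>bounded_operator_algebra J\<^esub>"
  by (simp add: pull_op_def bounded_operator_algebra_def)

definition matrix_unit :: "'x set \<Rightarrow> 'x \<Rightarrow> 'x \<Rightarrow> (('x \<Rightarrow> complex) \<Rightarrow> ('x \<Rightarrow> complex))" where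
  "matrix_unit J x y = pull_op J [x \<mapsto> y]"

lemma partial_bij_single: "x \<in> J \<Longrightarrow> y \<in> J \<Longrightarrow> partial_bij J [x \<mapsto> y]"
  by (auto simp: partial_bij_def)

lemma matrix_unit_bounded: "x \<in> J \<Longrightarrow> y \<in> J \<Longrightarrow> matrix_unit J x y \<in> bounded_operators J"
  unfolding matrix_unit_def by (intro pull_op_bounded partial_bij_single)

lemma matrix_unit_apply: "f \<in> ell2 J \<Longrightarrow> matrix_unit J x y f = (\<lambda>z. if z = x then f y else 0)"
  by (auto simp: matrix_unit_def pull_op_apply)

lemma matrix_unit_mult:
  assumes "x \<in> J" "y \<in> J" "z \<in> J" "w \<in> J"
  shows "matrix_unit J x y \<otimes>\<^bsub>bounded_operator_algebra J\<^esub> matrix_unit J z w =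
    (if y = z then matrix_unit J x w else \<zero>\<^bsub>bounded_operator_algebra J\<^esub>)"
proof -
  have "(\<lambda>u. Option.bind ([x \<mapsto> y] u) [z \<mapsto> w]) = (if y = z then [x \<mapsto> w] else (\<lambda>_. None))"
    by auto
  then show ?thesis
    using assms by (simp add: matrix_unit_def pull_op_mult partial_bij_single pull_op_empty)
qed

lemma matrix_unit_adj:
  assumes "x \<in> J" "y \<in> J"
  shows "op_adj J (matrix_unit J x y) = matrix_unit J y x"
  unfolding matrix_unit_def
  by (rule op_adj_pull_op) (use assms in \<open>auto simp: partial_bij_single split: if_splits\<close>)

lemma matrix_unit_nonzero:
  assumes "x \<in> J" "y \<in> J"
  shows "matrix_unit J x y \<noteq> \<zero>\<^bsub>bounded_operator_algebra J\<^esub>"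
proof
  assume *: "matrix_unit J x y = \<zero>\<^bsub>bounded_operator_algebra J\<^esub>"
  have "matrix_unit J x y (basis_vec y) x = \<zero>\<^bsub>bounded_operator_algebra J\<^esub> (basis_vec y) x"
    by (simp add: *)
  then show False
    using basis_vec_ell2[OF assms(2)]
    by (simp add: matrix_unit_apply bounded_operator_algebra_simps, simp add: basis_vec_def)
qed

definition mat_op :: "'x set \<Rightarrow> 'x set \<Rightarrow> ('x \<Rightarrow> 'x \<Rightarrow> complex) \<Rightarrow> (('x \<Rightarrow> complex) \<Rightarrow> ('x \<Rightarrow> complex))" where
  "mat_op J F c = (\<lambda>f\<in>ell2 J. \<lambda>x. if x \<in> F then \<Sum>y\<in>F. c x y * f y else 0)"

lemma bounded_operators_finsum_apply:
  assumes "finite I" "\<And>i. i \<in> I \<Longrightarrow> T i \<in> bounded_operators J" "f \<in> ell2 J"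
  shows "finsum (bounded_operator_algebra J) T I f = (\<lambda>x. \<Sum>i\<in>I. T i f x)"
  using assms(1,2)
proof (induction I rule: finite_induct)
  case empty
  interpret B: cstar_algebra "bounded_operator_algebra J" by (rule cstar_algebra_bounded_operators)
  show ?case using assms(3) by (simp add: bounded_operator_algebra_simps)
next
  case (insert i I)
  interpret B: cstar_algebra "bounded_operator_algebra J" by (rule cstar_algebra_bounded_operators)
  show ?case
    using insert assms(3)
    by (subst B.M.finsum_insert) (auto simp: bounded_operator_algebra_simps)
qed

lemma finsum_matrix_units:
  assumes F: "finite F" "F \<subseteq> J"
  shows "finsum (bounded_operator_algebra J)
      (\<lambda>(x, y). c x y \<odot>\<^bsub>bounded_operator_algebra J\<^esub> matrix_unit J x y) (F \<times> F) = mat_op J F c"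
    (is "finsum ?B ?g _ = _")
proof -
  interpret B: cstar_algebra ?B by (rule cstar_algebra_bounded_operators)
  have g: "?g i \<in> bounded_operators J" if "i \<in> F \<times> F" for i
    using that F by (auto simp: bounded_operators_smult_closed matrix_unit_bounded subset_iff)
  have S: "finsum ?B ?g (F \<times> F) \<in> bounded_operators J"
    using B.M.finsum_closed[of ?g "F \<times> F"] g by (auto simp: bounded_operator_algebra_simps)
  have eq: "finsum ?B ?g (F \<times> F) f = mat_op J F c f" if f: "f \<in> ell2 J" for f
  proof
    fix x
    have "finsum ?B ?g (F \<times> F) f x = (\<Sum>i\<in>F \<times> F. ?g i f x)"
      using F by (simp add: bounded_operators_finsum_apply[OF _ g f])
    also have "\<dots> = (\<Sum>a\<in>F. \<Sum>b\<in>F. c a b * (if x = a then f b else 0))"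
      using f by (simp add: sum.cartesian_product bounded_operator_algebra_simps matrix_unit_apply case_prod_beta)
    also have "\<dots> = (\<Sum>a\<in>F. if x = a then \<Sum>b\<in>F. c a b * f b else 0)"
      by (intro sum.cong) auto
    also have "\<dots> = mat_op J F c f x" using F f by (simp add: mat_op_def)
    finally show "finsum ?B ?g (F \<times> F) f x = mat_op J F c f x" .
  qed
  have "finsum ?B ?g (F \<times> F) = restrict (finsum ?B ?g (F \<times> F)) (ell2 J)"
    using S by (auto simp: bounded_operators_def PiE_restrict)
  also have "\<dots> = restrict (mat_op J F c) (ell2 J)" by (rule restrict_ext) (rule eq)
  finally show ?thesis by (simp add: mat_op_def)
qed

lemma mat_op_bounded:
  assumes F: "finite F" "F \<subseteq> J"
  shows "mat_op J F c \<in> bounded_operators J"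
proof -
  interpret B: cstar_algebra "bounded_operator_algebra J" by (rule cstar_algebra_bounded_operators)
  show ?thesis
    unfolding finsum_matrix_units[OF F, symmetric] bounded_operator_algebra_simps(1)[symmetric]
    using F by (intro B.M.finsum_closed)
      (auto simp: bounded_operator_algebra_simps bounded_operators_smult_closed matrix_unit_bounded subset_iff)
qed

section \<open>Compact operators are the limits of finite matrices\<close>

lemma Metric_space_ell2: "Metric_space (ell2 J) ell2_dist"
proof
  show "0 \<le> ell2_dist f g" for f g :: "'x \<Rightarrow> complex" by (rule ell2_norm_ge0)
  show "ell2_dist f g = ell2_dist g f" for f g :: "'x \<Rightarrow> complex"
    by (simp add: ell2_norm_def norm_minus_commute)
  show "ell2_dist f g = 0 \<longleftrightarrow> f = g" if "f \<in> ell2 J" "g \<in> ell2 J" for f g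
    using ell2_norm_eq_0[OF ell2_diff[OF that]] by (auto simp: fun_eq_iff)
  show "ell2_dist f h \<le> ell2_dist f g + ell2_dist g h"
    if "f \<in> ell2 J" "g \<in> ell2 J" "h \<in> ell2 J" for f g h
    by (rule ell2_dist_triangle[OF that])
qed

lemma ell2_mcomplete: "Metric_space.mcomplete (ell2 J) ell2_dist"
proof -
  interpret Metric_space "ell2 J" ell2_dist by (rule Metric_space_ell2)
  show ?thesis
    unfolding mcomplete_def
  proof (intro allI impI)
    fix g assume g: "MCauchy g"
    then have mem: "g n \<in> ell2 J" for n unfolding MCauchy_def by (meson range_subsetD)
    have Cauchy: "\<exists>N. \<forall>m\<ge>N. \<forall>n\<ge>N. ell2_dist (g m) (g n) < \<epsilon>" if "\<epsilon> > 0" for \<epsilon>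
      using conjunct2[OF g[unfolded MCauchy_def]] that by simp
    note lim = ell2_Cauchy_limit[OF mem Cauchy]
    let ?h = "\<lambda>x. lim (\<lambda>n. g n x)"
    have "limitin mtopology g ?h sequentially"
      unfolding limit_metric_sequentially
    proof (intro conjI lim(2) allI impI)
      fix \<epsilon> :: real assume \<epsilon>: "\<epsilon> > 0"
      then obtain N where N: "\<forall>m\<ge>N. \<forall>n\<ge>N. ell2_dist (g m) (g n) < \<epsilon> / 2" using Cauchy[of "\<epsilon> / 2"] by auto
      have "ell2_dist (g n) ?h < \<epsilon>" if "n \<ge> N" for n
        using lim(3)[of N n "\<epsilon> / 2"] N that \<epsilon> by (auto simp: less_imp_le)
      then show "\<exists>N. \<forall>n\<ge>N. g n \<in> ell2 J \<and> ell2_dist (g n) ?h < \<epsilon>" using mem by blast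
    qed
    then show "\<exists>h. limitin mtopology g h sequentially" by blast
  qed
qed

lemma compact_operators_iff_totally_bounded:
  "T \<in> carrier (compact_operator_algebra J) \<longleftrightarrow>
    T \<in> bounded_operators J \<and> Metric_space.mtotally_bounded (ell2 J) ell2_dist (T ` ell2_ball J)"
proof -
  interpret Metric_space "ell2 J" ell2_dist by (rule Metric_space_ell2)
  show ?thesis
    using mtotally_bounded_eq_compact_closure_of[OF ell2_mcomplete, of "T ` ell2_ball J"]
    by (auto simp: compact_operator_algebra_def dest: bounded_operatorsD(1))
qed

text \<open>
  The centres of the net may lie outside \<open>S\<close>: doubling the radius moves them into \<open>S\<close>.
\<close>

lemma (in Metric_space) mtotally_boundedI:
  assumes S: "S \<subseteq> M"
    and net: "\<And>\<epsilon>. \<epsilon> > 0 \<Longrightarrow> \<exists>N. finite N \<and> N \<subseteq> M \<and> (\<forall>x\<in>S. \<exists>y\<in>N. d y x < \<epsilon>)"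
  shows "mtotally_bounded S"
  unfolding mtotally_bounded_def
proof (intro allI impI)
  fix \<epsilon> :: real assume "\<epsilon> > 0"
  then obtain N where N: "finite N" "N \<subseteq> M" "\<And>x. x \<in> S \<Longrightarrow> \<exists>y\<in>N. d y x < \<epsilon> / 2"
    using net[of "\<epsilon> / 2"] by auto
  \<comment> \<open>Only centres near a point of \<open>S\<close> can be replaced by a point of \<open>S\<close>.\<close>
  define N' where "N' = {y \<in> N. \<exists>x\<in>S. d y x < \<epsilon> / 2}"
  have "\<forall>y\<in>N'. \<exists>x. x \<in> S \<and> d y x < \<epsilon> / 2" unfolding N'_def by blast
  then obtain c where c: "\<And>y. y \<in> N' \<Longrightarrow> c y \<in> S \<and> d y (c y) < \<epsilon> / 2" by metis
  have "finite (c ` N')" using N by (simp add: N'_def)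
  moreover have "c ` N' \<subseteq> S" using c by auto
  moreover have "S \<subseteq> (\<Union>x\<in>c ` N'. mball x \<epsilon>)"
  proof
    fix x assume x: "x \<in> S"
    then obtain y where y: "y \<in> N" "d y x < \<epsilon> / 2" using N by blast
    then have y': "y \<in> N'" using x by (auto simp: N'_def)
    have "d (c y) x \<le> d (c y) y + d y x" using c[OF y'] x y S N by (intro triangle) auto
    then have "d (c y) x < \<epsilon>" using c[OF y'] y commute[of y "c y"] by linarith
    then show "x \<in> (\<Union>x\<in>c ` N'. mball x \<epsilon>)" using y' c[OF y'] x S by auto
  qed
  ultimately show "\<exists>K. finite K \<and> K \<subseteq> S \<and> S \<subseteq> (\<Union>x\<in>K. mball x \<epsilon>)" by blast
qed

text \<open>
  A finite matrix maps the unit ball to vectors supported on \<open>F\<close> with entries of modulus at most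
  \<open>M\<close>, the norm of the matrix. A finite net of the disc of radius \<open>M\<close> therefore gives a finite net
  of the image, and uniform approximation transfers total boundedness to \<open>T\<close>.
\<close>

lemma limit_of_matrices_is_compact:
  assumes T: "T \<in> bounded_operators J"
    and approx: "\<And>\<epsilon>. \<epsilon> > 0 \<Longrightarrow> \<exists>F c. finite F \<and> F \<subseteq> J \<and>
      op_norm J (T \<ominus>\<^bsub>bounded_operator_algebra J\<^esub> mat_op J F c) \<le> \<epsilon>"
  shows "T \<in> carrier (compact_operator_algebra J)"
proof -
  interpret Metric_space "ell2 J" ell2_dist by (rule Metric_space_ell2)
  have "mtotally_bounded (T ` ell2_ball J)"
  proof (rule mtotally_boundedI)
    show "T ` ell2_ball J \<subseteq> ell2 J" using bounded_operatorsD(1)[OF T] by auto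
    fix \<epsilon> :: real assume \<epsilon>: "\<epsilon> > 0"
    then obtain F c where F: "finite F" "F \<subseteq> J"
      and close: "op_norm J (T \<ominus>\<^bsub>bounded_operator_algebra J\<^esub> mat_op J F c) \<le> \<epsilon> / 4"
      using approx[of "\<epsilon> / 4"] by auto
    let ?S = "mat_op J F c"
    note S = mat_op_bounded[OF F, of c]
    define M where "M = op_norm J ?S"
    define \<delta> where "\<delta> = \<epsilon> / (2 * (card F + 1))"
    have \<delta>: "\<delta> > 0" using \<epsilon> by (simp add: \<delta>_def)
    obtain D where D: "finite D" "cball (0::complex) M \<subseteq> (\<Union>x\<in>D. ball x \<delta>)"
      using seq_compact_imp_totally_bounded[of "cball (0::complex) M"] \<delta> compact_cball compact_imp_seq_compact
      by meson
    define ext where "ext = (\<lambda>h x. if x \<in> F then h x else (0 :: complex))"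
    let ?N = "ext ` (F \<rightarrow>\<^sub>E D)"
    have ext_in: "ext h \<in> ell2 J" for h unfolding ext_def by (rule ell2_finite_support[OF F])
    have "\<exists>g\<in>?N. ell2_dist g (T f) < \<epsilon>" if f: "f \<in> ell2_ball J" for f
    proof -
      have f': "f \<in> ell2 J" "ell2_norm f \<le> 1" using f by auto
      note Sf = bounded_operatorsD(1)[OF S f'(1)] and Tf = bounded_operatorsD(1)[OF T f'(1)]
      have "ell2_norm (?S f) \<le> M * ell2_norm f" unfolding M_def by (rule ell2_norm_op_le[OF S f'(1)])
      also have "\<dots> \<le> M * 1" using f'(2) op_norm_ge0[OF S] by (intro mult_left_mono) (auto simp: M_def)
      finally have "cmod (?S f x) \<le> M" for x using cmod_le_ell2_norm[OF Sf, of x] by linarith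
      then have "\<forall>x. \<exists>d\<in>D. cmod (d - ?S f x) < \<delta>" using D(2) by (force simp: dist_norm)
      then obtain h where h: "\<And>x. h x \<in> D" "\<And>x. cmod (h x - ?S f x) < \<delta>" by metis
      let ?g = "ext (restrict h F)"
      have "?g \<in> ?N" using h by auto
      have "ell2_dist ?g (?S f) = ell2_norm (\<lambda>x. if x \<in> F then h x - ?S f x else 0)"
        using f' by (intro arg_cong[where f = ell2_norm]) (auto simp: ext_def mat_op_def)
      also have "\<dots> = L2_set (\<lambda>x. cmod (h x - ?S f x)) F" by (rule ell2_finite_support[OF F])
      also have "\<dots> \<le> (\<Sum>x\<in>F. cmod (h x - ?S f x))" by (rule L2_set_le_sum) auto
      also have "\<dots> \<le> card F * \<delta>" using h(2) by (intro sum_bounded_above) (auto simp: less_imp_le)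
      also have "\<dots> \<le> \<epsilon> / 2" using \<epsilon> by (simp add: \<delta>_def field_simps)
      finally have 1: "ell2_dist ?g (?S f) \<le> \<epsilon> / 2" .
      have "ell2_dist (T f) (?S f) \<le> \<epsilon> / 4 * 1"
        using ell2_dist_op_le[OF T S f'(1)] mult_mono[OF close f'(2)] \<epsilon> ell2_norm_ge0[of f] by simp
      then have "ell2_dist ?g (T f) < \<epsilon>"
        using ell2_dist_triangle[OF ext_in Sf Tf, of "restrict h F"] 1 \<epsilon> commute[of "T f" "?S f"] by simp
      then show ?thesis using \<open>?g \<in> ?N\<close> by blast
    qed
    moreover have "finite ?N" using F D by (intro finite_imageI finite_PiE) auto
    ultimately show "\<exists>N. finite N \<and> N \<subseteq> ell2 J \<and> (\<forall>x\<in>T ` ell2_ball J. \<exists>y\<in>N. ell2_dist y x < \<epsilon>)"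
      using ext_in by blast
  qed
  then show ?thesis using T by (simp add: compact_operators_iff_totally_bounded)
qed

lemma ell2_restrict:
  assumes "f \<in> ell2 J"
  shows "(\<lambda>x. if x \<in> G then f x else 0) \<in> ell2 J" "ell2_dist f (\<lambda>x. if x \<in> G then f x else 0) \<le> ell2_norm f"
proof -
  have *: "h \<in> ell2 J \<and> ell2_norm h \<le> ell2_norm f" if "\<And>x. cmod (h x) \<le> cmod (f x)" for h
  proof -
    have off: "h x = 0" if "x \<notin> J" for x using \<open>cmod (h x) \<le> cmod (f x)\<close> assms that by (simp add: ell2_off)
    have L2: "L2_set (\<lambda>x. cmod (h x)) H \<le> ell2_norm f" if "finite H" "H \<subseteq> J" for H
    proof -
      have "L2_set (\<lambda>x. cmod (h x)) H \<le> L2_set (\<lambda>x. cmod (f x)) H"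
        using \<open>\<And>x. cmod (h x) \<le> cmod (f x)\<close> by (intro L2_set_mono) auto
      then show ?thesis using L2_set_le_ell2_norm[OF assms that(1)] by linarith
    qed
    show ?thesis using ell2_leI[OF off L2] by blast
  qed
  show "(\<lambda>x. if x \<in> G then f x else 0) \<in> ell2 J" "ell2_dist f (\<lambda>x. if x \<in> G then f x else 0) \<le> ell2_norm f"
    using *[of "\<lambda>x. if x \<in> G then f x else 0"] *[of "\<lambda>x. f x - (if x \<in> G then f x else 0)"] by auto
qed

lemma ell2_approx_finite_set:
  assumes "finite K" "K \<subseteq> ell2 J" "\<epsilon> > 0"
  shows "\<exists>F. finite F \<and> F \<subseteq> J \<and>
    (\<forall>f\<in>K. \<forall>G. F \<subseteq> G \<longrightarrow> ell2_dist f (\<lambda>x. if x \<in> G then f x else 0) < \<epsilon>)"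
  using assms(1,2)
proof (induction K rule: finite_induct)
  case (insert f K)
  then obtain F where F: "finite F" "F \<subseteq> J"
    "\<forall>f\<in>K. \<forall>G. F \<subseteq> G \<longrightarrow> ell2_dist f (\<lambda>x. if x \<in> G then f x else 0) < \<epsilon>" by auto
  have f: "f \<in> ell2 J" using insert.prems by simp
  obtain F' where F': "finite F'" "F' \<subseteq> J"
    "\<And>G. F' \<subseteq> G \<Longrightarrow> ell2_dist f (\<lambda>x. if x \<in> G then f x else 0) < \<epsilon>"
    by (rule ell2_approx[OF f assms(3)]) (rule that)
  show ?case
    by (rule exI[of _ "F \<union> F'"]) (use F F' in \<open>simp add: Un_subset_iff\<close>)
qed auto

text \<open>
  The image of the unit ball has a finite net, and truncating the net to a finite set \<open>F1\<close> of rows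
  changes it little, so truncating the whole image to \<open>F1\<close> changes it little as well. Each of the
  finitely many remaining rows is a square-summable vector, the conjugate of \<open>T\<^sup>* e\<^sub>a\<close>, and can be
  truncated to finitely many columns.
\<close>

lemma compact_operator_approx:
  assumes T: "T \<in> carrier (compact_operator_algebra J)" and \<epsilon>: "\<epsilon> > 0"
  obtains F c where "finite F" "F \<subseteq> J"
    "op_norm J (T \<ominus>\<^bsub>bounded_operator_algebra J\<^esub> mat_op J F c) \<le> \<epsilon>"
proof -
  interpret Metric_space "ell2 J" ell2_dist by (rule Metric_space_ell2)
  have TB: "T \<in> bounded_operators J" and tb: "mtotally_bounded (T ` ell2_ball J)"
    using T by (auto simp: compact_operators_iff_totally_bounded)
  have e4: "\<epsilon> / 4 > 0" using \<epsilon> by simp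
  obtain K where K: "finite K" "K \<subseteq> T ` ell2_ball J" "T ` ell2_ball J \<subseteq> (\<Union>k\<in>K. mball k (\<epsilon> / 4))"
    using tb[unfolded mtotally_bounded_def, rule_format, OF e4] by auto
  have KM: "k \<in> ell2 J" if "k \<in> K" for k using K(2) that bounded_operatorsD(1)[OF TB] by auto
  have "K \<subseteq> ell2 J" using KM by blast
  from ell2_approx_finite_set[OF K(1) this e4] obtain F1 where F1: "finite F1" "F1 \<subseteq> J"
    and K_near: "\<forall>k\<in>K. \<forall>G. F1 \<subseteq> G \<longrightarrow> ell2_dist k (\<lambda>x. if x \<in> G then k x else 0) < \<epsilon> / 4"
    by (elim exE conjE)
  let ?P = "\<lambda>f x. if x \<in> F1 then f x else (0::complex)"
  have rows: "ell2_dist (T f) (?P (T f)) \<le> \<epsilon> / 2" if f: "f \<in> ell2_ball J" for f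
  proof -
    obtain k where k: "k \<in> K" "ell2_dist k (T f) < \<epsilon> / 4" using K(3) f by auto
    have mem: "T f \<in> ell2 J" "k \<in> ell2 J" using f bounded_operatorsD(1)[OF TB] KM[OF k(1)] by auto
    let ?h = "\<lambda>x. T f x - k x"
    note h = ell2_diff[OF mem]
    have "ell2_dist (T f) (?P (T f)) = ell2_norm (\<lambda>x. (?h x - ?P ?h x) + (k x - ?P k x))"
      by (rule arg_cong[where f = ell2_norm]) auto
    also have "\<dots> \<le> ell2_dist ?h (?P ?h) + ell2_dist k (?P k)"
      by (intro ell2_add(2)[of _ J] ell2_diff h mem ell2_restrict)
    also have "\<dots> \<le> ell2_norm ?h + \<epsilon> / 4"
      using ell2_restrict(2)[OF h, of F1] K_near[rule_format, OF k(1) order_refl] by simp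
    also have "\<dots> \<le> \<epsilon> / 2" using k(2) commute[of k "T f"] by simp
    finally show ?thesis .
  qed
  define \<delta> where "\<delta> = \<epsilon> / (2 * (card F1 + 1))"
  have \<delta>: "\<delta> > 0" using \<epsilon> by (simp add: \<delta>_def)
  define r where "r = (\<lambda>a. op_adj J T (basis_vec a))"
  have r: "r a \<in> ell2 J" if "a \<in> F1" for a
    unfolding r_def using that F1 by (intro bounded_operatorsD(1)[OF op_adj(1)[OF TB]] basis_vec_ell2) auto
  have T_row: "T f a = ell2_inner f (r a)" if "a \<in> F1" "f \<in> ell2 J" for a f
    using op_adj(2)[OF TB that(2) basis_vec_ell2[of a J]] that F1
    by (auto simp: r_def ell2_inner_basis_right)
  have rF1: "r ` F1 \<subseteq> ell2 J" using r by auto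
  from ell2_approx_finite_set[OF finite_imageI[OF F1(1)] rF1 \<delta>]
  obtain F2 where F2: "finite F2" "F2 \<subseteq> J"
    and r_near: "\<forall>f\<in>r ` F1. \<forall>G. F2 \<subseteq> G \<longrightarrow> ell2_dist f (\<lambda>x. if x \<in> G then f x else 0) < \<delta>"
    by (elim exE conjE)
  define F where "F = F1 \<union> F2"
  have F: "finite F" "F \<subseteq> J" using F1 F2 by (auto simp: F_def)
  define c where "c = (\<lambda>a b. if a \<in> F1 then cnj (r a b) else 0)"
  let ?S = "mat_op J F c"
  have close: "ell2_dist (T f) (?S f) \<le> \<epsilon>" if f: "f \<in> ell2_ball J" for f
  proof -
    have f': "f \<in> ell2 J" "ell2_norm f \<le> 1" using f by auto
    note mem = bounded_operatorsD(1)[OF TB f'(1)] bounded_operatorsD(1)[OF mat_op_bounded[OF F] f'(1), of c]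
    have entry: "cmod (T f a - ?S f a) \<le> \<delta>" if a: "a \<in> F1" for a
    proof -
      let ?rF = "\<lambda>x. if x \<in> F then r a x else 0"
      have "?S f a = (\<Sum>b\<in>F. cnj (r a b) * f b)" using a f' by (simp add: mat_op_def c_def F_def)
      also have "\<dots> = cnj (ell2_inner ?rF f)" by (simp add: ell2_inner_finite_left[OF F(1)])
      also have "\<dots> = ell2_inner f ?rF" by (rule ell2_inner_commute[symmetric])
      finally have "T f a - ?S f a = ell2_inner f (r a) + ell2_inner f (\<lambda>x. (-1) * ?rF x)"
        using T_row[OF a f'(1)] ell2_inner_smult_right[of f "-1" ?rF] by simp
      also have "\<dots> = ell2_inner f (\<lambda>x. r a x + (-1) * ?rF x)"
        by (rule ell2_inner_add_right[symmetric, OF f'(1) r[OF a] ell2_smult[OF ell2_restrict(1)[OF r[OF a]]]])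
      finally have "cmod (T f a - ?S f a) = cmod (ell2_inner f (\<lambda>x. r a x - ?rF x))" by simp
      also have "\<dots> \<le> ell2_norm f * ell2_dist (r a) ?rF"
        by (rule cmod_ell2_inner_le[OF f'(1) ell2_diff[OF r[OF a] ell2_restrict(1)[OF r[OF a]]]])
      also have "\<dots> \<le> 1 * \<delta>"
      proof (rule mult_mono[OF f'(2)])
        show "ell2_dist (r a) ?rF \<le> \<delta>" using r_near[rule_format, OF imageI[OF a], of F] by (simp add: F_def)
      qed (auto simp: ell2_norm_ge0)
      finally show ?thesis by simp
    qed
    have "ell2_dist (?P (T f)) (?S f) = ell2_norm (\<lambda>x. if x \<in> F1 then T f x - ?S f x else 0)"
      using f' by (intro arg_cong[where f = ell2_norm]) (auto simp: mat_op_def c_def)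
    also have "\<dots> = L2_set (\<lambda>x. cmod (T f x - ?S f x)) F1" by (rule ell2_finite_support[OF F1])
    also have "\<dots> \<le> (\<Sum>x\<in>F1. cmod (T f x - ?S f x))" by (rule L2_set_le_sum) auto
    also have "\<dots> \<le> card F1 * \<delta>" using entry by (intro sum_bounded_above) auto
    also have "\<dots> \<le> \<epsilon> / 2" using \<epsilon> by (simp add: \<delta>_def field_simps)
    finally show ?thesis
      using ell2_dist_triangle[OF mem(1) ell2_restrict(1)[OF mem(1)] mem(2), of F1] rows[OF f] by linarith
  qed
  have "op_norm J (T \<ominus>\<^bsub>bounded_operator_algebra J\<^esub> ?S) \<le> \<epsilon>"
    unfolding op_norm_eq_SUP
  proof (rule cSUP_least)
    have "(\<lambda>x. 0) \<in> ell2_ball J" by (simp add: ell2_zero)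
    then show "ell2_ball J \<noteq> {}" by blast
  qed (use close in \<open>simp add: bounded_operators_minus_apply TB mat_op_bounded F\<close>)
  with F show thesis using that by blast
qed

section \<open>Subspaces and norms in C*-algebras\<close>

context cstar_algebra
begin

lemma scalar_laws:
  "x \<in> carrier C \<Longrightarrow> 1 \<odot> x = x"
  "x \<in> carrier C \<Longrightarrow> a \<odot> (b \<odot> x) = (a * b) \<odot> x"
  "x \<in> carrier C \<Longrightarrow> (a + b) \<odot> x = a \<odot> x \<oplus> b \<odot> x"
  "x \<in> carrier C \<Longrightarrow> y \<in> carrier C \<Longrightarrow> a \<odot> (x \<oplus> y) = a \<odot> x \<oplus> a \<odot> y"
  using smult_one[of x] smult_assoc1[of a b x] smult_l_distr[of a b x] smult_r_distr[of a x y]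
  by (simp_all add: ring_of_type_algebra_def)

lemma zero_scalar:
  assumes "x \<in> carrier C"
  shows "0 \<odot> x = \<zero>"
proof -
  have "0 \<odot> x \<oplus> 0 \<odot> x = 0 \<odot> x" using scalar_laws(3)[OF assms, of 0 0] by simp
  then show ?thesis using assms by (metis M.add.l_cancel_one' smult_in)
qed

lemma scalar_zero: "c \<odot> \<zero> = \<zero>"
  using zero_scalar[of \<zero>] scalar_laws(2)[of \<zero> c 0] by simp

lemma mult_zero:
  assumes "x \<in> carrier C"
  shows "\<zero> \<otimes> x = \<zero>" "x \<otimes> \<zero> = \<zero>"
  using mult_smult_left[of \<zero> x 0] mult_smult_right[of x \<zero> 0] assms
  by (simp_all add: zero_scalar mult_closed)

lemma adj_zero: "adj C \<zero> = \<zero>"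
  using adj_smult[of \<zero> 0] by (simp add: zero_scalar adj_closed)

lemma minus_mult:
  assumes "x \<in> carrier C" "y \<in> carrier C" "z \<in> carrier C"
  shows "(x \<ominus> y) \<otimes> z = x \<otimes> z \<ominus> y \<otimes> z" "z \<otimes> (x \<ominus> y) = z \<otimes> x \<ominus> z \<otimes> y"
  using assms by (simp_all add: minus_eq_smult mult_add_left mult_add_right mult_smult_left mult_smult_right mult_closed)

lemma adj_minus:
  assumes "x \<in> carrier C" "y \<in> carrier C"
  shows "adj C (x \<ominus> y) = adj C x \<ominus> adj C y"
  using assms by (simp add: minus_eq_smult adj_add adj_smult adj_closed)

lemma cnorm_zero: "cnorm C \<zero> = 0"
  by (simp add: cnorm_eq_0_iff)

lemma cnorm_nonneg:
  assumes "x \<in> carrier C"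
  shows "0 \<le> cnorm C x"
proof -
  have "cnorm C (x \<oplus> (-1) \<odot> x) \<le> cnorm C x + cnorm C ((-1) \<odot> x)"
    using assms by (intro cnorm_triangle) auto
  moreover have "x \<oplus> (-1) \<odot> x = \<zero>" using assms by (simp add: smult_minus_one M.r_neg)
  ultimately show ?thesis using cnorm_smult[OF assms, of "-1"] by (simp add: cnorm_zero)
qed

lemma cnorm_minus_commute:
  assumes "x \<in> carrier C" "y \<in> carrier C"
  shows "cnorm C (x \<ominus> y) = cnorm C (y \<ominus> x)"
proof -
  interpret Metric_space "carrier C" "cdist C" by (rule Metric_space_cdist)
  show ?thesis using commute[of x y] assms by (simp add: cdist_def)
qed

lemma cnorm_minus_triangle:
  assumes "x \<in> carrier C" "y \<in> carrier C" "z \<in> carrier C"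
  shows "cnorm C (x \<ominus> z) \<le> cnorm C (x \<ominus> y) + cnorm C (y \<ominus> z)"
proof -
  interpret Metric_space "carrier C" "cdist C" by (rule Metric_space_cdist)
  show ?thesis using triangle[of x y z] assms by (simp add: cdist_def)
qed

lemma cnorm_diff_le:
  assumes xy: "x \<in> carrier C" "y \<in> carrier C"
  shows "\<bar>cnorm C x - cnorm C y\<bar> \<le> cnorm C (x \<ominus> y)"
proof -
  have "x \<ominus> \<zero> = x" "y \<ominus> \<zero> = y" using xy by (simp_all add: minus_eq_smult scalar_zero)
  then show ?thesis
    using cnorm_minus_triangle[OF xy M.zero_closed] cnorm_minus_triangle[OF xy(2,1) M.zero_closed]
      cnorm_minus_commute[OF xy] by simp
qed

lemma cnorm_minus_eq_0_iff:
  assumes "x \<in> carrier C" "y \<in> carrier C"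
  shows "cnorm C (x \<ominus> y) = 0 \<longleftrightarrow> x = y"
proof -
  interpret Metric_space "carrier C" "cdist C" by (rule Metric_space_cdist)
  show ?thesis using zero[of x y] assms by (simp add: cdist_def)
qed

lemma cnorm_adj:
  assumes "x \<in> carrier C"
  shows "cnorm C (adj C x) = cnorm C x"
proof -
  have le: "cnorm C x \<le> cnorm C (adj C x)" if x: "x \<in> carrier C" for x
  proof (cases "cnorm C x = 0")
    case True
    then show ?thesis using cnorm_nonneg[OF adj_closed[OF x]] by simp
  next
    case False
    have "cnorm C x * cnorm C x \<le> cnorm C (adj C x) * cnorm C x"
      using cstar_identity[OF x] cnorm_mult[OF adj_closed[OF x] x] by (simp add: power2_eq_square)
    then show ?thesis using False cnorm_nonneg[OF x] by (simp add: less_le)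
  qed
  show ?thesis using le[OF assms] le[OF adj_closed[OF assms]] by (simp add: adj_adj assms)
qed

lemma cnorm_finsum_le:
  assumes "finite I" "f \<in> I \<rightarrow> carrier C"
  shows "cnorm C (finsum C f I) \<le> (\<Sum>i\<in>I. cnorm C (f i))"
  using assms
proof (induction I rule: finite_induct)
  case (insert i I)
  then show ?case using cnorm_triangle[of "f i" "finsum C f I"] by (auto simp: Pi_iff)
qed (simp add: cnorm_zero)

lemma subspace_finsum:
  assumes "is_subspace C V" "finite I" "f \<in> I \<rightarrow> V"
  shows "finsum C f I \<in> V"
  using assms(2,3)
proof (induction I rule: finite_induct)
  case (insert i I)
  then have "f \<in> I \<rightarrow> carrier C" "f i \<in> carrier C" using assms(1) by (auto simp: is_subspace_def)
  then show ?case using insert assms(1) by (auto simp: is_subspace_def)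
qed (use assms(1) in \<open>simp add: is_subspace_def\<close>)

lemma subspace_minus:
  assumes "is_subspace C V" "x \<in> V" "y \<in> V"
  shows "x \<ominus> y \<in> V"
  using assms by (auto simp: is_subspace_def subset_iff minus_eq_smult)

lemma cspan_subset:
  assumes "is_subspace C V" "S \<subseteq> V"
  shows "cspan C S \<subseteq> V"
proof
  fix x assume "x \<in> cspan C S"
  then obtain c F where x: "x = finsum C (\<lambda>x. c x \<odot> x) F" "finite F" "F \<subseteq> S"
    by (auto simp: cspan_def)
  show "x \<in> V"
    unfolding x(1) using x assms by (intro subspace_finsum) (auto simp: is_subspace_def)
qed

lemma cspan_mono: "S \<subseteq> T \<Longrightarrow> cspan C S \<subseteq> cspan C T"
  by (auto simp: cspan_def)

lemma cspan_base:
  assumes "S \<subseteq> carrier C"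
  shows "S \<subseteq> cspan C S"
proof
  fix x assume x: "x \<in> S"
  then have "x = finsum C (\<lambda>x. 1 \<odot> x) {x}" using assms by (auto simp: scalar_laws(1) subset_iff)
  then show "x \<in> cspan C S" using x unfolding cspan_def by (intro CollectI exI[of _ "\<lambda>_. 1"] exI[of _ "{x}"]) auto
qed

lemma cspan_subspace:
  assumes S: "S \<subseteq> carrier C"
  shows "is_subspace C (cspan C S)"
  unfolding is_subspace_def
proof (intro conjI ballI allI)
  show "cspan C S \<subseteq> carrier C"
    using S by (intro cspan_subset) (auto simp: is_subspace_def)
  show "\<zero> \<in> cspan C S"
    unfolding cspan_def by (intro CollectI exI[of _ "\<lambda>_. 0"] exI[of _ "{}"]) auto
next
  fix x y assume "x \<in> cspan C S" "y \<in> cspan C S"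
  then obtain c F d G where x: "x = finsum C (\<lambda>x. c x \<odot> x) F" "finite F" "F \<subseteq> S"
    and y: "y = finsum C (\<lambda>x. d x \<odot> x) G" "finite G" "G \<subseteq> S"
    by (auto simp: cspan_def)
  have extend: "finsum C (\<lambda>x. c x \<odot> x) F = finsum C (\<lambda>x. (if x \<in> F then c x else 0) \<odot> x) (F \<union> H)"
    if F: "finite F" "F \<subseteq> S" and H: "finite H" "H \<subseteq> S" for c F H
    using that S by (intro M.add.finprod_mono_neutral_cong_left) (auto simp: zero_scalar subset_iff)
  have "x \<oplus> y = finsum C (\<lambda>x. (if x \<in> F then c x else 0) \<odot> x \<oplus> (if x \<in> G then d x else 0) \<odot> x) (F \<union> G)"
    unfolding x(1) y(1) extend[OF x(2,3) y(2,3)] extend[OF y(2,3) x(2,3)] Un_commute[of G F]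
    using x y S by (intro M.finsum_addf[symmetric]) auto
  also have "\<dots> = finsum C (\<lambda>x. ((if x \<in> F then c x else 0) + (if x \<in> G then d x else 0)) \<odot> x) (F \<union> G)"
    using x y S by (intro M.finsum_cong') (auto simp: scalar_laws zero_scalar subset_iff)
  finally show "x \<oplus> y \<in> cspan C S"
    using x y unfolding cspan_def
    by (intro CollectI exI[of _ "\<lambda>x. (if x \<in> F then c x else 0) + (if x \<in> G then d x else 0)"]
        exI[of _ "F \<union> G"]) auto
next
  fix a x assume "x \<in> cspan C S"
  then obtain c F where x: "x = finsum C (\<lambda>x. c x \<odot> x) F" "finite F" "F \<subseteq> S"
    by (auto simp: cspan_def)
  have "a \<odot> x = finsum C (\<lambda>x. (a * c x) \<odot> x) F"
    unfolding x(1) using x(2,3) S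
  proof (induction F rule: finite_induct)
    case (insert y F)
    then show ?case
      by (subst (1 2) M.finsum_insert) (auto simp: scalar_laws subset_iff intro!: M.finsum_closed)
  qed (simp add: scalar_zero)
  then show "a \<odot> x \<in> cspan C S"
    using x unfolding cspan_def by (intro CollectI exI[of _ "\<lambda>x. a * c x"] exI[of _ F]) auto
qed

lemma in_closed_cspan_iff:
  assumes "S \<subseteq> carrier C"
  shows "x \<in> closed_cspan C S \<longleftrightarrow> x \<in> carrier C \<and> (\<forall>\<epsilon>>0. \<exists>y\<in>cspan C S. cnorm C (x \<ominus> y) < \<epsilon>)"
proof -
  interpret Metric_space "carrier C" "cdist C" by (rule Metric_space_cdist)
  have sub: "cspan C S \<subseteq> carrier C" using cspan_subspace[OF assms] by (simp add: is_subspace_def)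
  have "(\<exists>y\<in>cspan C S. y \<in> mball x \<epsilon>) \<longleftrightarrow> (\<exists>y\<in>cspan C S. cnorm C (x \<ominus> y) < \<epsilon>)"
    if "x \<in> carrier C" for \<epsilon>
    using sub that by (auto simp: cdist_def subset_iff)
  then show ?thesis unfolding closed_cspan_def metric_closure_of by auto
qed

lemma cspan_subset_closed_cspan:
  assumes "S \<subseteq> carrier C"
  shows "cspan C S \<subseteq> closed_cspan C S"
proof
  fix x assume x: "x \<in> cspan C S"
  then have "x \<in> carrier C" using cspan_subspace[OF assms] by (auto simp: is_subspace_def)
  then show "x \<in> closed_cspan C S"
    using x cnorm_minus_eq_0_iff[of x x] unfolding in_closed_cspan_iff[OF assms] by (metis)
qed

text \<open>
  A Lipschitz map carries approximations of \<open>x\<close> to approximations of \<open>L x\<close>. The bound is stated on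
  differences so that it covers the conjugate-linear adjoint as well as multiplications.
\<close>

lemma closed_cspan_image:
  assumes S: "S \<subseteq> carrier C" and x: "x \<in> closed_cspan C S"
    and L: "\<And>x. x \<in> carrier C \<Longrightarrow> L x \<in> carrier C"
      "\<And>x y. \<lbrakk>x \<in> carrier C; y \<in> carrier C\<rbrakk> \<Longrightarrow> cnorm C (L x \<ominus> L y) \<le> K * cnorm C (x \<ominus> y)"
      "\<And>x. x \<in> cspan C S \<Longrightarrow> L x \<in> closed_cspan C S"
  shows "L x \<in> closed_cspan C S"
  unfolding in_closed_cspan_iff[OF S]
proof (intro conjI allI impI)
  have xC: "x \<in> carrier C" using x in_closed_cspan_iff[OF S] by simp
  then show "L x \<in> carrier C" by (rule L(1))
  fix \<epsilon> :: real assume \<epsilon>: "\<epsilon> > 0"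
  \<comment> \<open>Adding 1 keeps the denominator positive when \<open>K = 0\<close>.\<close>
  define \<delta> where "\<delta> = \<epsilon> / (2 * (\<bar>K\<bar> + 1))"
  have \<delta>: "\<delta> > 0" "\<bar>K\<bar> * \<delta> \<le> \<epsilon> / 2" using \<epsilon> by (auto simp: \<delta>_def field_simps)
  obtain y where y: "y \<in> cspan C S" "cnorm C (x \<ominus> y) < \<delta>" using x \<delta> in_closed_cspan_iff[OF S] by blast
  have yC: "y \<in> carrier C" using y cspan_subspace[OF S] by (auto simp: is_subspace_def)
  obtain z where z: "z \<in> cspan C S" "cnorm C (L y \<ominus> z) < \<epsilon> / 2"
    using L(3)[OF y(1)] \<epsilon> in_closed_cspan_iff[OF S, of "L y"] by (meson half_gt_zero)
  have zC: "z \<in> carrier C" using z cspan_subspace[OF S] by (auto simp: is_subspace_def)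
  have "cnorm C (L x \<ominus> L y) \<le> \<bar>K\<bar> * cnorm C (x \<ominus> y)"
    using L(2)[OF xC yC] mult_right_mono[OF abs_ge_self[of K], of "cnorm C (x \<ominus> y)"] cnorm_nonneg xC yC
    by simp
  also have "\<dots> \<le> \<bar>K\<bar> * \<delta>" using y(2) by (intro mult_left_mono) auto
  finally have "cnorm C (L x \<ominus> z) < \<epsilon>"
    using cnorm_minus_triangle[OF L(1)[OF xC] L(1)[OF yC] zC] z(2) \<delta>(2) by linarith
  then show "\<exists>y\<in>cspan C S. cnorm C (L x \<ominus> y) < \<epsilon>" using z(1) by blast
qed

lemma closed_cspan_subspace:
  assumes S: "S \<subseteq> carrier C"
  shows "is_subspace C (closed_cspan C S)"
  unfolding is_subspace_def
proof (intro conjI ballI allI)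
  have V: "is_subspace C (cspan C S)" by (rule cspan_subspace[OF S])
  then have VC: "y \<in> carrier C" if "y \<in> cspan C S" for y using that by (auto simp: is_subspace_def)
  show "closed_cspan C S \<subseteq> carrier C" using in_closed_cspan_iff[OF S] by blast
  show "\<zero> \<in> closed_cspan C S" using V cspan_subset_closed_cspan[OF S] by (auto simp: is_subspace_def)
  show "c \<odot> x \<in> closed_cspan C S" if x: "x \<in> closed_cspan C S" for c x
  proof (rule closed_cspan_image[OF S x, where L = "\<lambda>x. c \<odot> x"])
    fix x y assume xy: "x \<in> carrier C" "y \<in> carrier C"
    have "c \<odot> x \<ominus> c \<odot> y = c \<odot> (x \<ominus> y)"
      using xy by (simp add: minus_eq_smult scalar_laws mult.commute)
    then show "cnorm C (c \<odot> x \<ominus> c \<odot> y) \<le> cmod c * cnorm C (x \<ominus> y)" using xy by (simp add: cnorm_smult)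
  qed (use V cspan_subset_closed_cspan[OF S] in \<open>auto simp: is_subspace_def\<close>)
  show "x \<oplus> y \<in> closed_cspan C S" if xy: "x \<in> closed_cspan C S" "y \<in> closed_cspan C S" for x y
    unfolding in_closed_cspan_iff[OF S]
  proof (intro conjI allI impI)
    have xyC: "x \<in> carrier C" "y \<in> carrier C" using xy in_closed_cspan_iff[OF S] by auto
    then show "x \<oplus> y \<in> carrier C" by simp
    fix \<epsilon> :: real assume "\<epsilon> > 0"
    then have \<epsilon>: "\<epsilon> / 2 > 0" by simp
    obtain u where u: "u \<in> cspan C S" "cnorm C (x \<ominus> u) < \<epsilon> / 2" using xy(1) \<epsilon> in_closed_cspan_iff[OF S] by blast
    obtain v where v: "v \<in> cspan C S" "cnorm C (y \<ominus> v) < \<epsilon> / 2" using xy(2) \<epsilon> in_closed_cspan_iff[OF S] by blast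
    note uvC = VC[OF u(1)] VC[OF v(1)]
    have "x \<oplus> y \<ominus> (u \<oplus> v) = (x \<ominus> u) \<oplus> (y \<ominus> v)"
      using xyC uvC by (simp add: minus_eq_smult scalar_laws M.a_ac)
    then have "cnorm C (x \<oplus> y \<ominus> (u \<oplus> v)) < \<epsilon>"
      using cnorm_triangle[of "x \<ominus> u" "y \<ominus> v"] xyC uvC u(2) v(2) by simp
    moreover have "u \<oplus> v \<in> cspan C S" using u v V by (simp add: is_subspace_def)
    ultimately show "\<exists>z\<in>cspan C S. cnorm C (x \<oplus> y \<ominus> z) < \<epsilon>" by blast
  qed
qed

text \<open>
  These are the powers of \<open>x\<^sup>* x\<close> with exponent \<open>2\<^sup>k\<close>. Each of them is self-adjoint, so the
  C*-identity gives their norms exactly.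
\<close>

primrec adj_square_iter :: "'c \<Rightarrow> nat \<Rightarrow> 'c" where
  "adj_square_iter x 0 = adj C x \<otimes> x"
| "adj_square_iter x (Suc k) = adj_square_iter x k \<otimes> adj_square_iter x k"

lemma adj_square_iter:
  assumes x: "x \<in> carrier C"
  shows "adj_square_iter x k \<in> carrier C \<and> adj C (adj_square_iter x k) = adj_square_iter x k \<and>
    cnorm C (adj_square_iter x k) = cnorm C x ^ (2 ^ Suc k)"
proof (induction k)
  case 0
  then show ?case using x by (simp add: mult_closed adj_closed adj_mult adj_adj cstar_identity)
next
  case (Suc k)
  let ?y = "adj_square_iter x k"
  have "cnorm C (?y \<otimes> ?y) = (cnorm C ?y)\<^sup>2" using Suc cstar_identity[of ?y] by simp
  then show ?case using Suc by (simp add: mult_closed adj_mult power_mult[symmetric] mult.commute)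
qed

end

text \<open>
  If \<open>b < a\<close>, the powers of \<open>a / b\<close> would be unbounded.
\<close>

lemma le_of_power_bounds:
  fixes a b N :: real
  assumes a: "0 \<le> a" and b: "0 \<le> b" and bound: "\<And>k::nat. a ^ (2 ^ Suc k) \<le> N * b ^ (2 ^ Suc k)"
  shows "a \<le> b"
proof (rule ccontr)
  assume "\<not> a \<le> b"
  then have ab: "b < a" by simp
  show False
  proof (cases "b = 0")
    case True
    then show False using bound[of 0] ab by simp
  next
    case False
    then have b0: "b > 0" using b by simp
    define q where "q = a / b"
    have q: "q > 1" using ab b0 by (simp add: q_def)
    obtain n where n: "N < q ^ n" using real_arch_pow[OF q] by blast
    \<comment> \<open>The exponents at hand are powers of two, and \<open>2 ^ Suc n\<close> dominates \<open>n\<close>.\<close>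
    have "n \<le> 2 ^ Suc n" by (meson less_exp le_SucI less_imp_le order_trans power_increasing one_le_numeral lessI)
    then have "q ^ n \<le> q ^ (2 ^ Suc n)" using q by (intro power_increasing) auto
    moreover have "q ^ (2 ^ Suc n) \<le> N" using bound[of n] b0 by (simp add: q_def power_divide field_simps)
    ultimately show False using n by simp
  qed
qed

lemma star_homD:
  assumes "\<phi> \<in> star_hom C D" "x \<in> carrier C"
  shows "\<phi> x \<in> carrier D" "\<phi> (adj C x) = adj D (\<phi> x)" "\<phi> (c \<odot>\<^bsub>C\<^esub> x) = c \<odot>\<^bsub>D\<^esub> \<phi> x"
    and "y \<in> carrier C \<Longrightarrow> \<phi> (x \<otimes>\<^bsub>C\<^esub> y) = \<phi> x \<otimes>\<^bsub>D\<^esub> \<phi> y"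
    and "y \<in> carrier C \<Longrightarrow> \<phi> (x \<oplus>\<^bsub>C\<^esub> y) = \<phi> x \<oplus>\<^bsub>D\<^esub> \<phi> y"
  using assms by (auto simp: star_hom_def)

lemma star_hom_adj_square_iter:
  assumes C: "cstar_algebra C" and D: "cstar_algebra D" and \<phi>: "\<phi> \<in> star_hom C D" and x: "x \<in> carrier C"
  shows "\<phi> (cstar_algebra.adj_square_iter C x k) = cstar_algebra.adj_square_iter D (\<phi> x) k"
proof -
  interpret C: cstar_algebra C by fact
  interpret D: cstar_algebra D by fact
  show ?thesis
    by (induction k) (auto simp: star_homD[OF \<phi>] C.adj_closed x C.adj_square_iter)
qed

text \<open>
  Equivalent norms on a *-subalgebra are equal. The estimates for \<open>adj_square_iter x k\<close> compare
  powers of the two norms of \<open>x\<close> up to the factor \<open>N\<close>, whose influence vanishes as \<open>k\<close> grows.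
\<close>

lemma star_hom_isometric_on:
  assumes C: "cstar_algebra C" and D: "cstar_algebra D" and \<phi>: "\<phi> \<in> star_hom C D"
    and V: "V \<subseteq> carrier C" "\<And>x y. x \<in> V \<Longrightarrow> y \<in> V \<Longrightarrow> x \<otimes>\<^bsub>C\<^esub> y \<in> V" "\<And>x. x \<in> V \<Longrightarrow> adj C x \<in> V"
    and upper: "\<And>y. y \<in> V \<Longrightarrow> cnorm D (\<phi> y) \<le> N * cnorm C y"
    and lower: "\<And>y. y \<in> V \<Longrightarrow> cnorm C y \<le> N * cnorm D (\<phi> y)"
    and x: "x \<in> V"
  shows "cnorm D (\<phi> x) = cnorm C x"
proof -
  interpret C: cstar_algebra C by fact
  interpret D: cstar_algebra D by fact
  have xC: "x \<in> carrier C" using V x by auto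
  note \<phi>x = star_homD(1)[OF \<phi> xC]
  have y: "C.adj_square_iter x k \<in> V" for k by (induction k) (auto intro: V x)
  have "cnorm D (\<phi> x) ^ (2 ^ Suc k) \<le> N * cnorm C x ^ (2 ^ Suc k)"
    "cnorm C x ^ (2 ^ Suc k) \<le> N * cnorm D (\<phi> x) ^ (2 ^ Suc k)" for k
    using upper[OF y[of k]] lower[OF y[of k]]
    by (simp_all add: star_hom_adj_square_iter[OF C D \<phi> xC] C.adj_square_iter[OF xC] D.adj_square_iter[OF \<phi>x]
        del: power_Suc)
  then show ?thesis
    using le_of_power_bounds[OF D.cnorm_nonneg[OF \<phi>x] C.cnorm_nonneg[OF xC]]
      le_of_power_bounds[OF C.cnorm_nonneg[OF xC] D.cnorm_nonneg[OF \<phi>x]]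
    by (metis antisym)
qed

section \<open>Matrix units\<close>

definition matrix_units :: "'c cstar \<Rightarrow> 'x set \<Rightarrow> ('x \<Rightarrow> 'x \<Rightarrow> 'c) \<Rightarrow> bool" where
  "matrix_units C J e \<longleftrightarrow> (\<forall>x\<in>J. \<forall>y\<in>J. e x y \<in> carrier C \<and> e x y \<noteq> \<zero>\<^bsub>C\<^esub> \<and> adj C (e x y) = e y x \<and>
     (\<forall>z\<in>J. \<forall>w\<in>J. e x y \<otimes>\<^bsub>C\<^esub> e z w = (if y = z then e x w else \<zero>\<^bsub>C\<^esub>)))"

definition unit_set :: "('x \<Rightarrow> 'x \<Rightarrow> 'c) \<Rightarrow> 'x set \<Rightarrow> 'c set" where
  "unit_set e F = {e x y | x y. x \<in> F \<and> y \<in> F}"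

lemma matrix_unitsD:
  assumes "matrix_units C J e" "x \<in> J" "y \<in> J"
  shows "e x y \<in> carrier C" "e x y \<noteq> \<zero>\<^bsub>C\<^esub>" "adj C (e x y) = e y x"
    and "\<lbrakk>z \<in> J; w \<in> J\<rbrakk> \<Longrightarrow> e x y \<otimes>\<^bsub>C\<^esub> e z w = (if y = z then e x w else \<zero>\<^bsub>C\<^esub>)"
  using assms by (simp_all add: matrix_units_def)

lemma matrix_units_bounded_operators: "matrix_units (bounded_operator_algebra J) J (matrix_unit J)"
  unfolding matrix_units_def bounded_operator_algebra_simps(1)
  by (intro ballI conjI matrix_unit_bounded matrix_unit_nonzero matrix_unit_adj matrix_unit_mult)

context cstar_algebra
begin

lemma unit_set_closed:
  assumes e: "matrix_units C J e" and F: "F \<subseteq> J"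
  shows "unit_set e F \<subseteq> carrier C"
proof
  fix u assume "u \<in> unit_set e F"
  then obtain x y where u: "u = e x y" "x \<in> F" "y \<in> F" by (auto simp: unit_set_def)
  show "u \<in> carrier C" unfolding u(1) using u F by (intro matrix_unitsD(1)[OF e]) auto
qed

lemma cnorm_matrix_unit:
  assumes e: "matrix_units C J e" and x: "x \<in> J" and y: "y \<in> J"
  shows "cnorm C (e x y) = 1"
proof -
  have diag: "cnorm C (e y y) = 1" if y: "y \<in> J" for y
  proof -
    have "(cnorm C (e y y))\<^sup>2 = cnorm C (e y y)"
      using cstar_identity[OF matrix_unitsD(1)[OF e y y]] y by (simp add: matrix_unitsD[OF e])
    moreover have "cnorm C (e y y) \<noteq> 0"
      using matrix_unitsD(1,2)[OF e y y] by (simp add: cnorm_eq_0_iff)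
    ultimately show ?thesis by (simp add: power2_eq_square)
  qed
  have "(cnorm C (e x y))\<^sup>2 = 1"
    using cstar_identity[OF matrix_unitsD(1)[OF e x y]] x y by (simp add: matrix_unitsD[OF e] diag)
  then show ?thesis using cnorm_nonneg[OF matrix_unitsD(1)[OF e x y]] by (simp add: power2_eq_1_iff)
qed

lemma cspan_unit_set_adj:
  assumes e: "matrix_units C J e" and F: "F \<subseteq> J" and x: "x \<in> cspan C (unit_set e F)"
  shows "adj C x \<in> cspan C (unit_set e F)"
proof -
  let ?V = "cspan C (unit_set e F)"
  note S = unit_set_closed[OF e F]
  have V: "is_subspace C ?V" by (rule cspan_subspace[OF S])
  let ?W = "{x \<in> carrier C. adj C x \<in> ?V}"
  have "is_subspace C ?W"
    using V by (auto simp: is_subspace_def adj_add adj_smult adj_zero)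
  moreover have "unit_set e F \<subseteq> ?W"
  proof
    fix u assume "u \<in> unit_set e F"
    then obtain a b where u: "u = e a b" "a \<in> F" "b \<in> F" by (auto simp: unit_set_def)
    then have "adj C u = e b a" using F by (auto simp: matrix_unitsD(3)[OF e] subset_iff)
    moreover have "e b a \<in> unit_set e F" using u by (auto simp: unit_set_def)
    ultimately show "u \<in> ?W" using S u cspan_base[OF S] \<open>u \<in> unit_set e F\<close> by auto
  qed
  ultimately show ?thesis using cspan_subset x by blast
qed

text \<open>
  The condition that a product lies in the span is linear in each factor, so that two passes of
  \<open>cspan_subset\<close>, one for each factor, reduce the claim to products of matrix units.
\<close>

lemma cspan_unit_set_mult:
  assumes e: "matrix_units C J e" and F: "F \<subseteq> J"
    and x: "x \<in> cspan C (unit_set e F)" and y: "y \<in> cspan C (unit_set e F)"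
  shows "x \<otimes> y \<in> cspan C (unit_set e F)"
proof -
  let ?S = "unit_set e F" and ?V = "cspan C (unit_set e F)"
  note S = unit_set_closed[OF e F]
  have V: "is_subspace C ?V" by (rule cspan_subspace[OF S])
  then have VC: "?V \<subseteq> carrier C" by (simp add: is_subspace_def)
  have S_mult: "u \<otimes> v \<in> ?V" if uv: "u \<in> ?S" "v \<in> ?S" for u v
  proof -
    obtain a b c d where u: "u = e a b" "v = e c d" "a \<in> F" "b \<in> F" "c \<in> F" "d \<in> F"
      using uv by (auto simp: unit_set_def)
    then have *: "u \<otimes> v = (if b = c then e a d else \<zero>)" using F by (auto simp: matrix_unitsD(4)[OF e] subset_iff)
    have "e a d \<in> ?S" using u by (auto simp: unit_set_def)
    then show ?thesis using * V cspan_base[OF S] by (auto simp: is_subspace_def)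
  qed
  have right: "u \<otimes> z \<in> ?V" if u: "u \<in> ?S" and z: "z \<in> ?V" for u z
  proof -
    let ?W = "{z \<in> carrier C. u \<otimes> z \<in> ?V}"
    have "is_subspace C ?W"
      using V u S by (auto simp: is_subspace_def mult_add_right mult_smult_right mult_zero subset_iff)
    moreover have "?S \<subseteq> ?W" using S_mult[OF u] S by auto
    ultimately show ?thesis using cspan_subset z by blast
  qed
  let ?W = "{x \<in> carrier C. x \<otimes> y \<in> ?V}"
  have "y \<in> carrier C" using y VC by auto
  then have "is_subspace C ?W"
    using V by (auto simp: is_subspace_def mult_add_left mult_smult_left mult_zero)
  moreover have "?S \<subseteq> ?W" using right[OF _ y] S by auto
  ultimately show ?thesis using cspan_subset x by blast
qed

text \<open>
  The two-sided compression \<open>e\<^sub>a\<^sub>a y e\<^sub>b\<^sub>b\<close> reads off the matrix entry of \<open>y\<close> at \<open>(a, b)\<close>.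
\<close>

lemma unit_corner:
  assumes e: "matrix_units C J e" and F: "F \<subseteq> J" and a: "a \<in> J" and b: "b \<in> J"
    and y: "y \<in> cspan C (unit_set e F)"
  shows "\<exists>c. e a a \<otimes> y \<otimes> e b b = c \<odot> e a b"
proof -
  let ?W = "{y \<in> carrier C. \<exists>c. e a a \<otimes> y \<otimes> e b b = c \<odot> e a b}"
  note E = matrix_unitsD[OF e a a] matrix_unitsD[OF e b b] matrix_unitsD[OF e a b]
  have "is_subspace C ?W"
    unfolding is_subspace_def
  proof (intro conjI ballI allI)
    show "\<zero> \<in> ?W" using E by (auto simp: mult_zero zero_scalar intro!: exI[of _ 0])
  next
    fix x y assume "x \<in> ?W" "y \<in> ?W"
    then obtain c d where "x \<in> carrier C" "e a a \<otimes> x \<otimes> e b b = c \<odot> e a b"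
      "y \<in> carrier C" "e a a \<otimes> y \<otimes> e b b = d \<odot> e a b" by auto
    then show "x \<oplus> y \<in> ?W"
      using E by (auto simp: mult_add_left mult_add_right mult_closed scalar_laws(3)[symmetric])
  next
    fix k x assume "x \<in> ?W"
    then obtain c where "x \<in> carrier C" "e a a \<otimes> x \<otimes> e b b = c \<odot> e a b" by auto
    then show "k \<odot> x \<in> ?W"
      using E by (auto simp: mult_smult_left mult_smult_right mult_closed scalar_laws(2))
  qed auto
  moreover have "unit_set e F \<subseteq> ?W"
  proof
    fix u assume "u \<in> unit_set e F"
    then obtain x y where u: "u = e x y" "x \<in> J" "y \<in> J" using F by (auto simp: unit_set_def)
    then have "e a a \<otimes> u \<otimes> e b b = (if a = x \<and> y = b then 1 else 0) \<odot> e a b"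
      using a b by (auto simp: matrix_unitsD[OF e] mult_zero zero_scalar scalar_laws(1))
    then show "u \<in> ?W" using u by (auto simp: matrix_unitsD[OF e])
  qed
  ultimately show ?thesis using cspan_subset y by blast
qed

lemma unit_corner_sum:
  assumes e: "matrix_units C J e" and F: "finite F" "F \<subseteq> J" and y: "y \<in> cspan C (unit_set e F)"
  shows "y = finsum C (\<lambda>(a, b). e a a \<otimes> y \<otimes> e b b) (F \<times> F)"
proof -
  let ?g = "\<lambda>y (a, b). e a a \<otimes> y \<otimes> e b b"
  let ?W = "{y \<in> carrier C. y = finsum C (?g y) (F \<times> F)}"
  have E: "e a b \<in> carrier C" if "a \<in> F" "b \<in> F" for a b
    using that F by (auto simp: matrix_unitsD[OF e] subset_iff)
  have g: "?g y \<in> F \<times> F \<rightarrow> carrier C" if "y \<in> carrier C" for y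
    using that E by (auto simp: mult_closed)
  have "is_subspace C ?W"
    unfolding is_subspace_def
  proof (intro conjI ballI allI)
    have "finsum C (?g \<zero>) (F \<times> F) = finsum C (\<lambda>_. \<zero>) (F \<times> F)"
      using E by (intro M.finsum_cong') (auto simp: mult_zero)
    then show "\<zero> \<in> ?W" by simp
  next
    fix x y assume "x \<in> ?W" "y \<in> ?W"
    then have xy: "x \<in> carrier C" "y \<in> carrier C" "finsum C (?g x) (F \<times> F) = x" "finsum C (?g y) (F \<times> F) = y" by auto
    have "finsum C (?g (x \<oplus> y)) (F \<times> F) = finsum C (\<lambda>i. ?g x i \<oplus> ?g y i) (F \<times> F)"
      using xy E by (intro M.finsum_cong') (auto simp: mult_add_left mult_add_right mult_closed)
    also have "\<dots> = x \<oplus> y" using M.finsum_addf[OF g[OF xy(1)] g[OF xy(2)]] xy by simp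
    finally show "x \<oplus> y \<in> ?W" using xy by simp
  next
    fix k x assume "x \<in> ?W"
    then have x: "x \<in> carrier C" "finsum C (?g x) (F \<times> F) = x" by auto
    have smult_finsum: "finsum C (\<lambda>i. k \<odot> f i) I = k \<odot> finsum C f I" if "finite I" "f \<in> I \<rightarrow> carrier C" for f I
      using that
      by (induction I rule: finite_induct) (auto simp: scalar_zero scalar_laws Pi_iff)
    have "finsum C (?g (k \<odot> x)) (F \<times> F) = finsum C (\<lambda>i. k \<odot> ?g x i) (F \<times> F)"
      using x E by (intro M.finsum_cong') (auto simp: mult_smult_left mult_smult_right mult_closed)
    also have "\<dots> = k \<odot> x" using smult_finsum[OF _ g[OF x(1)]] x F by simp
    finally show "k \<odot> x \<in> ?W" using x by simp
  qed auto
  moreover have "unit_set e F \<subseteq> ?W"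
  proof
    fix u assume "u \<in> unit_set e F"
    then obtain x y where u: "u = e x y" "x \<in> F" "y \<in> F" by (auto simp: unit_set_def)
    \<comment> \<open>Only the corner at \<open>(x, y)\<close> survives.\<close>
    have "finsum C (?g u) (F \<times> F) = finsum C (\<lambda>i. if (x, y) = i then u else \<zero>) (F \<times> F)"
      using u E F by (intro M.finsum_cong') (auto simp: matrix_unitsD[OF e] mult_zero subset_iff split: if_splits)
    also have "\<dots> = u" using M.finsum_singleton[of "(x, y)" "F \<times> F" "\<lambda>_. u"] u F E by simp
    finally show "u \<in> ?W" using u E by simp
  qed
  ultimately have "cspan C (unit_set e F) \<subseteq> ?W" by (rule cspan_subset)
  then show ?thesis using y by (auto simp: case_prod_beta)
qed

lemma cspan_unit_set_finite:
  assumes "x \<in> cspan C (unit_set e J)"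
  obtains F where "finite F" "F \<subseteq> J" "x \<in> cspan C (unit_set e F)"
proof -
  obtain c K where x: "x = finsum C (\<lambda>x. c x \<odot> x) K" "finite K" "K \<subseteq> unit_set e J"
    using assms by (auto simp: cspan_def)
  have "K \<subseteq> case_prod e ` (J \<times> J)"
  proof
    fix u assume "u \<in> K"
    then have "u \<in> unit_set e J" using x(3) by (rule rev_subsetD)
    then obtain a b where "u = e a b" "a \<in> J" "b \<in> J" unfolding unit_set_def by blast
    then show "u \<in> case_prod e ` (J \<times> J)" by (intro image_eqI[of _ _ "(a, b)"]) simp_all
  qed
  then obtain P where P: "P \<subseteq> J \<times> J" "finite P" "K = case_prod e ` P"
    using finite_subset_image[OF x(2)] by meson
  let ?F = "fst ` P \<union> snd ` P"
  have "K \<subseteq> unit_set e ?F"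
  proof
    fix u assume "u \<in> K"
    then obtain q where q: "q \<in> P" "u = case_prod e q" unfolding P(3) by (rule imageE)
    then show "u \<in> unit_set e ?F"
      unfolding unit_set_def by (intro CollectI exI[of _ "fst q"] exI[of _ "snd q"]) (simp add: case_prod_beta)
  qed
  then have "x \<in> cspan C (unit_set e ?F)" using x(1,2) unfolding cspan_def by blast
  moreover have "finite ?F" "?F \<subseteq> J" using P(1,2) by auto
  ultimately show thesis using that[of ?F] by simp
qed

end

text \<open>
  In both C*-algebras every matrix unit has norm 1. Compressing to a corner does not increase the
  norm, and a linear combination is the sum of its corners, of which there are \<open>N\<close>. Since \<open>\<phi>\<close>
  preserves the norms of the corners, the norms of \<open>y\<close> and \<open>\<phi> y\<close> are equivalent with constant \<open>N\<close>.
\<close>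

lemma star_hom_isometric_on_matrix_units:
  assumes C: "cstar_algebra C" and D: "cstar_algebra D" and \<phi>: "\<phi> \<in> star_hom C D"
    and e: "matrix_units C J e" and f: "matrix_units D J f"
    and \<phi>e: "\<And>x y. \<lbrakk>x \<in> J; y \<in> J\<rbrakk> \<Longrightarrow> \<phi> (e x y) = f x y"
    and x: "x \<in> cspan C (unit_set e J)"
  shows "cnorm D (\<phi> x) = cnorm C x"
proof -
  interpret C: cstar_algebra C by fact
  interpret D: cstar_algebra D by fact
  obtain F where F: "finite F" "F \<subseteq> J" and xF: "x \<in> cspan C (unit_set e F)"
    using C.cspan_unit_set_finite[OF x] by blast
  let ?V = "cspan C (unit_set e F)"
  have V: "is_subspace C ?V" by (rule C.cspan_subspace[OF C.unit_set_closed[OF e F(2)]])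
  have FJ: "a \<in> J" if "a \<in> F" for a using that F by auto
  define N where "N = real (card (F \<times> F))"
  note E = matrix_unitsD[OF e FJ FJ] and E' = matrix_unitsD[OF f FJ FJ]
  note nE = C.cnorm_matrix_unit[OF e FJ FJ] and nE' = D.cnorm_matrix_unit[OF f FJ FJ]
  have bounds: "cnorm D (\<phi> y) \<le> N * cnorm C y \<and> cnorm C y \<le> N * cnorm D (\<phi> y)" if y: "y \<in> ?V" for y
  proof -
    have yC: "y \<in> carrier C" using y V by (auto simp: is_subspace_def)
    note \<phi>y = star_homD(1)[OF \<phi> yC]
    define g where "g = (\<lambda>(a, b). e a a \<otimes>\<^bsub>C\<^esub> y \<otimes>\<^bsub>C\<^esub> e b b)"
    have g: "g \<in> F \<times> F \<rightarrow> carrier C" using E yC by (auto simp: g_def C.mult_closed)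
    have \<phi>g: "(\<lambda>i. \<phi> (g i)) \<in> F \<times> F \<rightarrow> carrier D" using g star_homD(1)[OF \<phi>] by auto
    have y_sum: "y = finsum C g (F \<times> F)" using C.unit_corner_sum[OF e F y] by (simp add: g_def)
    have corner: "cnorm C (g i) \<le> cnorm C y \<and> cnorm D (\<phi> (g i)) = cnorm C (g i) \<and> cnorm D (\<phi> (g i)) \<le> cnorm D (\<phi> y)"
      if i: "i \<in> F \<times> F" for i
    proof -
      obtain a b where ab: "i = (a, b)" "a \<in> F" "b \<in> F" using i by auto
      obtain c where c: "g i = c \<odot>\<^bsub>C\<^esub> e a b"
        using C.unit_corner[OF e F(2) FJ[OF ab(2)] FJ[OF ab(3)] y] ab by (auto simp: g_def)
      have "cnorm C (g i) \<le> cnorm C (e a a \<otimes>\<^bsub>C\<^esub> y) * cnorm C (e b b)"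
        unfolding ab g_def using ab E yC by (auto intro!: C.cnorm_mult C.mult_closed)
      also have "\<dots> \<le> (cnorm C (e a a) * cnorm C y) * cnorm C (e b b)"
        using ab E yC by (intro mult_right_mono C.cnorm_mult C.cnorm_nonneg) auto
      finally have 1: "cnorm C (g i) \<le> cnorm C y" using ab by (simp add: nE)
      have "\<phi> (g i) = f a a \<otimes>\<^bsub>D\<^esub> \<phi> y \<otimes>\<^bsub>D\<^esub> f b b"
        unfolding ab g_def using ab E yC by (simp add: star_homD[OF \<phi>] C.mult_closed \<phi>e FJ)
      then have "cnorm D (\<phi> (g i)) \<le> cnorm D (f a a \<otimes>\<^bsub>D\<^esub> \<phi> y) * cnorm D (f b b)"
        using ab E' \<phi>y by (auto intro!: D.cnorm_mult D.mult_closed)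
      also have "\<dots> \<le> (cnorm D (f a a) * cnorm D (\<phi> y)) * cnorm D (f b b)"
        using ab E' \<phi>y by (intro mult_right_mono D.cnorm_mult D.cnorm_nonneg) auto
      finally have 2: "cnorm D (\<phi> (g i)) \<le> cnorm D (\<phi> y)" using ab by (simp add: nE')
      have "cnorm D (\<phi> (g i)) = cnorm C (g i)"
        unfolding c using ab by (simp add: star_homD[OF \<phi>] E E' \<phi>e FJ C.cnorm_smult D.cnorm_smult nE nE')
      then show ?thesis using 1 2 by simp
    qed
    have "cnorm C y \<le> (\<Sum>i\<in>F \<times> F. cnorm C (g i))"
      using C.cnorm_finsum_le[OF _ g] F y_sum by simp
    also have "\<dots> \<le> N * cnorm D (\<phi> y)"
      unfolding N_def
    proof (rule sum_bounded_above)
      show "cnorm C (g i) \<le> cnorm D (\<phi> y)" if "i \<in> F \<times> F" for i using corner[OF that] by simp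
    qed
    finally have 1: "cnorm C y \<le> N * cnorm D (\<phi> y)" .
    have "\<phi> y = finsum D (\<lambda>i. \<phi> (g i)) (F \<times> F)"
      using star_hom_finsum[OF C D \<phi> _ g] F y_sum by simp
    then have "cnorm D (\<phi> y) \<le> (\<Sum>i\<in>F \<times> F. cnorm D (\<phi> (g i)))"
      using D.cnorm_finsum_le[OF _ \<phi>g] F by simp
    also have "\<dots> \<le> N * cnorm C y"
      unfolding N_def using corner by (intro sum_bounded_above) auto
    finally show ?thesis using 1 by simp
  qed
  show ?thesis
  proof (rule star_hom_isometric_on[OF C D \<phi> _ _ _ _ _ xF])
    show "?V \<subseteq> carrier C" using V by (simp add: is_subspace_def)
    show "u \<otimes>\<^bsub>C\<^esub> v \<in> ?V" if "u \<in> ?V" "v \<in> ?V" for u v by (rule C.cspan_unit_set_mult[OF e F(2) that])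
    show "adj C u \<in> ?V" if "u \<in> ?V" for u by (rule C.cspan_unit_set_adj[OF e F(2) that])
  qed (use bounds in auto)
qed

section \<open>The closed span of a system of matrix units\<close>

text \<open>
  The entries of an operator determine its adjoint on the basis vectors, and \<open>(T f)(a)\<close> is the
  inner product of \<open>f\<close> with \<open>T\<^sup>* e\<^sub>a\<close>.
\<close>

lemma bounded_operators_eqI_entries:
  assumes S: "S \<in> bounded_operators J" and T: "T \<in> bounded_operators J"
    and eq: "\<And>a b. \<lbrakk>a \<in> J; b \<in> J\<rbrakk> \<Longrightarrow> S (basis_vec b) a = T (basis_vec b) a"
  shows "S = T"
proof (rule bounded_operators_eqI[OF S T])
  fix f assume f: "f \<in> ell2 J"
  have adj_entry: "op_adj J R (basis_vec a) b = cnj (R (basis_vec b) a)"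
    if "R \<in> bounded_operators J" "a \<in> J" "b \<in> J" for R a b
  proof -
    have "R (basis_vec b) a = cnj (op_adj J R (basis_vec a) b)"
      using op_adj(2)[OF that(1) basis_vec_ell2[OF that(3)] basis_vec_ell2[OF that(2)]]
      unfolding ell2_inner_basis_left ell2_inner_basis_right .
    then show ?thesis by (metis complex_cnj_cnj)
  qed
  have adj_row: "op_adj J S (basis_vec a) = op_adj J T (basis_vec a)" if a: "a \<in> J" for a
  proof
    fix b
    show "op_adj J S (basis_vec a) b = op_adj J T (basis_vec a) b"
    proof (cases "b \<in> J")
      case True
      then show ?thesis using eq a by (simp add: adj_entry S T)
    next
      case False
      show ?thesis
        using ell2_off[OF bounded_operatorsD(1)[OF op_adj(1)[OF S] basis_vec_ell2[OF a]] False]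
          ell2_off[OF bounded_operatorsD(1)[OF op_adj(1)[OF T] basis_vec_ell2[OF a]] False] by simp
    qed
  qed
  show "S f = T f"
  proof
    fix a
    show "S f a = T f a"
    proof (cases "a \<in> J")
      case True
      then show ?thesis
        using op_adj(2)[OF S f basis_vec_ell2[OF True]] op_adj(2)[OF T f basis_vec_ell2[OF True]]
          adj_row[OF True] by (simp add: ell2_inner_basis_right)
    next
      case False
      show ?thesis
        using ell2_off[OF bounded_operatorsD(1)[OF S f] False] ell2_off[OF bounded_operatorsD(1)[OF T f] False]
        by simp
    qed
  qed
qed

lemma matrix_unit_corner:
  assumes T: "T \<in> bounded_operators J" and a: "a \<in> J" and b: "b \<in> J"
  shows "matrix_unit J a a \<otimes>\<^bsub>bounded_operator_algebra J\<^esub> T \<otimes>\<^bsub>bounded_operator_algebra J\<^esub> matrix_unit J b b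
    = T (basis_vec b) a \<odot>\<^bsub>bounded_operator_algebra J\<^esub> matrix_unit J a b" (is "?L = ?R")
proof (rule bounded_operators_eqI[where J = J])
  note U = matrix_unit_bounded
  show "?L \<in> bounded_operators J" by (intro bounded_operators_closed U T a b)
  show "?R \<in> bounded_operators J" by (intro bounded_operators_smult_closed U a b)
  fix f assume f: "f \<in> ell2 J"
  have fb: "matrix_unit J b b f = (\<lambda>x. f b * basis_vec b x)"
    using f by (auto simp: matrix_unit_apply basis_vec_def)
  have Tb: "T (matrix_unit J b b f) = (\<lambda>x. f b * T (basis_vec b) x)"
    unfolding fb by (rule bounded_operatorsD(3)[OF T basis_vec_ell2[OF b]])
  have mem: "matrix_unit J b b f \<in> ell2 J" "T (matrix_unit J b b f) \<in> ell2 J"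
    using bounded_operatorsD(1)[OF U[OF b b] f] bounded_operatorsD(1)[OF T] by auto
  show "?L f = ?R f"
    using f mem by (auto simp: bounded_operator_algebra_simps Tb matrix_unit_apply[OF mem(2)[unfolded Tb]]
        matrix_unit_apply[OF f, of a b])
qed

lemma entry_le_op_norm:
  assumes "T \<in> bounded_operators J" "a \<in> J" "b \<in> J"
  shows "cmod (T (basis_vec b) a) \<le> op_norm J T"
  using cmod_le_ell2_norm[OF bounded_operatorsD(1)[OF assms(1) basis_vec_ell2[OF assms(3)]], of a]
    ell2_norm_op_le[OF assms(1) basis_vec_ell2[OF assms(3)]] by (simp add: basis_vec_norm)

text \<open>
  In this setting \<open>\<phi>\<close> turns out to identify the closed span \<open>I\<close> of the matrix units with the
  compact operators. The span \<open>V\<close> without closure corresponds to the finite matrices.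
\<close>

locale matrix_unit_representation =
  fixes C :: "'c cstar" (structure) and J :: "'x set" and e :: "'x \<Rightarrow> 'x \<Rightarrow> 'c"
    and \<phi> :: "'c \<Rightarrow> (('x \<Rightarrow> complex) \<Rightarrow> ('x \<Rightarrow> complex))"
  assumes C: "cstar_algebra C"
    and e: "matrix_units C J e"
    and \<phi>: "\<phi> \<in> star_hom C (bounded_operator_algebra J)"
    and \<phi>_e: "\<And>x y. \<lbrakk>x \<in> J; y \<in> J\<rbrakk> \<Longrightarrow> \<phi> (e x y) = matrix_unit J x y"
begin

sublocale C: cstar_algebra C by (rule C)

abbreviation "B \<equiv> bounded_operator_algebra J"

lemma B: "cstar_algebra B" by (rule cstar_algebra_bounded_operators)

sublocale B: cstar_algebra B by (rule B)

abbreviation "V \<equiv> cspan C (unit_set e J)"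
abbreviation "I \<equiv> closed_cspan C (unit_set e J)"

lemma units_closed: "unit_set e J \<subseteq> carrier C"
  by (rule C.unit_set_closed[OF e order_refl])

lemma V_subspace: "is_subspace C V"
  by (rule C.cspan_subspace[OF units_closed])

lemma V_carrier: "x \<in> V \<Longrightarrow> x \<in> carrier C"
  using V_subspace by (auto simp: is_subspace_def)

lemma I_subspace: "is_subspace C I"
  by (rule C.closed_cspan_subspace[OF units_closed])

lemma I_carrier: "x \<in> I \<Longrightarrow> x \<in> carrier C"
  using I_subspace by (auto simp: is_subspace_def)

lemma \<phi>_bounded: "x \<in> carrier C \<Longrightarrow> \<phi> x \<in> bounded_operators J"
  using star_homD(1)[OF \<phi>] by (simp add: bounded_operator_algebra_simps)

lemma \<phi>_minus: "x \<in> carrier C \<Longrightarrow> y \<in> carrier C \<Longrightarrow> \<phi> (x \<ominus> y) = \<phi> x \<ominus>\<^bsub>B\<^esub> \<phi> y"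
  by (rule star_hom_minus[OF C B \<phi>])

lemma isometric_on_V: "x \<in> V \<Longrightarrow> op_norm J (\<phi> x) = cnorm C x"
  by (rule star_hom_isometric_on_matrix_units[OF C B \<phi> e matrix_units_bounded_operators \<phi>_e])

lemma corner_of_V:
  assumes y: "y \<in> V" and a: "a \<in> J" and b: "b \<in> J"
  shows "e a a \<otimes> y \<otimes> e b b = \<phi> y (basis_vec b) a \<odot> e a b"
proof -
  note E = matrix_unitsD[OF e a a] matrix_unitsD[OF e b b] matrix_unitsD[OF e a b]
  have yC: "y \<in> carrier C" by (rule V_carrier[OF y])
  obtain c where c: "e a a \<otimes> y \<otimes> e b b = c \<odot> e a b"
    using C.unit_corner[OF e order_refl a b y] by blast
  have "\<phi> (e a a \<otimes> y \<otimes> e b b) = \<phi> y (basis_vec b) a \<odot>\<^bsub>B\<^esub> matrix_unit J a b"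
    using E yC by (simp add: star_homD[OF \<phi>] C.mult_closed \<phi>_e a b matrix_unit_corner \<phi>_bounded)
  moreover have "\<phi> (c \<odot> e a b) = c \<odot>\<^bsub>B\<^esub> matrix_unit J a b"
    using E by (simp add: star_homD[OF \<phi>] \<phi>_e a b)
  ultimately have "(\<phi> y (basis_vec b) a \<odot>\<^bsub>B\<^esub> matrix_unit J a b) (basis_vec b) a
      = (c \<odot>\<^bsub>B\<^esub> matrix_unit J a b) (basis_vec b) a" by (simp add: c)
  then have "\<phi> y (basis_vec b) a = c"
    using basis_vec_ell2[OF b]
    by (simp add: bounded_operator_algebra_simps matrix_unit_apply, simp add: basis_vec_def)
  then show ?thesis using c by simp
qed

text \<open>
  The images of the sequence converge to some operator \<open>T\<close> because \<open>\<phi>\<close> is isometric on the span.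
  That \<open>T\<close> is \<open>\<phi> x\<close>, although \<open>\<phi>\<close> is not known to be continuous, is seen entry by entry. In the
  algebra, the corners of \<open>y n\<close> at \<open>(a, b)\<close> converge to the corner of \<open>x\<close>, while their
  coefficients converge to the entry of \<open>T\<close>. So the corner of \<open>x\<close> is that entry times \<open>e a b\<close>, and
  applying \<open>\<phi>\<close> to this equation gives the entry of \<open>\<phi> x\<close>.
\<close>

lemma \<phi>_limit:
  assumes x: "x \<in> carrier C" and y: "\<And>n. y n \<in> V"
    and lim: "(\<lambda>n. cnorm C (x \<ominus> y n)) \<longlonglongrightarrow> 0"
  shows "(\<lambda>n. op_norm J (\<phi> x \<ominus>\<^bsub>B\<^esub> \<phi> (y n))) \<longlonglongrightarrow> 0"
proof -
  interpret MB: Metric_space "carrier B" "cdist B" by (rule B.Metric_space_cdist)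
  have yC: "y n \<in> carrier C" for n by (rule V_carrier[OF y])
  have \<phi>y: "\<phi> (y n) \<in> bounded_operators J" for n by (rule \<phi>_bounded[OF yC])
  have dist: "cdist B (\<phi> (y m)) (\<phi> (y n)) = cnorm C (y m \<ominus> y n)" for m n
    using isometric_on_V[OF C.subspace_minus[OF V_subspace y y], of m n] \<phi>_minus[OF yC yC]
    by (simp add: cdist_bounded_operators \<phi>y)
  have "MB.MCauchy (\<lambda>n. \<phi> (y n))"
    unfolding MB.MCauchy_def
  proof (intro conjI allI impI)
    show "range (\<lambda>n. \<phi> (y n)) \<subseteq> carrier B" using \<phi>y by (auto simp: bounded_operator_algebra_simps)
    fix \<epsilon> :: real assume "\<epsilon> > 0"
    then have "\<epsilon> / 2 > 0" by simp
    then obtain N where N: "\<And>n. n \<ge> N \<Longrightarrow> cnorm C (x \<ominus> y n) < \<epsilon> / 2"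
      using order_tendstoD(2)[OF lim, of "\<epsilon> / 2"] unfolding eventually_sequentially by blast
    have "cdist B (\<phi> (y m)) (\<phi> (y n)) < \<epsilon>" if "N \<le> m" "N \<le> n" for m n
      using N[OF that(1)] N[OF that(2)] C.cnorm_minus_triangle[OF yC x yC, of m n]
        C.cnorm_minus_commute[OF x yC, of m] by (simp add: dist)
    then show "\<exists>N. \<forall>m n. N \<le> m \<longrightarrow> N \<le> n \<longrightarrow> cdist B (\<phi> (y m)) (\<phi> (y n)) < \<epsilon>" by blast
  qed
  then obtain T where "limitin MB.mtopology (\<lambda>n. \<phi> (y n)) T sequentially"
    using B.complete unfolding MB.mcomplete_def by blast
  then have T: "T \<in> bounded_operators J"
    and lim_T: "(\<lambda>n. cdist B (\<phi> (y n)) T) \<longlonglongrightarrow> 0"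
    unfolding MB.limitin_metric_dist_null by (simp_all add: bounded_operator_algebra_simps(1))
  have lim_T': "(\<lambda>n. op_norm J (T \<ominus>\<^bsub>B\<^esub> \<phi> (y n))) \<longlonglongrightarrow> 0"
    using lim_T by (simp add: cdist_bounded_operators \<phi>y T op_norm_minus_commute[OF T \<phi>y])
  have "\<phi> x = T"
  proof (rule bounded_operators_eqI_entries[OF \<phi>_bounded[OF x] T])
    fix a b assume ab: "a \<in> J" "b \<in> J"
    note E = matrix_unitsD[OF e ab(1,1)] matrix_unitsD[OF e ab(2,2)] matrix_unitsD[OF e ab]
    let ?t = "T (basis_vec b) a"
    let ?corner = "\<lambda>z. e a a \<otimes> z \<otimes> e b b"
    have corner_closed: "?corner z \<in> carrier C" if "z \<in> carrier C" for z
      using that E by (simp add: C.mult_closed)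
    have "cnorm C (?corner x \<ominus> ?t \<odot> e a b)
        \<le> cnorm C (x \<ominus> y n) + op_norm J (T \<ominus>\<^bsub>B\<^esub> \<phi> (y n))" for n
    proof -
      let ?c = "\<phi> (y n) (basis_vec b) a"
      let ?d = "x \<ominus> y n"
      have d: "?d \<in> carrier C" using x yC by simp
      have "?corner x \<ominus> ?corner (y n) = ?corner ?d"
        using x yC E by (simp add: C.minus_mult C.mult_closed)
      also have "cnorm C \<dots> \<le> cnorm C (e a a \<otimes> ?d) * cnorm C (e b b)"
        using d E by (intro C.cnorm_mult C.mult_closed)
      also have "\<dots> \<le> (cnorm C (e a a) * cnorm C ?d) * cnorm C (e b b)"
        using d E by (intro mult_right_mono C.cnorm_mult C.cnorm_nonneg)
      finally have 1: "cnorm C (?corner x \<ominus> ?corner (y n)) \<le> cnorm C ?d"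
        by (simp add: C.cnorm_matrix_unit[OF e] ab)
      have "?c \<odot> e a b \<ominus> ?t \<odot> e a b = (?c - ?t) \<odot> e a b"
        using E C.scalar_laws(3)[of "e a b" ?c "- ?t"] by (simp add: C.minus_eq_smult C.scalar_laws(2))
      then have "cnorm C (?corner (y n) \<ominus> ?t \<odot> e a b) = cmod (?c - ?t)"
        using E by (simp add: corner_of_V[OF y ab] C.cnorm_smult C.cnorm_matrix_unit[OF e ab])
      also have "\<dots> = cmod ((T \<ominus>\<^bsub>B\<^esub> \<phi> (y n)) (basis_vec b) a)"
        by (simp add: bounded_operators_minus_apply[OF T \<phi>y basis_vec_ell2[OF ab(2)]] norm_minus_commute)
      also have "\<dots> \<le> op_norm J (T \<ominus>\<^bsub>B\<^esub> \<phi> (y n))"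
        by (rule entry_le_op_norm[OF bounded_operators_minus_closed[OF T \<phi>y] ab])
      finally show ?thesis
        using 1 C.cnorm_minus_triangle[OF corner_closed[OF x] corner_closed[OF yC[of n]] C.smult_in[OF E(9)], of ?t]
        by simp
    qed
    then have "cnorm C (?corner x \<ominus> ?t \<odot> e a b) \<le> 0 + 0"
      by (intro LIMSEQ_le_const[OF tendsto_add[OF lim lim_T']]) auto
    then have "?corner x = ?t \<odot> e a b"
      using C.cnorm_minus_eq_0_iff[OF corner_closed[OF x] C.smult_in[OF E(9)], of ?t]
        C.cnorm_nonneg[of "?corner x \<ominus> ?t \<odot> e a b"] corner_closed[OF x] E by simp
    then have "\<phi> (?corner x) = \<phi> (?t \<odot> e a b)" by simp
    then have "(\<phi> x (basis_vec b) a \<odot>\<^bsub>B\<^esub> matrix_unit J a b) (basis_vec b) a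
        = (?t \<odot>\<^bsub>B\<^esub> matrix_unit J a b) (basis_vec b) a"
      using E x by (simp add: star_homD[OF \<phi>] C.mult_closed \<phi>_e ab matrix_unit_corner \<phi>_bounded)
    then show "\<phi> x (basis_vec b) a = ?t"
      using basis_vec_ell2[OF ab(2)]
      by (simp add: bounded_operator_algebra_simps matrix_unit_apply, simp add: basis_vec_def)
  qed
  then show ?thesis using lim_T' by simp
qed

lemma I_sequence:
  assumes "x \<in> I"
  obtains y where "\<And>n. y n \<in> V" "(\<lambda>n. cnorm C (x \<ominus> y n)) \<longlonglongrightarrow> 0"
proof -
  have "\<exists>y\<in>V. cnorm C (x \<ominus> y) < 1 / real (Suc n)" for n
    using assms C.in_closed_cspan_iff[OF units_closed] by simp
  then obtain y where y: "\<And>n. y n \<in> V" "\<And>n. cnorm C (x \<ominus> y n) < 1 / real (Suc n)" by metis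
  have "(\<lambda>n. cnorm C (x \<ominus> y n)) \<longlonglongrightarrow> 0"
  proof (rule tendsto_sandwich[OF _ _ tendsto_const LIMSEQ_Suc[OF lim_1_over_n]])
    show "\<forall>\<^sub>F n in sequentially. 0 \<le> cnorm C (x \<ominus> y n)"
      using C.cnorm_nonneg I_carrier[OF assms] V_carrier[OF y(1)] by simp
    show "\<forall>\<^sub>F n in sequentially. cnorm C (x \<ominus> y n) \<le> 1 / real (Suc n)"
      using y(2) by (simp add: less_imp_le)
  qed
  then show thesis using that y by blast
qed

lemma isometric_on_I:
  assumes x: "x \<in> I"
  shows "op_norm J (\<phi> x) = cnorm C x"
proof -
  obtain y where y: "\<And>n. y n \<in> V" and lim: "(\<lambda>n. cnorm C (x \<ominus> y n)) \<longlonglongrightarrow> 0"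
    using I_sequence[OF x] by blast
  note xC = I_carrier[OF x] and yC = V_carrier[OF y]
  have diff: "\<bar>op_norm J (\<phi> x) - cnorm C x\<bar> \<le> op_norm J (\<phi> x \<ominus>\<^bsub>B\<^esub> \<phi> (y n)) + cnorm C (x \<ominus> y n)" for n
  proof -
    have B_carrier: "\<phi> z \<in> carrier B" if "z \<in> carrier C" for z by (rule star_homD(1)[OF \<phi> that])
    show ?thesis
      using C.cnorm_diff_le[OF xC yC[of n]] B.cnorm_diff_le[OF B_carrier[OF xC] B_carrier[OF yC[of n]]]
        isometric_on_V[OF y[of n]]
      by linarith
  qed
  have "\<bar>op_norm J (\<phi> x) - cnorm C x\<bar> \<le> 0 + 0"
    by (rule LIMSEQ_le_const[OF tendsto_add[OF \<phi>_limit[OF xC y lim] lim]]) (use diff in auto)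
  then show ?thesis by simp
qed

lemma \<phi>_V_matrix:
  assumes y: "y \<in> V"
  obtains F c where "finite F" "F \<subseteq> J" "\<phi> y = mat_op J F c"
proof -
  obtain F where F: "finite F" "F \<subseteq> J" and yF: "y \<in> cspan C (unit_set e F)"
    using C.cspan_unit_set_finite[OF y] by blast
  let ?g = "\<lambda>(a, b). e a a \<otimes> y \<otimes> e b b"
  have E: "e a b \<in> carrier C" if "a \<in> F" "b \<in> F" for a b
    using that F by (intro matrix_unitsD(1)[OF e]) auto
  have g: "?g \<in> F \<times> F \<rightarrow> carrier C" using E V_carrier[OF y] by (auto simp: C.mult_closed)
  have "\<phi> y = finsum B (\<lambda>i. \<phi> (?g i)) (F \<times> F)"
    using star_hom_finsum[OF C B \<phi> _ g] F C.unit_corner_sum[OF e F yF] by simp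
  also have "\<dots> = finsum B (\<lambda>(a, b). \<phi> y (basis_vec b) a \<odot>\<^bsub>B\<^esub> matrix_unit J a b) (F \<times> F)"
  proof (rule B.M.finsum_cong'[OF refl])
    show "(\<lambda>(a, b). \<phi> y (basis_vec b) a \<odot>\<^bsub>B\<^esub> matrix_unit J a b) \<in> F \<times> F \<rightarrow> carrier B"
      using F by (auto simp: bounded_operator_algebra_simps subset_iff
          intro!: bounded_operators_smult_closed matrix_unit_bounded)
    fix i assume "i \<in> F \<times> F"
    then obtain a b where i: "i = (a, b)" "a \<in> F" "b \<in> F" by auto
    then have ab: "a \<in> J" "b \<in> J" using F by auto
    show "\<phi> (?g i) = (case i of (a, b) \<Rightarrow> \<phi> y (basis_vec b) a \<odot>\<^bsub>B\<^esub> matrix_unit J a b)"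
      using i by (simp add: corner_of_V[OF y ab] star_homD[OF \<phi>] E \<phi>_e ab)
  qed
  also have "\<dots> = mat_op J F (\<lambda>a b. \<phi> y (basis_vec b) a)"
    by (rule finsum_matrix_units[OF F])
  finally show thesis using that F by blast
qed

lemma mat_op_in_image:
  assumes F: "finite F" "F \<subseteq> J"
  shows "\<exists>y\<in>V. \<phi> y = mat_op J F c"
proof -
  let ?g = "\<lambda>(a, b). c a b \<odot> e a b"
  have E: "e a b \<in> V" if "a \<in> F" "b \<in> F" for a b
  proof -
    have "e a b \<in> unit_set e J" using that F unfolding unit_set_def by blast
    then show ?thesis using C.cspan_base[OF units_closed] by blast
  qed
  have g: "?g \<in> F \<times> F \<rightarrow> V" using E V_subspace by (auto simp: is_subspace_def)
  have gC: "?g \<in> F \<times> F \<rightarrow> carrier C" using g V_carrier by (auto simp: Pi_iff)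
  have "\<phi> (finsum C ?g (F \<times> F)) = finsum B (\<lambda>i. \<phi> (?g i)) (F \<times> F)"
    using star_hom_finsum[OF C B \<phi> _ gC] F by simp
  also have "\<dots> = finsum B (\<lambda>(a, b). c a b \<odot>\<^bsub>B\<^esub> matrix_unit J a b) (F \<times> F)"
  proof (rule B.M.finsum_cong'[OF refl])
    show "(\<lambda>(a, b). c a b \<odot>\<^bsub>B\<^esub> matrix_unit J a b) \<in> F \<times> F \<rightarrow> carrier B"
      using F by (auto simp: bounded_operator_algebra_simps subset_iff
          intro!: bounded_operators_smult_closed matrix_unit_bounded)
    fix i assume "i \<in> F \<times> F"
    then obtain a b where i: "i = (a, b)" "a \<in> F" "b \<in> F" by auto
    then have ab: "a \<in> J" "b \<in> J" using F by auto
    show "\<phi> (?g i) = (case i of (a, b) \<Rightarrow> c a b \<odot>\<^bsub>B\<^esub> matrix_unit J a b)"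
      using i by (simp add: star_homD[OF \<phi>] V_carrier[OF E] \<phi>_e ab)
  qed
  also have "\<dots> = mat_op J F c" by (rule finsum_matrix_units[OF F])
  finally show ?thesis using C.subspace_finsum[OF V_subspace _ g] F by blast
qed

text \<open>
  Injectivity is clear since \<open>\<phi>\<close> is isometric on \<open>I\<close>. For surjectivity, a compact operator is a
  limit of finite matrices; these lift to the span, and since \<open>\<phi>\<close> is isometric there, the lifts
  form a Cauchy sequence, whose limit lies in \<open>I\<close>.
\<close>

theorem star_isomorphic_compact_operators:
  "star_isomorphic (C\<lparr>carrier := I\<rparr>) (compact_operator_algebra J)"
proof -
  let ?K = "compact_operator_algebra J"
  have compact: "\<phi> x \<in> carrier ?K" if x: "x \<in> I" for x
  proof (rule limit_of_matrices_is_compact[OF \<phi>_bounded[OF I_carrier[OF x]]])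
    obtain y where y: "\<And>n. y n \<in> V" and lim: "(\<lambda>n. cnorm C (x \<ominus> y n)) \<longlonglongrightarrow> 0"
      using I_sequence[OF x] by blast
    fix \<epsilon> :: real assume "\<epsilon> > 0"
    then obtain n where n: "op_norm J (\<phi> x \<ominus>\<^bsub>B\<^esub> \<phi> (y n)) < \<epsilon>"
      using order_tendstoD(2)[OF \<phi>_limit[OF I_carrier[OF x] y lim]]
      unfolding eventually_sequentially by blast
    obtain F c where "finite F" "F \<subseteq> J" "\<phi> (y n) = mat_op J F c"
      by (rule \<phi>_V_matrix[OF y[of n]]) (rule that)
    then show "\<exists>F c. finite F \<and> F \<subseteq> J \<and> op_norm J (\<phi> x \<ominus>\<^bsub>B\<^esub> mat_op J F c) \<le> \<epsilon>"
      using n by (intro exI[of _ F] exI[of _ c]) (simp add: less_imp_le)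
  qed
  have inj: "inj_on \<phi> I"
  proof (rule inj_onI)
    fix x y assume xy: "x \<in> I" "y \<in> I" "\<phi> x = \<phi> y"
    note xC = I_carrier[OF xy(1)] and yC = I_carrier[OF xy(2)]
    have "cnorm C (x \<ominus> y) = op_norm J (\<phi> x \<ominus>\<^bsub>B\<^esub> \<phi> y)"
      using isometric_on_I[OF C.subspace_minus[OF I_subspace xy(1,2)]] \<phi>_minus[OF xC yC] by simp
    also have "\<dots> = 0" using B.cnorm_minus_eq_0_iff[of "\<phi> x" "\<phi> y"] xy(3) star_homD(1)[OF \<phi> xC] by simp
    finally show "x = y" using C.cnorm_minus_eq_0_iff[OF xC yC] by simp
  qed
  have surj: "T \<in> \<phi> ` I" if T: "T \<in> carrier ?K" for T
  proof -
    have TB: "T \<in> bounded_operators J" using T by (simp add: compact_operator_algebra_def)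
    have "\<exists>y\<in>V. op_norm J (T \<ominus>\<^bsub>B\<^esub> \<phi> y) \<le> 1 / real (Suc n)" for n
    proof -
      have pos: "1 / real (Suc n) > 0" by simp
      obtain F c where F: "finite F" "F \<subseteq> J" "op_norm J (T \<ominus>\<^bsub>B\<^esub> mat_op J F c) \<le> 1 / real (Suc n)"
        by (rule compact_operator_approx[OF T pos]) (rule that)
      obtain y where "y \<in> V" "\<phi> y = mat_op J F c" using mat_op_in_image[OF F(1,2)] by blast
      then show ?thesis using F(3) by (intro bexI[of _ y]) simp_all
    qed
    then obtain y where y: "\<And>n. y n \<in> V" and close: "\<And>n. op_norm J (T \<ominus>\<^bsub>B\<^esub> \<phi> (y n)) \<le> 1 / real (Suc n)"
      by metis
    note yC = V_carrier[OF y]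
    have \<phi>y: "\<phi> (y n) \<in> carrier B" for n by (rule star_homD(1)[OF \<phi> yC])
    have TB': "T \<in> carrier B" using TB by (simp add: bounded_operator_algebra_simps)
    have lim_T: "(\<lambda>n. op_norm J (T \<ominus>\<^bsub>B\<^esub> \<phi> (y n))) \<longlonglongrightarrow> 0"
    proof (rule tendsto_sandwich[OF _ _ tendsto_const LIMSEQ_Suc[OF lim_1_over_n]])
      show "\<forall>\<^sub>F n in sequentially. 0 \<le> op_norm J (T \<ominus>\<^bsub>B\<^esub> \<phi> (y n))"
        using B.cnorm_nonneg \<phi>y TB' by simp
    qed (use close in simp)
    interpret MC: Metric_space "carrier C" "cdist C" by (rule C.Metric_space_cdist)
    have dist: "cdist C (y m) (y n) = op_norm J (\<phi> (y m) \<ominus>\<^bsub>B\<^esub> \<phi> (y n))" for m n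
      using isometric_on_V[OF C.subspace_minus[OF V_subspace y y], of m n] \<phi>_minus[OF yC yC] yC
      by (simp add: cdist_def)
    have "MC.MCauchy y"
      unfolding MC.MCauchy_def
    proof (intro conjI allI impI)
      show "range y \<subseteq> carrier C" using yC by auto
      fix \<epsilon> :: real assume "\<epsilon> > 0"
      then have "\<epsilon> / 2 > 0" by simp
      then obtain N where N: "\<And>n. n \<ge> N \<Longrightarrow> op_norm J (T \<ominus>\<^bsub>B\<^esub> \<phi> (y n)) < \<epsilon> / 2"
        using order_tendstoD(2)[OF lim_T, of "\<epsilon> / 2"] unfolding eventually_sequentially by blast
      have "cdist C (y m) (y n) < \<epsilon>" if "N \<le> m" "N \<le> n" for m n
        using N[OF that(1)] N[OF that(2)] B.cnorm_minus_triangle[OF \<phi>y TB' \<phi>y, of m n]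
          B.cnorm_minus_commute[OF TB' \<phi>y, of m] by (simp add: dist)
      then show "\<exists>N. \<forall>m n. N \<le> m \<longrightarrow> N \<le> n \<longrightarrow> cdist C (y m) (y n) < \<epsilon>" by blast
    qed
    then obtain x where "limitin MC.mtopology y x sequentially"
      using C.complete unfolding MC.mcomplete_def by blast
    then have xC: "x \<in> carrier C" and "(\<lambda>n. cdist C (y n) x) \<longlonglongrightarrow> 0"
      by (auto simp: MC.limitin_metric_dist_null)
    then have lim_x: "(\<lambda>n. cnorm C (x \<ominus> y n)) \<longlonglongrightarrow> 0"
      using yC by (simp add: cdist_def C.cnorm_minus_commute[OF xC])
    have "x \<in> I"
      unfolding C.in_closed_cspan_iff[OF units_closed]
    proof (intro conjI xC allI impI)
      fix \<epsilon> :: real assume "\<epsilon> > 0"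
      then show "\<exists>y\<in>V. cnorm C (x \<ominus> y) < \<epsilon>"
        using order_tendstoD(2)[OF lim_x] y unfolding eventually_sequentially by blast
    qed
    have \<phi>x: "\<phi> x \<in> carrier B" by (rule star_homD(1)[OF \<phi> xC])
    have "op_norm J (\<phi> x \<ominus>\<^bsub>B\<^esub> T) \<le> 0 + 0"
    proof (rule LIMSEQ_le_const[OF tendsto_add[OF \<phi>_limit[OF xC y lim_x] lim_T]])
      show "\<exists>N. \<forall>n\<ge>N. op_norm J (\<phi> x \<ominus>\<^bsub>B\<^esub> T) \<le> op_norm J (\<phi> x \<ominus>\<^bsub>B\<^esub> \<phi> (y n)) + op_norm J (T \<ominus>\<^bsub>B\<^esub> \<phi> (y n))"
        using B.cnorm_minus_triangle[OF \<phi>x \<phi>y TB'] B.cnorm_minus_commute[OF TB' \<phi>y] by simp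
    qed
    then have "\<phi> x = T"
      using B.cnorm_minus_eq_0_iff[OF \<phi>x TB'] B.cnorm_nonneg[of "\<phi> x \<ominus>\<^bsub>B\<^esub> T"] \<phi>x TB' by simp
    then show ?thesis using \<open>x \<in> I\<close> by blast
  qed
  have "\<phi> \<in> star_hom (C\<lparr>carrier := I\<rparr>) ?K"
    using compact I_carrier star_homD[OF \<phi>]
    unfolding star_hom_def by (simp add: compact_operator_algebra_def)
  moreover have "bij_betw \<phi> (carrier (C\<lparr>carrier := I\<rparr>)) (carrier ?K)"
    unfolding bij_betw_def using inj compact surj by auto
  ultimately show ?thesis unfolding star_isomorphic_def by blast
qed

end

section \<open>Words that reach a minimal sinks set\<close>

locale minimal_sinks_labeled_space = weakly_left_resolving_labeled_space G lab \<B>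
  for G :: "('v, 'e) pre_digraph" and lab :: "'e \<Rightarrow> 'a" and \<B> :: "'v set set" +
  fixes A :: "'v set"
  assumes minimal: "minimal_sinks_set G \<B> A"
begin

text \<open>
  By its definition \<^const>\<open>rel_range\<close> is empty for the empty word. With \<open>reach Y [] = Y\<close> instead,
  \<open>reach_Cons\<close> also holds for words of one letter.
\<close>

definition reach :: "'v set \<Rightarrow> 'a list \<Rightarrow> 'v set" where
  "reach Y \<alpha> = (if \<alpha> = [] then Y else rel_range G lab Y \<alpha>)"

text \<open>
  For \<open>Y \<in> \<B>\<close> the alternative to covering is, by \<open>reach_dichotomy\<close>, that \<open>A\<close> is disjoint from
  \<open>r(Y, \<alpha>)\<close>. The projection of \<open>Y\<close> fixes \<open>s\<^sub>\<alpha> p\<^sub>A\<close> if \<open>Y\<close> covers \<open>\<alpha>\<close> and kills it otherwise.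
\<close>

definition covers :: "'v set \<Rightarrow> 'a list \<Rightarrow> bool" where
  "covers Y \<alpha> \<longleftrightarrow> A \<subseteq> reach Y \<alpha>"

abbreviation "J \<equiv> words_onto G lab A"

lemma A_in: "A \<in> \<B>" and A_nonempty: "A \<noteq> {}" and A_sinks: "A \<subseteq> sinks G"
  and A_dichotomy: "B \<in> \<B> \<Longrightarrow> A \<subseteq> B \<or> A \<inter> B = {}"
  using minimal by (auto simp: minimal_sinks_set_def)

lemma A_verts: "A \<subseteq> verts G"
  using A_sinks by (auto simp: sinks_def)

lemma rel_range_single: "rel_range G lab Y [a] = {head G e | e. e \<in> arcs G \<and> lab e = a \<and> tail G e \<in> Y}"
proof (intro Set.set_eqI iffI)
  fix v assume "v \<in> rel_range G lab Y [a]"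
  then obtain u q where q: "awalk u q v" "map lab q = [a]" "u \<in> Y" by (auto simp: rel_range_def)
  then obtain e where "q = [e]" "lab e = a" by auto
  then show "v \<in> {head G e | e. e \<in> arcs G \<and> lab e = a \<and> tail G e \<in> Y}"
    using q by (auto simp: awalk_Cons_iff awalk_Nil_iff)
next
  fix v assume "v \<in> {head G e | e. e \<in> arcs G \<and> lab e = a \<and> tail G e \<in> Y}"
  then obtain e where "v = head G e" "e \<in> arcs G" "lab e = a" "tail G e \<in> Y" by blast
  then show "v \<in> rel_range G lab Y [a]"
    unfolding rel_range_def
    by (intro CollectI exI[of _ "tail G e"] exI[of _ "[e]"]) (simp add: awalk_Cons_iff awalk_Nil_iff)
qed

lemma reach_Cons: "reach Y (a # \<alpha>) = reach (rel_range G lab Y [a]) \<alpha>"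
proof (cases "\<alpha> = []")
  case False
  have "rel_range G lab Y (a # \<alpha>) = rel_range G lab (rel_range G lab Y [a]) \<alpha>"
  proof (intro Set.set_eqI iffI)
    fix v assume "v \<in> rel_range G lab Y (a # \<alpha>)"
    then obtain u q where q: "awalk u q v" "map lab q = a # \<alpha>" "u \<in> Y" by (auto simp: rel_range_def)
    then obtain e q' where "q = e # q'" "lab e = a" "map lab q' = \<alpha>" by auto
    then show "v \<in> rel_range G lab (rel_range G lab Y [a]) \<alpha>"
      using q False unfolding rel_range_single rel_range_def[of _ _ _ \<alpha>] by (force simp: awalk_Cons_iff)
  next
    fix v assume "v \<in> rel_range G lab (rel_range G lab Y [a]) \<alpha>"
    then obtain e q where "awalk (head G e) q v" "map lab q = \<alpha>" "e \<in> arcs G" "lab e = a" "tail G e \<in> Y"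
      unfolding rel_range_single rel_range_def[of _ _ _ \<alpha>] by auto
    then show "v \<in> rel_range G lab Y (a # \<alpha>)"
      unfolding rel_range_def
      by (intro CollectI exI[of _ "tail G e"] exI[of _ "e # q"]) (simp add: awalk_Cons_iff)
  qed
  then show ?thesis using False by (simp add: reach_def)
qed (simp add: reach_def)

lemma reach_mono: "Y \<subseteq> Z \<Longrightarrow> reach Y \<alpha> \<subseteq> reach Z \<alpha>"
  by (auto simp: reach_def rel_range_def)

lemma reach_Un: "reach (Y \<union> Z) \<alpha> = reach Y \<alpha> \<union> reach Z \<alpha>"
  by (auto simp: reach_def rel_range_def)

lemma reach_empty: "reach {} \<alpha> = {}"
  by (auto simp: reach_def rel_range_def)

lemma rel_range_nonpath: "\<alpha> \<notin> labeled_paths G lab \<Longrightarrow> rel_range G lab Y \<alpha> = {}"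
  by (auto simp: rel_range_def labeled_paths_def)

text \<open>
  If \<open>\<alpha>\<close> labels a path, this is weak left-resolvability. For all other non-empty words the three
  sets are empty.
\<close>

lemma reach_Int: "Y \<in> \<B> \<Longrightarrow> Z \<in> \<B> \<Longrightarrow> reach (Y \<inter> Z) \<alpha> = reach Y \<alpha> \<inter> reach Z \<alpha>"
  using weakly_left_resolving[of Y Z \<alpha>] rel_range_nonpath[of \<alpha>]
  by (cases "\<alpha> \<in> labeled_paths G lab") (auto simp: reach_def)

text \<open>
  If \<open>\<alpha>\<close> labels a path or is empty, then \<open>r(Y, \<alpha>)\<close> lies in \<open>\<B>\<close> and minimality of \<open>A\<close> applies; for
  all other words it is empty.
\<close>

lemma reach_dichotomy: "Y \<in> \<B> \<Longrightarrow> A \<subseteq> reach Y \<alpha> \<or> A \<inter> reach Y \<alpha> = {}"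
  using A_dichotomy[of Y] A_dichotomy[OF rel_range_in, of Y \<alpha>] rel_range_nonpath[of \<alpha> Y]
  by (cases "\<alpha> \<in> labeled_paths G lab") (auto simp: reach_def)

lemma covers_Cons: "covers Y (a # \<alpha>) \<longleftrightarrow> covers (rel_range G lab Y [a]) \<alpha>"
  by (simp add: covers_def reach_Cons)

lemma covers_Nil: "covers Y [] \<longleftrightarrow> A \<subseteq> Y"
  by (simp add: covers_def reach_def)

lemma covers_Int: "Y \<in> \<B> \<Longrightarrow> Z \<in> \<B> \<Longrightarrow> covers (Y \<inter> Z) \<alpha> \<longleftrightarrow> covers Y \<alpha> \<and> covers Z \<alpha>"
  by (simp add: covers_def reach_Int)

text \<open>
  By \<open>reach_dichotomy\<close>, each of the two ranges contains \<open>A\<close> as soon as it meets \<open>A\<close>, so their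
  union cannot contain \<open>A\<close> without one of them doing so.
\<close>

lemma covers_Un: "Y \<in> \<B> \<Longrightarrow> Z \<in> \<B> \<Longrightarrow> covers (Y \<union> Z) \<alpha> \<longleftrightarrow> covers Y \<alpha> \<or> covers Z \<alpha>"
  using reach_dichotomy[of Y \<alpha>] reach_dichotomy[of Z \<alpha>] A_nonempty
  unfolding covers_def reach_Un by blast

lemma covers_empty: "\<not> covers {} \<alpha>"
  using A_nonempty by (simp add: covers_def reach_empty)

lemma rel_range_sinks: "rel_range G lab A [a] = {}"
  using A_sinks by (auto simp: rel_range_single sinks_def)

lemma covers_A_iff: "covers A \<alpha> \<longleftrightarrow> \<alpha> = []"
  by (cases \<alpha>) (simp_all add: covers_Cons covers_Nil rel_range_sinks covers_empty)

lemma word_range_eq_reach: "\<alpha> \<noteq> [] \<Longrightarrow> word_range G lab \<alpha> = reach (verts G) \<alpha>"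
  by (auto simp: word_range_def reach_def rel_range_def)

text \<open>
  A word whose range contains the non-empty set \<open>A\<close> is the label of a path.
\<close>

lemma words_onto_iff: "\<alpha> \<in> J \<longleftrightarrow> covers (verts G) \<alpha>"
proof (cases "\<alpha> = []")
  case True
  then show ?thesis using A_verts by (simp add: words_onto_def covers_Nil)
next
  case False
  then show ?thesis
    using A_nonempty rel_range_nonpath[of \<alpha> "verts G"]
    by (auto simp: words_onto_def covers_def word_range_eq_reach reach_def)
qed

lemma Nil_in_J: "[] \<in> J"
  by (simp add: words_onto_def)

lemma Cons_in_J_iff: "a # \<alpha> \<in> J \<longleftrightarrow> covers (word_range G lab [a]) \<alpha>"
  by (simp add: words_onto_iff covers_Cons word_range_eq_reach) (simp add: reach_def)

lemma covers_in_J: "Y \<subseteq> verts G \<Longrightarrow> covers Y \<alpha> \<Longrightarrow> \<alpha> \<in> J"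
  unfolding words_onto_iff covers_def using reach_mono by blast

lemma label_path: "a \<in> labels G lab \<Longrightarrow> [a] \<in> labeled_paths G lab"
proof -
  assume "a \<in> labels G lab"
  then obtain e where e: "e \<in> arcs G" "a = lab e" by (auto simp: labels_def)
  then have "awalk (tail G e) [e] (head G e)" by (simp add: awalk_Cons_iff awalk_Nil_iff)
  then have "map lab [e] \<in> labeled_paths G lab" unfolding labeled_paths_def by blast
  then show ?thesis using e by simp
qed

lemma Cons_in_J_D: "a # \<alpha> \<in> J \<Longrightarrow> \<alpha> \<in> J"
proof (rule covers_in_J)
  assume "a # \<alpha> \<in> J"
  then show "covers (word_range G lab [a]) \<alpha>" by (simp add: Cons_in_J_iff)
  show "word_range G lab [a] \<subseteq> verts G" by (auto simp: word_range_def)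
qed

lemma covers_label: "covers Y (a # \<alpha>) \<Longrightarrow> a \<in> labels_from G lab Y"
proof (rule ccontr)
  assume c: "covers Y (a # \<alpha>)" and "a \<notin> labels_from G lab Y"
  then have "rel_range G lab Y [a] = {}" by (auto simp: rel_range_single labels_from_def)
  then show False using c covers_empty by (simp add: covers_Cons)
qed

lemma labeled_paths_letters: "\<alpha> \<in> labeled_paths G lab \<Longrightarrow> set \<alpha> \<subseteq> labels G lab"
  unfolding labeled_paths_def labels_def using awalk_def by fastforce

lemma J_subset: "J \<subseteq> labeled_paths G lab \<union> {[]}"
  by (auto simp: words_onto_def)

lemma J_letters: "\<alpha> \<in> J \<Longrightarrow> set \<alpha> \<subseteq> labels G lab"
  using J_subset labeled_paths_letters by fastforce

section \<open>A representation in which the projection of the sinks set is a matrix unit\<close>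

definition vertex_op :: "'v set \<Rightarrow> (('a list \<Rightarrow> complex) \<Rightarrow> ('a list \<Rightarrow> complex))" where
  "vertex_op Y = pull_op J (\<lambda>\<alpha>. if \<alpha> \<in> J \<and> covers Y \<alpha> then Some \<alpha> else None)"

text \<open>
  Reindexing by \<open>shift a\<close> gives the operator that prepends \<open>a\<close>: the value of the new function at
  \<open>a # \<alpha>\<close> is the value of the old one at \<open>\<alpha>\<close>. Words that leave \<open>J\<close> when \<open>a\<close> is prepended are sent
  to zero.
\<close>

definition shift :: "'a \<Rightarrow> 'a list \<Rightarrow> 'a list option" where
  "shift a \<beta> = (case \<beta> of [] \<Rightarrow> None | b # \<alpha> \<Rightarrow> if b = a \<and> \<beta> \<in> J then Some \<alpha> else None)"

definition unshift :: "'a \<Rightarrow> 'a list \<Rightarrow> 'a list option" where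
  "unshift a \<alpha> = (if a # \<alpha> \<in> J then Some (a # \<alpha>) else None)"

lemma partial_bij_restriction: "partial_bij J (\<lambda>\<alpha>. if \<alpha> \<in> J \<and> Q \<alpha> then Some \<alpha> else None)"
  by (rule partial_bijI) (auto split: if_splits)

lemma shift_eq_Some: "shift a \<beta> = Some \<alpha> \<longleftrightarrow> \<beta> = a # \<alpha> \<and> \<beta> \<in> J"
  by (auto simp: shift_def split: list.splits if_splits)

lemma unshift_eq_Some: "unshift a \<alpha> = Some \<beta> \<longleftrightarrow> \<beta> = a # \<alpha> \<and> \<beta> \<in> J"
  by (auto simp: unshift_def)

lemma partial_bij_shift: "partial_bij J (shift a)" "partial_bij J (unshift a)"
proof -
  show "partial_bij J (shift a)"
    by (rule partial_bijI) (simp_all add: shift_eq_Some Cons_in_J_D)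
  show "partial_bij J (unshift a)"
    by (rule partial_bijI) (simp_all add: unshift_eq_Some Cons_in_J_D)
qed

lemma adj_shift: "op_adj J (pull_op J (shift a)) = pull_op J (unshift a)"
  by (rule op_adj_pull_op[OF partial_bij_shift]) (auto simp: shift_eq_Some unshift_eq_Some)

abbreviation "B \<equiv> bounded_operator_algebra J"

lemma vertex_op_mult: "Y \<in> \<B> \<Longrightarrow> Z \<in> \<B> \<Longrightarrow> vertex_op Y \<otimes>\<^bsub>B\<^esub> vertex_op Z = vertex_op (Y \<inter> Z)"
  unfolding vertex_op_def pull_op_mult[OF partial_bij_restriction partial_bij_restriction]
  by (rule arg_cong[where f = "pull_op J"]) (auto simp: covers_Int)

lemma vertex_op_bounded: "vertex_op Y \<in> bounded_operators J"
  unfolding vertex_op_def by (rule pull_op_bounded[OF partial_bij_restriction])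

lemma vertex_op_apply: "f \<in> ell2 J \<Longrightarrow> vertex_op Y f = (\<lambda>\<alpha>. if \<alpha> \<in> J \<and> covers Y \<alpha> then f \<alpha> else 0)"
  by (auto simp: vertex_op_def pull_op_apply)

lemma shift_bounded: "pull_op J (shift a) \<in> bounded_operators J"
  by (rule pull_op_bounded[OF partial_bij_shift(1)])

lemma adj_vertex_op: "op_adj J (vertex_op Y) = vertex_op Y"
  unfolding vertex_op_def by (rule op_adj_pull_op[OF partial_bij_restriction partial_bij_restriction]) auto

lemma unshift_shift:
  "pull_op J (unshift a) \<otimes>\<^bsub>B\<^esub> pull_op J (shift b) =
    (if a = b then vertex_op (word_range G lab [a]) else \<zero>\<^bsub>B\<^esub>)"
proof -
  have eq: "(\<lambda>\<alpha>. Option.bind (unshift a \<alpha>) (shift b)) =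
      (if a = b then (\<lambda>\<alpha>. if \<alpha> \<in> J \<and> covers (word_range G lab [a]) \<alpha> then Some \<alpha> else None) else (\<lambda>_. None))"
  proof
    fix \<alpha>
    show "Option.bind (unshift a \<alpha>) (shift b) = (if a = b
        then (\<lambda>\<alpha>. if \<alpha> \<in> J \<and> covers (word_range G lab [a]) \<alpha> then Some \<alpha> else None) else (\<lambda>_. None)) \<alpha>"
      using Cons_in_J_D[of a \<alpha>] by (auto simp: unshift_def shift_def Cons_in_J_iff)
  qed
  show ?thesis
    unfolding pull_op_mult[OF partial_bij_shift(2,1)] eq by (simp add: vertex_op_def pull_op_empty)
qed

lemma unshift_vertex_op:
  assumes Y: "Y \<in> \<B>"
  shows "pull_op J (unshift a) \<otimes>\<^bsub>B\<^esub> vertex_op Y = vertex_op (rel_range G lab Y [a]) \<otimes>\<^bsub>B\<^esub> pull_op J (unshift a)"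
  unfolding vertex_op_def pull_op_mult[OF partial_bij_shift(2) partial_bij_restriction]
    pull_op_mult[OF partial_bij_restriction partial_bij_shift(2)]
proof (rule arg_cong[where f = "pull_op J"], rule ext)
  fix \<alpha>
  show "Option.bind (unshift a \<alpha>) (\<lambda>\<alpha>. if \<alpha> \<in> J \<and> covers Y \<alpha> then Some \<alpha> else None) =
      Option.bind (if \<alpha> \<in> J \<and> covers (rel_range G lab Y [a]) \<alpha> then Some \<alpha> else None) (unshift a)"
    using Cons_in_J_D[of a \<alpha>] by (auto simp: unshift_def covers_Cons)
qed

lemma shift_vertex_unshift_apply:
  assumes f: "f \<in> ell2 J"
  shows "(pull_op J (shift a) \<otimes>\<^bsub>B\<^esub> vertex_op Y \<otimes>\<^bsub>B\<^esub> pull_op J (unshift a)) f =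
    (\<lambda>\<beta>. if \<beta> \<in> J \<and> covers Y (tl \<beta>) \<and> \<beta> = a # tl \<beta> then f \<beta> else 0)"
proof
  fix \<beta>
  let ?u = "pull_op J (unshift a) f"
  have u: "?u \<in> ell2 J" by (rule bounded_operatorsD(1)[OF pull_op_bounded[OF partial_bij_shift(2)] f])
  have v: "vertex_op Y ?u \<in> ell2 J" by (rule bounded_operatorsD(1)[OF vertex_op_bounded u])
  have "(pull_op J (shift a) \<otimes>\<^bsub>B\<^esub> vertex_op Y \<otimes>\<^bsub>B\<^esub> pull_op J (unshift a)) f \<beta>
      = pull_op J (shift a) (vertex_op Y ?u) \<beta>"
    using f u by (simp add: bounded_operator_algebra_simps)
  also have "\<dots> = (case shift a \<beta> of None \<Rightarrow> 0 | Some \<alpha> \<Rightarrow> vertex_op Y ?u \<alpha>)"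
    by (rule pull_op_apply[OF v])
  also have "\<dots> = (case shift a \<beta> of None \<Rightarrow> 0 | Some \<alpha> \<Rightarrow> if \<alpha> \<in> J \<and> covers Y \<alpha> then
      (case unshift a \<alpha> of None \<Rightarrow> 0 | Some \<gamma> \<Rightarrow> f \<gamma>) else 0)"
    by (simp only: vertex_op_apply[OF u] pull_op_apply[OF f])
  also have "\<dots> = (if \<beta> \<in> J \<and> covers Y (tl \<beta>) \<and> \<beta> = a # tl \<beta> then f \<beta> else 0)"
    by (cases \<beta>) (auto simp: shift_def unshift_def dest: Cons_in_J_D)
  finally show "(pull_op J (shift a) \<otimes>\<^bsub>B\<^esub> vertex_op Y \<otimes>\<^bsub>B\<^esub> pull_op J (unshift a)) f \<beta>
      = (if \<beta> \<in> J \<and> covers Y (tl \<beta>) \<and> \<beta> = a # tl \<beta> then f \<beta> else 0)" .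
qed

text \<open>
  A word covered by \<open>Y\<close> is not empty, because \<open>Y\<close> contains no sinks, and its first letter labels
  an edge that starts in \<open>Y\<close>. So at each word at most one summand, that of the first letter, is
  non-zero.
\<close>

lemma vertex_op_sum:
  assumes Y: "Y \<in> \<B>" and fin: "finite (labels_from G lab Y)" and no_sink: "Y \<inter> sinks G = {}"
  shows "vertex_op Y = (\<Oplus>\<^bsub>B\<^esub>a\<in>labels_from G lab Y.
    pull_op J (shift a) \<otimes>\<^bsub>B\<^esub> vertex_op (rel_range G lab Y [a]) \<otimes>\<^bsub>B\<^esub> op_adj J (pull_op J (shift a)))"
    (is "_ = finsum B ?g _")
proof -
  interpret B: cstar_algebra B by (rule cstar_algebra_bounded_operators)
  have g: "?g a \<in> bounded_operators J" for a
    by (intro bounded_operators_closed op_adj shift_bounded vertex_op_bounded)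
  show ?thesis
  proof (rule bounded_operators_eqI[OF vertex_op_bounded])
    show "finsum B ?g (labels_from G lab Y) \<in> bounded_operators J"
      using B.M.finsum_closed[of ?g] g by (simp add: bounded_operator_algebra_simps(1))
    fix f assume f: "f \<in> ell2 J"
    have "finsum B ?g (labels_from G lab Y) f =
        (\<lambda>\<beta>. \<Sum>a\<in>labels_from G lab Y. if \<beta> \<in> J \<and> covers (rel_range G lab Y [a]) (tl \<beta>) \<and> \<beta> = a # tl \<beta> then f \<beta> else 0)"
      using bounded_operators_finsum_apply[OF fin g f]
      by (simp add: adj_shift shift_vertex_unshift_apply[OF f])
    also have "\<dots> = vertex_op Y f"
    proof
      fix \<beta>
      show "(\<Sum>a\<in>labels_from G lab Y. if \<beta> \<in> J \<and> covers (rel_range G lab Y [a]) (tl \<beta>) \<and> \<beta> = a # tl \<beta> then f \<beta> else 0)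
          = vertex_op Y f \<beta>"
      proof (cases \<beta>)
        case Nil
        have "\<not> A \<subseteq> Y" using no_sink A_sinks A_nonempty by blast
        then show ?thesis using Nil f by (simp add: vertex_op_apply covers_Nil)
      next
        case (Cons b \<alpha>)
        have "(\<Sum>a\<in>labels_from G lab Y. if \<beta> \<in> J \<and> covers (rel_range G lab Y [a]) (tl \<beta>) \<and> \<beta> = a # tl \<beta> then f \<beta> else 0)
          = (\<Sum>a\<in>labels_from G lab Y. if a = b then if \<beta> \<in> J \<and> covers Y \<beta> then f \<beta> else 0 else 0)"
          using Cons by (intro sum.cong) (auto simp: covers_Cons)
        also have "\<dots> = (if \<beta> \<in> J \<and> covers Y \<beta> then f \<beta> else 0)"
          using fin covers_label[of Y b \<alpha>] Cons by auto
        finally show ?thesis using f by (simp add: vertex_op_apply)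
      qed
    qed
    finally show "vertex_op Y f = finsum B ?g (labels_from G lab Y) f" ..
  qed
qed

text \<open>
  The relations of a representation are the rules for \<^const>\<open>covers\<close>: intersections and unions are
  \<open>covers_Int\<close> and \<open>covers_Un\<close>, and the commutation relation is \<open>covers_Cons\<close>.
\<close>

lemma representation_words_onto:
  "representation G lab \<B> B vertex_op (\<lambda>a. pull_op J (shift a))"
proof -
  interpret B: cstar_algebra B by (rule cstar_algebra_bounded_operators)
  have carrier: "vertex_op Y \<in> carrier B" "pull_op J (shift a) \<in> carrier B" for Y a
    by (simp_all add: bounded_operator_algebra_simps(1) vertex_op_bounded shift_bounded)
  show ?thesis
    unfolding representation_def
  proof (intro conjI ballI impI B.cstar_algebra_axioms cstar_algebra_bounded_operators)
    show "is_projection B (vertex_op Y)" if "Y \<in> \<B>" for Y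
      using vertex_op_mult[OF that that] by (simp add: is_projection_def carrier adj_vertex_op)
    show "is_partial_isometry B (pull_op J (shift a))" for a
    proof -
      have "pull_op J (shift a) \<otimes>\<^bsub>B\<^esub> pull_op J (unshift a) \<otimes>\<^bsub>B\<^esub> pull_op J (shift a)
          = pull_op J (shift a) \<otimes>\<^bsub>B\<^esub> vertex_op (word_range G lab [a])"
        using unshift_shift[of a a] B.mult_assoc carrier pull_op_bounded[OF partial_bij_shift(2)]
        by (simp add: bounded_operator_algebra_simps(1))
      also have "\<dots> = pull_op J (\<lambda>\<beta>. Option.bind (shift a \<beta>)
          (\<lambda>\<alpha>. if \<alpha> \<in> J \<and> covers (word_range G lab [a]) \<alpha> then Some \<alpha> else None))"
        unfolding vertex_op_def by (rule pull_op_mult[OF partial_bij_shift(1) partial_bij_restriction])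
      also have "\<dots> = pull_op J (shift a)"
      proof (rule arg_cong[where f = "pull_op J"], rule ext)
        fix \<beta>
        show "Option.bind (shift a \<beta>) (\<lambda>\<alpha>. if \<alpha> \<in> J \<and> covers (word_range G lab [a]) \<alpha> then Some \<alpha> else None) = shift a \<beta>"
          by (cases \<beta>) (auto simp: shift_def Cons_in_J_iff[symmetric] dest: Cons_in_J_D)
      qed
      finally show ?thesis by (simp add: is_partial_isometry_def carrier adj_shift)
    qed
    show "vertex_op Y \<otimes>\<^bsub>B\<^esub> vertex_op Z = vertex_op (Y \<inter> Z)" if "Y \<in> \<B>" "Z \<in> \<B>" for Y Z
      by (rule vertex_op_mult[OF that])
    show "vertex_op (Y \<union> Z) = (vertex_op Y \<oplus>\<^bsub>B\<^esub> vertex_op Z) \<ominus>\<^bsub>B\<^esub> vertex_op (Y \<inter> Z)"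
      if "Y \<in> \<B>" "Z \<in> \<B>" for Y Z
    proof (rule bounded_operators_eqI[OF vertex_op_bounded])
      show "(vertex_op Y \<oplus>\<^bsub>B\<^esub> vertex_op Z) \<ominus>\<^bsub>B\<^esub> vertex_op (Y \<inter> Z) \<in> bounded_operators J"
        by (intro bounded_operators_minus_closed bounded_operators_closed vertex_op_bounded)
      fix f assume f: "f \<in> ell2 J"
      then show "vertex_op (Y \<union> Z) f = ((vertex_op Y \<oplus>\<^bsub>B\<^esub> vertex_op Z) \<ominus>\<^bsub>B\<^esub> vertex_op (Y \<inter> Z)) f"
        using covers_Un[OF that] covers_Int[OF that]
        by (auto simp: bounded_operators_minus_apply bounded_operators_closed vertex_op_bounded
            bounded_operator_algebra_simps(3) vertex_op_apply)
    qed
    show "op_adj J (pull_op J (shift a)) \<otimes>\<^bsub>B\<^esub> pull_op J (shift b) =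
        (if a = b then vertex_op (word_range G lab [a]) else \<zero>\<^bsub>B\<^esub>)" for a b
      unfolding adj_shift by (rule unshift_shift)
    show "op_adj J (pull_op J (shift a)) \<otimes>\<^bsub>B\<^esub> vertex_op Y =
        vertex_op (rel_range G lab Y [a]) \<otimes>\<^bsub>B\<^esub> op_adj J (pull_op J (shift a))" if "Y \<in> \<B>" for a Y
      unfolding adj_shift by (rule unshift_vertex_op[OF that])
    show "vertex_op Y = (\<Oplus>\<^bsub>B\<^esub>a\<in>labels_from G lab Y.
        pull_op J (shift a) \<otimes>\<^bsub>B\<^esub> vertex_op (rel_range G lab Y [a]) \<otimes>\<^bsub>B\<^esub> op_adj J (pull_op J (shift a)))"
      if "Y \<in> \<B>" "finite (labels_from G lab Y) \<and> Y \<inter> sinks G = {}" for Y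
      using vertex_op_sum that by blast
  qed
qed

end

section \<open>The matrix units of a minimal sinks set\<close>

locale minimal_sinks_cstar_algebra = minimal_sinks_labeled_space G lab \<B> A
  for G :: "('v, 'e) pre_digraph" and lab :: "'e \<Rightarrow> 'a" and \<B> :: "'v set set" and A :: "'v set" +
  fixes C :: "'c cstar" (structure) and p :: "'v set \<Rightarrow> 'c" and s :: "'a \<Rightarrow> 'c"
  assumes universal: "labeled_graph_cstar_algebra G lab \<B> C p s"
begin

lemma representation: "representation G lab \<B> C p s"
  using universal by (simp add: labeled_graph_cstar_algebra_def)

lemma cstar: "cstar_algebra C"
  using representation by (simp add: representation_def)

sublocale C: cstar_algebra C by (rule cstar)

lemma p_carrier: "Y \<in> \<B> \<Longrightarrow> p Y \<in> carrier C"
  and p_adj: "Y \<in> \<B> \<Longrightarrow> adj C (p Y) = p Y"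
  and p_mult: "Y \<in> \<B> \<Longrightarrow> Z \<in> \<B> \<Longrightarrow> p Y \<otimes> p Z = p (Y \<inter> Z)"
  and s_carrier: "a \<in> labels G lab \<Longrightarrow> s a \<in> carrier C"
  using representation by (simp_all add: representation_def is_projection_def is_partial_isometry_def)

lemma adj_s_mult_s: "a \<in> labels G lab \<Longrightarrow> b \<in> labels G lab \<Longrightarrow>
    adj C (s a) \<otimes> s b = (if a = b then p (word_range G lab [a]) else \<zero>)"
  and adj_s_mult_p: "a \<in> labels G lab \<Longrightarrow> Y \<in> \<B> \<Longrightarrow>
    adj C (s a) \<otimes> p Y = p (rel_range G lab Y [a]) \<otimes> adj C (s a)"
  using representation unfolding representation_def by blast+

text \<open>
  The empty set emits no labels and contains no sinks, so its projection is an empty sum.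
\<close>

lemma p_empty:
  assumes "{} \<in> \<B>"
  shows "p {} = \<zero>"
proof -
  have no_labels: "labels_from G lab {} = {}" by (simp add: labels_from_def)
  have "\<forall>Y\<in>\<B>. finite (labels_from G lab Y) \<and> Y \<inter> sinks G = {} \<longrightarrow>
      p Y = (\<Oplus>a\<in>labels_from G lab Y. s a \<otimes> p (rel_range G lab Y [a]) \<otimes> adj C (s a))"
    using representation unfolding representation_def by (elim conjE)
  from bspec[OF this assms] show ?thesis by (simp add: no_labels)
qed

lemma p_mult_s:
  assumes a: "a \<in> labels G lab" and Y: "Y \<in> \<B>"
  shows "p Y \<otimes> s a = s a \<otimes> p (rel_range G lab Y [a])"
proof -
  have r: "rel_range G lab Y [a] \<in> \<B>" by (rule rel_range_in[OF Y label_path[OF a]])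
  have "adj C (adj C (s a) \<otimes> p Y) = adj C (p (rel_range G lab Y [a]) \<otimes> adj C (s a))"
    using adj_s_mult_p[OF a Y] by simp
  then show ?thesis
    using p_carrier Y r s_carrier[OF a] by (simp add: C.adj_mult C.adj_closed C.adj_adj p_adj)
qed

text \<open>
  The element \<open>s\<^sub>\<alpha> p\<^sub>A\<close>. Starting the recursion at \<open>p\<^sub>A\<close> avoids the multiplier unit \<open>s\<^sub>\<epsilon>\<close>.
\<close>

primrec w :: "'a list \<Rightarrow> 'c" where
  "w [] = p A"
| "w (a # \<alpha>) = s a \<otimes> w \<alpha>"

abbreviation "Words \<equiv> {\<alpha>. set \<alpha> \<subseteq> labels G lab}"

lemma w_carrier: "\<alpha> \<in> Words \<Longrightarrow> w \<alpha> \<in> carrier C"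
  by (induction \<alpha>) (auto simp: p_carrier A_in s_carrier C.mult_closed)

lemma w_mult_p: "\<alpha> \<in> Words \<Longrightarrow> w \<alpha> \<otimes> p A = w \<alpha>"
  by (induction \<alpha>) (auto simp: p_mult A_in p_carrier s_carrier w_carrier C.mult_assoc)

text \<open>
  Moving \<open>p\<^sub>Y\<close> past the letters of \<open>\<alpha>\<close> replaces \<open>Y\<close> by \<open>r(Y, \<alpha>)\<close>, and the product with \<open>p\<^sub>A\<close> is
  decided by the minimality of \<open>A\<close>.
\<close>

lemma p_mult_w:
  assumes "\<alpha> \<in> Words" "Y \<in> \<B>"
  shows "p Y \<otimes> w \<alpha> = (if covers Y \<alpha> then w \<alpha> else \<zero>)"
  using assms
proof (induction \<alpha> arbitrary: Y)
  case Nil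
  show ?case
  proof (cases "A \<subseteq> Y")
    case True
    then have "Y \<inter> A = A" by blast
    then show ?thesis using True Nil by (simp add: p_mult A_in covers_Nil)
  next
    case False
    then have "Y \<inter> A = {}" using A_dichotomy[OF Nil(2)] by blast
    then show ?thesis using False Nil p_empty Int_in[OF Nil(2) A_in] by (simp add: p_mult A_in covers_Nil)
  qed
next
  case (Cons a \<alpha>)
  have a: "a \<in> labels G lab" and \<alpha>: "\<alpha> \<in> Words" using Cons.prems by auto
  have r: "rel_range G lab Y [a] \<in> \<B>" by (rule rel_range_in[OF Cons.prems(2) label_path[OF a]])
  have "p Y \<otimes> w (a # \<alpha>) = (p Y \<otimes> s a) \<otimes> w \<alpha>"
    by (simp add: C.mult_assoc p_carrier s_carrier a Cons.prems w_carrier[OF \<alpha>])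
  also have "\<dots> = s a \<otimes> (p (rel_range G lab Y [a]) \<otimes> w \<alpha>)"
    by (simp add: p_mult_s[OF a Cons.prems(2)] C.mult_assoc p_carrier s_carrier a r w_carrier[OF \<alpha>])
  also have "\<dots> = (if covers Y (a # \<alpha>) then w (a # \<alpha>) else \<zero>)"
    by (simp add: Cons.IH[OF \<alpha> r] covers_Cons C.mult_zero s_carrier a)
  finally show ?case .
qed

text \<open>
  No edge starts in a sink.
\<close>

lemma adj_s_mult_w_Nil: "a \<in> labels G lab \<Longrightarrow> adj C (s a) \<otimes> w [] = \<zero>"
  using p_empty rel_range_in[OF A_in label_path, of a]
  by (simp add: adj_s_mult_p A_in rel_range_sinks C.mult_zero C.adj_closed s_carrier)

lemma adj_s_mult_w_Cons:
  assumes a: "a \<in> labels G lab" and \<alpha>: "b # \<alpha> \<in> Words"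
  shows "adj C (s a) \<otimes> w (b # \<alpha>) = (if a = b \<and> b # \<alpha> \<in> J then w \<alpha> else \<zero>)"
proof -
  have b: "b \<in> labels G lab" and \<alpha>': "\<alpha> \<in> Words" using \<alpha> by auto
  have r: "word_range G lab [b] \<in> \<B>" by (rule word_range_in[OF label_path[OF b]])
  have "adj C (s a) \<otimes> w (b # \<alpha>) = (adj C (s a) \<otimes> s b) \<otimes> w \<alpha>"
    by (simp add: C.mult_assoc C.adj_closed s_carrier a b w_carrier[OF \<alpha>'])
  also have "\<dots> = (if a = b \<and> b # \<alpha> \<in> J then w \<alpha> else \<zero>)"
    using w_carrier[OF \<alpha>'] by (auto simp: adj_s_mult_s a b p_mult_w[OF \<alpha>' r] Cons_in_J_iff C.mult_zero)
  finally show ?thesis .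
qed

text \<open>
  Letters cancel one at a time from the front. If one of the words runs out first, a letter meets
  \<open>p\<^sub>A\<close> and the product vanishes.
\<close>

lemma adj_w_mult_w:
  assumes "\<alpha> \<in> Words" "\<beta> \<in> Words"
  shows "adj C (w \<alpha>) \<otimes> w \<beta> = (if \<alpha> = \<beta> \<and> \<alpha> \<in> J then p A else \<zero>)"
  using assms
proof (induction \<alpha> arbitrary: \<beta>)
  case Nil
  then show ?case
    using p_mult_w[OF Nil(2) A_in] by (auto simp: p_adj A_in covers_A_iff Nil_in_J)
next
  case (Cons a \<alpha>)
  have a: "a \<in> labels G lab" and \<alpha>: "\<alpha> \<in> Words" using Cons.prems by auto
  have "adj C (w (a # \<alpha>)) \<otimes> w \<beta> = adj C (w \<alpha>) \<otimes> (adj C (s a) \<otimes> w \<beta>)"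
    by (simp add: C.adj_mult C.mult_assoc C.adj_closed s_carrier a w_carrier[OF \<alpha>] w_carrier[OF Cons.prems(2)])
  also have "\<dots> = (if a # \<alpha> = \<beta> \<and> a # \<alpha> \<in> J then p A else \<zero>)"
  proof (cases \<beta>)
    case Nil
    then show ?thesis
      by (simp only: adj_s_mult_w_Nil[OF a]) (simp add: C.mult_zero C.adj_closed w_carrier[OF \<alpha>])
  next
    case (Cons b \<gamma>)
    have \<gamma>: "\<gamma> \<in> Words" using Cons Cons.prems by auto
    show ?thesis
      unfolding Cons adj_s_mult_w_Cons[OF a Cons.prems(2)[unfolded Cons]]
      using Cons.IH[OF \<alpha> \<gamma>] Cons_in_J_D[of a \<alpha>]
      by (auto simp: C.mult_zero C.adj_closed w_carrier[OF \<alpha>])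
  qed
  finally show ?case .
qed

lemma w_outside_J:
  assumes "\<alpha> \<in> Words" "\<alpha> \<notin> J"
  shows "w \<alpha> = \<zero>"
proof -
  have "(cnorm C (w \<alpha>))\<^sup>2 = 0"
    using C.cstar_identity[OF w_carrier[OF assms(1)]] adj_w_mult_w[OF assms(1,1)] assms(2)
    by (simp add: C.cnorm_zero)
  then show ?thesis by (simp add: C.cnorm_eq_0_iff w_carrier[OF assms(1)])
qed

definition unit_elem :: "'a list \<Rightarrow> 'a list \<Rightarrow> 'c" where
  "unit_elem \<alpha> \<beta> = w \<alpha> \<otimes> adj C (w \<beta>)"

lemma unit_elem_carrier: "\<alpha> \<in> Words \<Longrightarrow> \<beta> \<in> Words \<Longrightarrow> unit_elem \<alpha> \<beta> \<in> carrier C"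
  unfolding unit_elem_def by (intro C.mult_closed C.adj_closed w_carrier)

lemma J_Words: "\<alpha> \<in> J \<Longrightarrow> \<alpha> \<in> Words"
  using J_letters by simp

text \<open>
  On \<open>\<ell>\<^sup>2(J)\<close> the projection of \<open>A\<close> is the matrix unit at the empty word, the only word covered by
  \<open>A\<close>, and each letter shifts the row index.
\<close>

lemma exists_representation:
  obtains \<pi> where "\<pi> \<in> star_hom C B"
    and "\<And>\<alpha> \<beta>. \<lbrakk>\<alpha> \<in> J; \<beta> \<in> J\<rbrakk> \<Longrightarrow> \<pi> (unit_elem \<alpha> \<beta>) = matrix_unit J \<alpha> \<beta>"
proof -
  obtain \<pi> where \<pi>: "\<pi> \<in> star_hom C B" "\<And>Y. Y \<in> \<B> \<Longrightarrow> \<pi> (p Y) = vertex_op Y"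
    "\<And>a. a \<in> labels G lab \<Longrightarrow> \<pi> (s a) = pull_op J (shift a)"
    using universal_property[OF labeled_space_axioms universal representation_words_onto] by blast
  have \<pi>w: "\<pi> (w \<alpha>) = matrix_unit J \<alpha> []" if "\<alpha> \<in> J" for \<alpha>
    using that
  proof (induction \<alpha>)
    case Nil
    have "(\<lambda>\<alpha>. if \<alpha> \<in> J \<and> covers A \<alpha> then Some \<alpha> else None) = [[] \<mapsto> []]"
      by (auto simp: covers_A_iff Nil_in_J)
    then show ?case by (simp add: \<pi>(2) A_in vertex_op_def matrix_unit_def)
  next
    case (Cons a \<alpha>)
    have \<alpha>: "\<alpha> \<in> J" by (rule Cons_in_J_D[OF Cons.prems])
    have a: "a \<in> labels G lab" using J_letters[OF Cons.prems] by simp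
    have "\<pi> (w (a # \<alpha>)) = pull_op J (shift a) \<otimes>\<^bsub>B\<^esub> pull_op J [\<alpha> \<mapsto> []]"
      using Cons.IH[OF \<alpha>]
      by (simp add: star_homD[OF \<pi>(1)] s_carrier a w_carrier[OF J_Words[OF \<alpha>]] \<pi>(3) matrix_unit_def)
    also have "\<dots> = pull_op J (\<lambda>\<beta>. Option.bind (shift a \<beta>) [\<alpha> \<mapsto> []])"
      by (rule pull_op_mult[OF partial_bij_shift(1) partial_bij_single[OF \<alpha> Nil_in_J]])
    also have "(\<lambda>\<beta>. Option.bind (shift a \<beta>) [\<alpha> \<mapsto> []]) = [a # \<alpha> \<mapsto> []]"
    proof
      fix \<beta>
      show "Option.bind (shift a \<beta>) [\<alpha> \<mapsto> []] = [a # \<alpha> \<mapsto> []] \<beta>"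
        using Cons.prems by (cases \<beta>) (auto simp: shift_def)
    qed
    finally show ?case unfolding matrix_unit_def .
  qed
  have "\<pi> (unit_elem \<alpha> \<beta>) = matrix_unit J \<alpha> \<beta>" if "\<alpha> \<in> J" "\<beta> \<in> J" for \<alpha> \<beta>
    using that
    by (simp add: unit_elem_def star_homD[OF \<pi>(1)] C.adj_closed w_carrier J_Words \<pi>w matrix_unit_adj
        matrix_unit_mult Nil_in_J del: mem_Collect_eq)
  then show thesis using that \<pi>(1) by blast
qed

lemma matrix_units_unit_elem: "matrix_units C J unit_elem"
  unfolding matrix_units_def
proof (intro ballI conjI)
  fix \<alpha> \<beta> assume J: "\<alpha> \<in> J" "\<beta> \<in> J"
  note W = J_Words[OF J(1)] J_Words[OF J(2)]
  show "unit_elem \<alpha> \<beta> \<in> carrier C" by (rule unit_elem_carrier[OF W])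
  show "adj C (unit_elem \<alpha> \<beta>) = unit_elem \<beta> \<alpha>"
    by (simp add: unit_elem_def C.adj_mult C.adj_closed C.adj_adj w_carrier[OF W(1)] w_carrier[OF W(2)])
  show "unit_elem \<alpha> \<beta> \<noteq> \<zero>"
  proof
    assume z: "unit_elem \<alpha> \<beta> = \<zero>"
    obtain \<pi> where \<pi>: "\<pi> \<in> star_hom C B"
      "\<And>\<alpha> \<beta>. \<lbrakk>\<alpha> \<in> J; \<beta> \<in> J\<rbrakk> \<Longrightarrow> \<pi> (unit_elem \<alpha> \<beta>) = matrix_unit J \<alpha> \<beta>"
      using exists_representation by blast
    then have "matrix_unit J \<alpha> \<beta> = \<zero>\<^bsub>B\<^esub>"
      using star_hom_zero[OF cstar cstar_algebra_bounded_operators \<pi>(1)] \<pi>(2)[OF J] z by simp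
    then show False using matrix_unit_nonzero[OF J] by simp
  qed
  fix \<gamma> \<delta> assume J': "\<gamma> \<in> J" "\<delta> \<in> J"
  note W' = J_Words[OF J'(1)] J_Words[OF J'(2)]
  note carrier = w_carrier[OF W(1)] w_carrier[OF W(2)] w_carrier[OF W'(1)] w_carrier[OF W'(2)]
  have "unit_elem \<alpha> \<beta> \<otimes> unit_elem \<gamma> \<delta>
      = w \<alpha> \<otimes> (adj C (w \<beta>) \<otimes> w \<gamma>) \<otimes> adj C (w \<delta>)"
    by (simp add: unit_elem_def C.mult_assoc C.adj_closed C.mult_closed carrier)
  then show "unit_elem \<alpha> \<beta> \<otimes> unit_elem \<gamma> \<delta> = (if \<beta> = \<gamma> then unit_elem \<alpha> \<delta> else \<zero>)"
    using J(2) by (simp add: adj_w_mult_w[OF W(2) W'(1)] w_mult_p[OF W(1)] unit_elem_def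
        C.mult_zero C.adj_closed carrier)
qed

section \<open>The ideal\<close>

abbreviation "I \<equiv> closed_cspan C (unit_set unit_elem J)"

lemma word_isometry_mult_p:
  "\<alpha> \<in> Words \<Longrightarrow> \<alpha> \<noteq> [] \<Longrightarrow>
    word_isometry C s \<alpha> \<in> carrier C \<and> word_isometry C s \<alpha> \<otimes> p A = w \<alpha>"
  by (induction \<alpha> rule: induct_list012)
    (auto simp: s_carrier C.mult_closed C.mult_assoc p_carrier A_in)

lemma word_sandwich_eq_unit_elem:
  assumes "\<alpha> \<in> Words" "\<beta> \<in> Words"
  shows "word_sandwich C s \<alpha> (p A) \<beta> = unit_elem \<alpha> \<beta>"
proof -
  note pA = p_carrier[OF A_in]
  have left: "(if \<alpha> = [] then p A else word_isometry C s \<alpha> \<otimes> p A) = w \<alpha>"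
    using word_isometry_mult_p[OF assms(1)] by auto
  show ?thesis
  proof (cases "\<beta> = []")
    case True
    then show ?thesis
      by (simp add: word_sandwich_def Let_def left unit_elem_def p_adj A_in w_mult_p[OF assms(1)])
  next
    case False
    note \<beta> = word_isometry_mult_p[OF assms(2) False]
    have "w \<alpha> \<otimes> adj C (w \<beta>) = w \<alpha> \<otimes> (p A \<otimes> adj C (word_isometry C s \<beta>))"
      using \<beta> pA by (metis C.adj_mult p_adj A_in)
    also have "\<dots> = w \<alpha> \<otimes> adj C (word_isometry C s \<beta>)"
      using \<beta> by (simp add: C.mult_assoc[symmetric] w_carrier[OF assms(1)] pA C.adj_closed w_mult_p[OF assms(1)])
    finally show ?thesis using False by (simp add: word_sandwich_def Let_def left unit_elem_def)
  qed
qed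

lemma units_carrier: "unit_set unit_elem J \<subseteq> carrier C"
  by (rule C.unit_set_closed[OF matrix_units_unit_elem order_refl])

lemma span_subspace: "is_subspace C (cspan C (unit_set unit_elem J))"
  by (rule C.cspan_subspace[OF units_carrier])

lemma unit_elem_in_span:
  assumes "\<alpha> \<in> Words" "\<beta> \<in> Words"
  shows "unit_elem \<alpha> \<beta> \<in> cspan C (unit_set unit_elem J)"
proof (cases "\<alpha> \<in> J \<and> \<beta> \<in> J")
  case True
  then have "unit_elem \<alpha> \<beta> \<in> unit_set unit_elem J" unfolding unit_set_def by blast
  then show ?thesis using C.cspan_base[OF units_carrier] by blast
next
  case False
  then have "unit_elem \<alpha> \<beta> = \<zero>"
    using w_outside_J assms w_carrier by (auto simp: unit_elem_def C.adj_zero C.mult_zero C.adj_closed)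
  then show ?thesis using span_subspace by (simp add: is_subspace_def)
qed

text \<open>
  The spanning elements of the ideal whose words are not both in \<open>J\<close> vanish.
\<close>

lemma sinks_ideal_eq: "sinks_ideal G lab C p s A = I"
proof -
  let ?P = "labeled_paths G lab \<union> {[]}"
  let ?T = "{word_sandwich C s \<alpha> (p A) \<beta> | \<alpha> \<beta>. \<alpha> \<in> ?P \<and> \<beta> \<in> ?P}"
  have P: "\<alpha> \<in> Words" if "\<alpha> \<in> ?P" for \<alpha> using that labeled_paths_letters by auto
  have T: "?T \<subseteq> cspan C (unit_set unit_elem J)"
  proof
    fix u assume "u \<in> ?T"
    then obtain \<alpha> \<beta> where u: "u = word_sandwich C s \<alpha> (p A) \<beta>" and \<alpha>\<beta>: "\<alpha> \<in> ?P" "\<beta> \<in> ?P" by blast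
    note W = P[OF \<alpha>\<beta>(1)] P[OF \<alpha>\<beta>(2)]
    show "u \<in> cspan C (unit_set unit_elem J)"
      unfolding u word_sandwich_eq_unit_elem[OF W] by (rule unit_elem_in_span[OF W])
  qed
  have "unit_set unit_elem J \<subseteq> ?T"
  proof
    fix u assume "u \<in> unit_set unit_elem J"
    then obtain \<alpha> \<beta> where u: "u = unit_elem \<alpha> \<beta>" and J: "\<alpha> \<in> J" "\<beta> \<in> J" unfolding unit_set_def by blast
    have "u = word_sandwich C s \<alpha> (p A) \<beta>"
      unfolding u by (rule word_sandwich_eq_unit_elem[OF J_Words[OF J(1)] J_Words[OF J(2)], symmetric])
    then show "u \<in> ?T" using subsetD[OF J_subset J(1)] subsetD[OF J_subset J(2)] by blast
  qed
  then have "cspan C (unit_set unit_elem J) \<subseteq> cspan C ?T" by (rule C.cspan_mono)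
  moreover have "cspan C ?T \<subseteq> cspan C (unit_set unit_elem J)" by (rule C.cspan_subset[OF span_subspace T])
  ultimately have "cspan C ?T = cspan C (unit_set unit_elem J)" by blast
  then show ?thesis unfolding sinks_ideal_def closed_cspan_def by simp
qed

lemma I_subspace: "is_subspace C I"
  by (rule C.closed_cspan_subspace[OF units_carrier])

lemma I_carrier: "x \<in> I \<Longrightarrow> x \<in> carrier C"
  using I_subspace by (auto simp: is_subspace_def)

lemma I_closed: "closedin (ctopology C) I"
  unfolding closed_cspan_def by (rule closedin_closure_of)

lemma I_adj:
  assumes "x \<in> I"
  shows "adj C x \<in> I"
proof (rule C.closed_cspan_image[OF units_carrier assms])
  show "cnorm C (adj C x \<ominus> adj C y) \<le> 1 * cnorm C (x \<ominus> y)"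
    if "x \<in> carrier C" "y \<in> carrier C" for x y
    using that by (simp add: C.adj_minus[symmetric] C.cnorm_adj)
  show "adj C x \<in> I" if "x \<in> cspan C (unit_set unit_elem J)" for x
    using C.cspan_unit_set_adj[OF matrix_units_unit_elem order_refl that]
      C.cspan_subset_closed_cspan[OF units_carrier] by blast
qed (rule C.adj_closed)

lemma mult_closed_cspan:
  assumes g: "g \<in> carrier C"
    and units: "\<And>\<alpha> \<beta>. \<lbrakk>\<alpha> \<in> J; \<beta> \<in> J\<rbrakk> \<Longrightarrow> g \<otimes> unit_elem \<alpha> \<beta> \<in> I"
    and y: "y \<in> I"
  shows "g \<otimes> y \<in> I"
proof (rule C.closed_cspan_image[OF units_carrier y, where L = "\<lambda>x. g \<otimes> x"])
  show "g \<otimes> x \<in> carrier C" if "x \<in> carrier C" for x by (rule C.mult_closed[OF g that])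
  show "cnorm C (g \<otimes> x \<ominus> g \<otimes> y) \<le> cnorm C g * cnorm C (x \<ominus> y)"
    if "x \<in> carrier C" "y \<in> carrier C" for x y
    using that g C.cnorm_mult[OF g, of "x \<ominus> y"] by (simp add: C.minus_mult)
  show "g \<otimes> x \<in> I" if x: "x \<in> cspan C (unit_set unit_elem J)" for x
  proof -
    let ?W = "{x \<in> carrier C. g \<otimes> x \<in> I}"
    have "is_subspace C ?W"
      using I_subspace g by (auto simp: is_subspace_def C.mult_add_right C.mult_smult_right C.mult_zero)
    moreover have "unit_set unit_elem J \<subseteq> ?W"
      using units units_carrier unfolding unit_set_def by blast
    ultimately show ?thesis using C.cspan_subset x by blast
  qed
qed

lemma unit_elem_in_I: "\<alpha> \<in> Words \<Longrightarrow> \<beta> \<in> Words \<Longrightarrow> unit_elem \<alpha> \<beta> \<in> I"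
  using unit_elem_in_span C.cspan_subset_closed_cspan[OF units_carrier] by blast

lemma zero_in_I: "\<zero> \<in> I"
  using I_subspace by (simp add: is_subspace_def)

lemma mult_unit_elem:
  assumes "g \<in> carrier C" "\<alpha> \<in> Words" "\<beta> \<in> Words"
  shows "g \<otimes> unit_elem \<alpha> \<beta> = (g \<otimes> w \<alpha>) \<otimes> adj C (w \<beta>)"
  using assms by (simp add: unit_elem_def C.mult_assoc C.adj_closed w_carrier del: mem_Collect_eq)

text \<open>
  The elements \<open>x\<close> for which \<open>x\<close> and \<open>x\<^sup>*\<close> both multiply \<open>I\<close> into itself form a C*-subalgebra. It
  contains the generators, because a generator or its adjoint sends \<open>w \<alpha>\<close> to some \<open>w \<beta>\<close> or to
  zero.
\<close>

lemma I_left_ideal: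
  assumes "x \<in> carrier C" "y \<in> I"
  shows "x \<otimes> y \<in> I"
proof -
  interpret Metric_space "carrier C" "cdist C" by (rule C.Metric_space_cdist)
  \<comment> \<open>Asking for \<open>adj C x\<close> too makes the set closed under adjoints.\<close>
  let ?N = "{x \<in> carrier C. \<forall>y\<in>I. x \<otimes> y \<in> I \<and> adj C x \<otimes> y \<in> I}"
  have "cstar_subalgebra C ?N"
    unfolding cstar_subalgebra_def
  proof (intro conjI ballI)
    show "is_subspace C ?N"
      using I_subspace I_carrier
      by (auto simp: is_subspace_def C.mult_zero C.adj_zero C.mult_add_left C.mult_smult_left C.adj_add
          C.adj_smult C.adj_closed)
    show "x \<otimes> y \<in> ?N" if "x \<in> ?N" "y \<in> ?N" for x y
      using that I_carrier by (auto simp: C.mult_closed C.mult_assoc C.adj_mult C.adj_closed)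
    show "adj C x \<in> ?N" if "x \<in> ?N" for x
      using that by (auto simp: C.adj_closed C.adj_adj)
    show "closedin (ctopology C) ?N"
      unfolding metric_closedin_iff_sequentially_closed
    proof (intro conjI allI impI)
      show "?N \<subseteq> carrier C" by auto
      fix \<sigma> l assume "range \<sigma> \<subseteq> ?N \<and> limitin (ctopology C) \<sigma> l sequentially"
      then have \<sigma>: "\<And>n. \<sigma> n \<in> ?N" and l: "l \<in> carrier C" and lim: "(\<lambda>n. cdist C (\<sigma> n) l) \<longlonglongrightarrow> 0"
        by (auto simp: limitin_metric_dist_null)
      have \<sigma>C: "\<sigma> n \<in> carrier C" for n using \<sigma> by simp
      have I_limit: "z \<in> I" if z: "z \<in> carrier C" "\<And>n. u n \<in> I"
        "\<And>n. cnorm C (u n \<ominus> z) \<le> cdist C (\<sigma> n) l * K" for z u K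
      proof -
        have uC: "u n \<in> carrier C" for n by (rule I_carrier[OF that(2)])
        have "(\<lambda>n. cdist C (u n) z) \<longlonglongrightarrow> 0"
        proof (rule tendsto_sandwich[OF _ _ tendsto_const])
          show "\<forall>\<^sub>F n in sequentially. 0 \<le> cdist C (u n) z" by simp
          show "\<forall>\<^sub>F n in sequentially. cdist C (u n) z \<le> cdist C (\<sigma> n) l * K"
            using z(3) by (simp add: cdist_def uC z(1))
          show "(\<lambda>n. cdist C (\<sigma> n) l * K) \<longlonglongrightarrow> 0" using tendsto_mult_left_zero[OF lim] .
        qed
        then have "limitin (ctopology C) u z sequentially"
          using uC z(1) by (simp add: limitin_metric_dist_null)
        then show ?thesis
          using I_closed that(2) unfolding metric_closedin_iff_sequentially_closed by blast
      qed
      have "l \<otimes> y \<in> I \<and> adj C l \<otimes> y \<in> I" if y: "y \<in> I" for y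
      proof
        note yC = I_carrier[OF y]
        show "l \<otimes> y \<in> I"
        proof (rule I_limit[of _ "\<lambda>n. \<sigma> n \<otimes> y"])
          show "cnorm C (\<sigma> n \<otimes> y \<ominus> l \<otimes> y) \<le> cdist C (\<sigma> n) l * cnorm C y" for n
            using C.cnorm_mult[of "\<sigma> n \<ominus> l" y] \<sigma>C l yC by (simp add: C.minus_mult cdist_def)
        qed (use \<sigma> y l yC in \<open>auto simp: C.mult_closed\<close>)
        show "adj C l \<otimes> y \<in> I"
        proof (rule I_limit[of _ "\<lambda>n. adj C (\<sigma> n) \<otimes> y"])
          show "cnorm C (adj C (\<sigma> n) \<otimes> y \<ominus> adj C l \<otimes> y) \<le> cdist C (\<sigma> n) l * cnorm C y" for n
          proof -
            have "adj C (\<sigma> n) \<otimes> y \<ominus> adj C l \<otimes> y = adj C (\<sigma> n \<ominus> l) \<otimes> y"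
              using \<sigma>C l yC by (simp add: C.minus_mult C.adj_minus C.adj_closed)
            then show ?thesis
              using C.cnorm_mult[of "adj C (\<sigma> n \<ominus> l)" y] \<sigma>C l yC
              by (simp add: cdist_def C.cnorm_adj C.adj_closed)
          qed
        qed (use \<sigma> y l yC in \<open>auto simp: C.mult_closed C.adj_closed\<close>)
      qed
      then show "l \<in> ?N" using l by simp
    qed
  qed
  moreover have "p ` \<B> \<union> s ` labels G lab \<subseteq> ?N"
  proof -
    have pN: "p Y \<in> ?N" if Y: "Y \<in> \<B>" for Y
    proof -
      have "p Y \<otimes> unit_elem \<alpha> \<beta> \<in> I" if J: "\<alpha> \<in> J" "\<beta> \<in> J" for \<alpha> \<beta>
        using unit_elem_in_I[OF J_Words J_Words, OF J] zero_in_I w_carrier[OF J_Words[OF J(2)]]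
        by (simp add: mult_unit_elem[OF p_carrier[OF Y] J_Words[OF J(1)] J_Words[OF J(2)]]
            p_mult_w[OF J_Words[OF J(1)] Y] unit_elem_def[symmetric] C.mult_zero C.adj_closed)
      then have "p Y \<otimes> y \<in> I" if "y \<in> I" for y
        using mult_closed_cspan[OF p_carrier[OF Y] _ that] by blast
      then show ?thesis using Y by (simp add: p_carrier p_adj)
    qed
    have sN: "s a \<in> ?N" if a: "a \<in> labels G lab" for a
    proof -
      have "s a \<otimes> unit_elem \<alpha> \<beta> \<in> I" if J: "\<alpha> \<in> J" "\<beta> \<in> J" for \<alpha> \<beta>
      proof -
        have "a # \<alpha> \<in> Words" using J_Words[OF J(1)] a by simp
        then show ?thesis
          using unit_elem_in_I[of "a # \<alpha>" \<beta>] J_Words[OF J(2)]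
          unfolding mult_unit_elem[OF s_carrier[OF a] J_Words[OF J(1)] J_Words[OF J(2)]]
          by (simp add: unit_elem_def)
      qed
      then have 1: "s a \<otimes> y \<in> I" if "y \<in> I" for y
        using mult_closed_cspan[OF s_carrier[OF a] _ that] by blast
      note sa = C.adj_closed[OF s_carrier[OF a]]
      have "adj C (s a) \<otimes> unit_elem \<alpha> \<beta> \<in> I" if J: "\<alpha> \<in> J" "\<beta> \<in> J" for \<alpha> \<beta>
      proof -
        note W = J_Words[OF J(1)] J_Words[OF J(2)]
        have zero: "\<zero> \<otimes> adj C (w \<beta>) \<in> I"
          using zero_in_I w_carrier[OF W(2)] by (simp add: C.mult_zero C.adj_closed)
        show ?thesis
        proof (cases \<alpha>)
          case Nil
          show ?thesis
            unfolding mult_unit_elem[OF sa W] unfolding Nil adj_s_mult_w_Nil[OF a] by (rule zero)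
        next
          case (Cons b \<gamma>)
          have "\<gamma> \<in> Words" using W(1) Cons by simp
          then show ?thesis
            unfolding mult_unit_elem[OF sa W] unfolding Cons adj_s_mult_w_Cons[OF a W(1)[unfolded Cons]]
            using zero unit_elem_in_I[of \<gamma> \<beta>] W(2) by (simp add: unit_elem_def)
        qed
      qed
      then have 2: "adj C (s a) \<otimes> y \<in> I" if "y \<in> I" for y
        using mult_closed_cspan[OF sa _ that] by blast
      show ?thesis using 1 2 s_carrier[OF a] by simp
    qed
    show ?thesis using pN sN by blast
  qed
  ultimately have "?N = carrier C"
    using universal unfolding labeled_graph_cstar_algebra_def generated_by_def by blast
  then show ?thesis using assms by blast
qed

lemma I_right_ideal:
  assumes x: "x \<in> carrier C" and y: "y \<in> I"
  shows "y \<otimes> x \<in> I"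
proof -
  have "adj C (adj C x \<otimes> adj C y) \<in> I"
    by (rule I_adj[OF I_left_ideal[OF C.adj_closed[OF x] I_adj[OF y]]])
  then show ?thesis using x I_carrier[OF y] by (simp add: C.adj_mult C.adj_closed C.adj_adj)
qed

lemma closed_ideal_sinks_ideal: "closed_ideal C (sinks_ideal G lab C p s A)"
  unfolding sinks_ideal_eq closed_ideal_def
  using I_subspace I_closed I_left_ideal I_right_ideal by blast

lemma sinks_ideal_isomorphic_compact:
  "star_isomorphic (C\<lparr>carrier := sinks_ideal G lab C p s A\<rparr>) (compact_operator_algebra J)"
proof -
  obtain \<pi> where \<pi>: "\<pi> \<in> star_hom C B"
    "\<And>\<alpha> \<beta>. \<lbrakk>\<alpha> \<in> J; \<beta> \<in> J\<rbrakk> \<Longrightarrow> \<pi> (unit_elem \<alpha> \<beta>) = matrix_unit J \<alpha> \<beta>"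
    using exists_representation by blast
  have "matrix_unit_representation C J unit_elem \<pi>"
    by (rule matrix_unit_representation.intro[OF cstar matrix_units_unit_elem \<pi>])
  then show ?thesis
    unfolding sinks_ideal_eq by (rule matrix_unit_representation.star_isomorphic_compact_operators)
qed

end

theorem corollary4p3:
  fixes G :: "('v, 'e) pre_digraph" and lab :: "'e \<Rightarrow> 'a" and \<B> :: "'v set set"
    and C :: "'c cstar" and p :: "'v set \<Rightarrow> 'c" and s :: "'a \<Rightarrow> 'c"
    and A :: "'v set"
  assumes "weakly_left_resolving_labeled_space G lab \<B>"
    and "labeled_graph_cstar_algebra G lab \<B> C p s"
    and "minimal_sinks_set G \<B> A"
  shows "closed_ideal C (sinks_ideal G lab C p s A) \<and>
    star_isomorphic (C\<lparr>carrier := sinks_ideal G lab C p s A\<rparr>)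
      (compact_operator_algebra (words_onto G lab A))"
proof -
  interpret minimal_sinks_cstar_algebra G lab \<B> A C p s
    using assms by (intro minimal_sinks_cstar_algebra.intro minimal_sinks_labeled_space.intro
        minimal_sinks_labeled_space_axioms.intro minimal_sinks_cstar_algebra_axioms.intro)
  show ?thesis using closed_ideal_sinks_ideal sinks_ideal_isomorphic_compact by blast
qed

end
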